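(* Let $\mathfrak T=(n_1,\dots,n_t)$ be a tower type of degree $n$ satisfying one of: (1) $n<8$; (2) $n=8$ and $\mathfrak T\neq(8)$; (3) $n$ is prime; (4) $\mathfrak T=(p,\dots,p)$ for a prime $p$; (5) $\mathfrak T=(2,p)$ for a prime $p$; (6) $\mathfrak T=(3,p)$ for a prime $p$. Then $T(\mathfrak T)$ is the unique minimal element, with respect to the pointwise partial order, of the set of flag types $T_{\mathcal F}$ where $\mathcal F$ ranges over flags (of finite abelian groups or finite field extensions) of tower type $\mathfrak T$.
   Context: Let $[n]=\{0,\dots,n-1\}$. A flag of a finite abelian group $G$ of order $n$ (written multiplicatively) is a chain of subsets $\{1\}=F_0\subset\cdots\subset F_{n-1}=G$ with $|F_i|=i+1$; a flag of a degree $n$ field extension $L/K$ is a chain of $K$-subspaces $K=F_0\subset\cdots\subset F_{n-1}=L$ with $\dim_KF_i=i+1$. The flag type of a flag is $T_{\mathcal F}:[n]\times[n]\to[n]$, $T_{\mathcal F}(i,j)=\min\{k: F_iF_j\subseteq F_k\}$, where $F_iF_j$ is the set of products (groups) or the $K$-span of products (fields). Partial order: $T\le T'$ iff $T(i,j)\le T'(i,j)$ for all $i,j$. The tower type of a flag of $G$: the distinct subgroups generated by the sets $F_i$, $i\in[n]$, form a chain $\{1\}=G_0\subset G_1\subset\cdots\subset G_t=G$, and the tower type is $(|G_1|/|G_0|,\dots,|G_t|/|G_{t-1}|)$; for a flag of $L/K$, the distinct subfields $K(F_i)$ generated over $K$ by the $F_i$ form a chain $K=L_0\subset\cdots\subset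 L_t=L$ and the tower type is $([L_1:L_0],\dots,[L_t:L_{t-1}])$. A tower type of degree $n$ is a tuple $(n_1,\dots,n_t)$ of integers $>1$ with product $n$. Writing $i\in[n]$ in mixed radix notation $i=i_1+i_2n_1+\cdots+i_tn_1\cdots n_{t-1}$ ($0\le i_s<n_s$), let $H=C_{n_1}\times\cdots\times C_{n_t}$, $e_s$ a generator of the $s$-th factor, $v_i=e_1^{i_1}\cdots e_t^{i_t}$, $F_i=\{v_0,\dots,v_i\}$; $T(\mathfrak T)$ is the flag type of this flag of $H$. *)

theory Defs
  imports "HOL-Algebra.Algebra" "HOL-Computational_Algebra.Primes"
begin

definition tower_type_of_degree :: "nat list \<Rightarrow> nat \<Rightarrow> bool" where
  "tower_type_of_degree ns n \<longleftrightarrow> (\<forall>m\<in>set ns. 1 < m) \<and> prod_list ns = n"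

(* Flags are indexed by nat; only the values F i with i < n matter.
   The flag type is a function on {..<n} \<times> {..<n}, encoded as an extensional
   function so that equality of flag types is equality on that domain. *)
definition flag_type ::
    "nat \<Rightarrow> ('a set \<Rightarrow> 'a set \<Rightarrow> 'a set) \<Rightarrow> (nat \<Rightarrow> 'a set) \<Rightarrow> nat \<times> nat \<Rightarrow> nat" where
  "flag_type n setprod F =
     (\<lambda>(i, j)\<in>{..<n} \<times> {..<n}. LEAST k. k < n \<and> setprod (F i) (F j) \<subseteq> F k)"

definition flag_type_le :: "nat \<Rightarrow> (nat \<times> nat \<Rightarrow> nat) \<Rightarrow> (nat \<times> nat \<Rightarrow> nat) \<Rightarrow> bool" where
  "flag_type_le n T T' \<longleftrightarrow> (\<forall>i<n. \<forall>j<n. T (i, j) \<le> T' (i, j))"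

definition minimal_elements :: "('b \<Rightarrow> 'b \<Rightarrow> bool) \<Rightarrow> 'b set \<Rightarrow> 'b set" where
  "minimal_elements leq S = {x \<in> S. \<forall>y\<in>S. leq y x \<longrightarrow> y = x}"

definition group_flag :: "('a, 'm) monoid_scheme \<Rightarrow> (nat \<Rightarrow> 'a set) \<Rightarrow> bool" where
  "group_flag G F \<longleftrightarrow>
     comm_group G \<and> finite (carrier G) \<and>
     F 0 = {\<one>\<^bsub>G\<^esub>} \<and> F (order G - 1) = carrier G \<and>
     (\<forall>i. Suc i < order G \<longrightarrow> F i \<subset> F (Suc i)) \<and>
     (\<forall>i < order G. card (F i) = i + 1)"

definition group_flag_type ::
    "('a, 'm) monoid_scheme \<Rightarrow> (nat \<Rightarrow> 'a set) \<Rightarrow> nat \<times> nat \<Rightarrow> nat" where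
  "group_flag_type G F = flag_type (order G) (set_mult G) F"

(* Gs lists the distinct subgroups generated by the F i in increasing order. *)
definition group_flag_has_tower_type ::
    "('a, 'm) monoid_scheme \<Rightarrow> (nat \<Rightarrow> 'a set) \<Rightarrow> nat list \<Rightarrow> bool" where
  "group_flag_has_tower_type G F ns \<longleftrightarrow>
     (\<exists>Gs. length Gs = length ns + 1 \<and> sorted_wrt (\<subset>) Gs \<and>
        set Gs = (\<lambda>i. generate G (F i)) ` {..< order G} \<and>
        (\<forall>s<length ns. card (Gs ! Suc s) = ns ! s * card (Gs ! s)))"

definition field_extension :: "('a, 'm) ring_scheme \<Rightarrow> 'a set \<Rightarrow> nat \<Rightarrow> bool" where
  "field_extension L K n \<longleftrightarrow> field L \<and> subfield K L \<and> ring.dimension L n K (carrier L)"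

(* For a subfield K, ring.dimension L m K V entails that V is a K-subspace of L. *)
definition field_flag ::
    "('a, 'm) ring_scheme \<Rightarrow> 'a set \<Rightarrow> nat \<Rightarrow> (nat \<Rightarrow> 'a set) \<Rightarrow> bool" where
  "field_flag L K n F \<longleftrightarrow>
     field_extension L K n \<and>
     F 0 = K \<and> F (n - 1) = carrier L \<and>
     (\<forall>i. Suc i < n \<longrightarrow> F i \<subset> F (Suc i)) \<and>
     (\<forall>i<n. ring.dimension L (i + 1) K (F i))"

(* ring.Span is defined for lists; the span of a set is the union over all
   lists of its elements. *)
definition set_span :: "('a, 'm) ring_scheme \<Rightarrow> 'a set \<Rightarrow> 'a set \<Rightarrow> 'a set" where
  "set_span L K S = (\<Union>us\<in>{us. set us \<subseteq> S}. ring.Span L K us)"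

definition field_flag_type ::
    "('a, 'm) ring_scheme \<Rightarrow> 'a set \<Rightarrow> nat \<Rightarrow> (nat \<Rightarrow> 'a set) \<Rightarrow> nat \<times> nat \<Rightarrow> nat" where
  "field_flag_type L K n F = flag_type n (\<lambda>A B. set_span L K (A <#>\<^bsub>L\<^esub> B)) F"

definition field_flag_has_tower_type ::
    "('a, 'm) ring_scheme \<Rightarrow> 'a set \<Rightarrow> nat \<Rightarrow> (nat \<Rightarrow> 'a set) \<Rightarrow> nat list \<Rightarrow> bool" where
  "field_flag_has_tower_type L K n F ns \<longleftrightarrow>
     (\<exists>Ls. length Ls = length ns + 1 \<and> sorted_wrt (\<subset>) Ls \<and>
        set Ls = (\<lambda>i. generate_field L (K \<union> F i)) ` {..<n} \<and>
        (\<forall>s<length ns. ring.dimension L (ns ! s) (Ls ! s) (Ls ! Suc s)))"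

(* HOL cannot quantify over all types inside a formula, so the groups live on a
   type 'g and the fields on a type 'f.  If 'g is infinite, every finite abelian
   group has a copy on 'g; 'f is left arbitrary. *)
definition flag_types :: "'g itself \<Rightarrow> 'f itself \<Rightarrow> nat list \<Rightarrow> (nat \<times> nat \<Rightarrow> nat) set" where
  "flag_types (_ :: 'g itself) (_ :: 'f itself) ns =
     {group_flag_type G F | (G :: 'g monoid) F.
        group_flag G F \<and> group_flag_has_tower_type G F ns} \<union>
     {field_flag_type L K n F | (L :: 'f ring) K n F.
        field_flag L K n F \<and> field_flag_has_tower_type L K n F ns}"

(* Indices are shifted: position s < length ns is the (s+1)-st factor. *)
definition mixed_radix_digit :: "nat list \<Rightarrow> nat \<Rightarrow> nat \<Rightarrow> nat" where
  "mixed_radix_digit ns i s = i div prod_list (take s ns) mod ns ! s"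

definition tower_group :: "nat list \<Rightarrow> (nat \<Rightarrow> int) monoid" where
  "tower_group ns = product_group {..<length ns} (\<lambda>s. integer_mod_group (ns ! s))"

definition tower_gen :: "nat list \<Rightarrow> nat \<Rightarrow> nat \<Rightarrow> int" where
  "tower_gen ns s = (\<lambda>r\<in>{..<length ns}. if r = s then 1 else 0)"

definition tower_elem :: "nat list \<Rightarrow> nat \<Rightarrow> nat \<Rightarrow> int" where
  "tower_elem ns i =
     finprod (tower_group ns)
       (\<lambda>s. tower_gen ns s [^]\<^bsub>tower_group ns\<^esub> mixed_radix_digit ns i s) {..<length ns}"

definition tower_flag :: "nat list \<Rightarrow> nat \<Rightarrow> (nat \<Rightarrow> int) set" where
  "tower_flag ns i = tower_elem ns ` {..i}"

definition tower_flag_type :: "nat list \<Rightarrow> nat \<times> nat \<Rightarrow> nat" where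
  "tower_flag_type ns = group_flag_type (tower_group ns) (tower_flag ns)"

end

theory Submission
  imports Defs
begin

text \<open>
  If \<open>F\<close> is a flag, then \<open>T\<^sub>F(i, j) + 1\<close> is at least the dimension of \<open>F\<^sub>i F\<^sub>j\<close>, so lower bounds for the
  dimension of a product set are needed; for the tower flag the minimum of
  \<open>(\<lceil>a/d\<rceil> + \<lceil>b/d\<rceil> - 1) d\<close> over the degrees \<open>d\<close> of the tower, where \<open>a = i + 1\<close> and \<open>b = j + 1\<close>, is an
  upper bound. It remains to prove a Kneser type inequality, numerical in \<open>d\<close>, that is also valid for
  inseparable extensions.

  Groups and fields are treated together: in both cases there is a commutative group \<open>G\<close> (for a field, its
  unit group) with a translation invariant modular rank function on a lattice of flats. For a flat \<open>S\<close> the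
  function \<open>T \<mapsto> rk (S T) - rk T\<close> is submodular and translation invariant, and the orthogonal complement with
  respect to a hyperplane is a duality for it. By Hamidoune's argument a smallest minimiser containing \<open>1\<close>
  among the \<open>T\<close> with \<open>S T \<noteq> G\<close> is a subgroup \<open>H\<close>. Cutting \<open>S\<close> and \<open>T\<close> along cosets of \<open>H\<close> reduces the
  inequality to products inside \<open>H\<close>, and if the divisors of \<open>rk H\<close> form a chain the resulting bounds can be glued.
  In each case of the theorem the rank of \<open>H\<close> is a prime power or \<open>H\<close> is excluded by the tower type.
\<close>

section \<open>Numerical bounds\<close>

text \<open>The tower flag meets the upper bound for every degree \<open>d\<close> of the tower at
  once, so a lower bound may use whichever degree it likes. Hence the stabilizer of a product never
  has to be identified; only the number \<open>d\<close> is carried through the proof. The obstacle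
  is a divisor of the degree that is not a degree of the tower: 4 for (2,4), 3 for (6), p for (2,p)
  and (3,p). If the subgroup \<open>H\<close> has such a rank, a member \<open>S\<close> of the flag
  inside \<open>H\<close> would contradict the tower type, so \<open>S H\<close> has at least twice
  the rank of \<open>H\<close>, while still being proper. Index 2 leaves no room for this and index
  3 leaves a single value, for which minimality of \<open>H\<close> gives a strong enough
  inequality; this is where the 2 and the 3 in the last two families come from. The divisor 2 for
  (4), (4,2) and (6) is harmless for arithmetical reasons once small indices are treated by
  hand.\<close>

text \<open>\<open>up d a\<close> is the least multiple of \<open>d\<close> that is at least \<open>a\<close>, provided that \<open>a\<close> and \<open>d\<close> are positive.\<close>

definition up :: "nat \<Rightarrow> nat \<Rightarrow> nat" where
  "up d a = ((a - 1) div d + 1) * d"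

lemma dvd_up: "d dvd up d a"
  by (simp add: up_def)

lemma up_least:
  assumes "d dvd m" "a \<le> m" "0 < a"
  shows "up d a \<le> m"
proof -
  obtain k where k: "m = d * k" using assms(1) by blast
  have "a - 1 < k * d" using assms k by (auto simp: mult.commute)
  then have "(a - 1) div d < k" by (simp add: less_mult_imp_div_less)
  then have "((a - 1) div d + 1) * d \<le> k * d" by (intro mult_le_mono1) simp
  then show ?thesis by (simp add: up_def k mult.commute)
qed

lemma up_ge:
  assumes "0 < d"
  shows "a \<le> up d a"
proof -
  have "a - 1 < ((a - 1) div d + 1) * d"
    using assms by (metis Suc_eq_plus1 dividend_less_div_times add.commute mult_Suc)
  then show ?thesis unfolding up_def by linarith
qed

lemma up_le_add: "0 < a \<Longrightarrow> up d a < a + d"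
  by (simp add: up_def) (metis One_nat_def Suc_pred div_times_less_eq_dividend le_imp_less_Suc add.commute
      add_less_cancel_right)

lemma up_gt_multiple:
  assumes "d dvd m" "m < a" "0 < d"
  shows "m + d \<le> up d a"
proof -
  have "m < up d a" using assms up_ge[of d a] by linarith
  with assms(1) dvd_up[of d a] obtain i j where "m = d * i" "up d a = d * j" by blast
  with \<open>m < up d a\<close> have "i + 1 \<le> j" by simp
  then have "d * (i + 1) \<le> d * j" by (rule mult_le_mono2)
  then show ?thesis using \<open>m = d * i\<close> \<open>up d a = d * j\<close> by simp
qed

text \<open>The inequality \<open>v \<ge> (\<lceil>a/d\<rceil> + \<lceil>b/d\<rceil> - 1) d\<close>, written without subtraction.\<close>

definition kneser_bound :: "nat \<Rightarrow> nat \<Rightarrow> nat \<Rightarrow> nat \<Rightarrow> bool" where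
  "kneser_bound d a b v \<longleftrightarrow> up d a + up d b \<le> v + d"

lemma kneser_bound_commute: "kneser_bound d a b v \<longleftrightarrow> kneser_bound d b a v"
  by (simp add: kneser_bound_def add.commute)

lemma kneser_bound_mono: "kneser_bound d a b v \<Longrightarrow> v \<le> w \<Longrightarrow> kneser_bound d a b w"
  by (simp add: kneser_bound_def)

text \<open>A set of rank \<open>c\<close> meets a coset of a subgroup of rank \<open>h\<close> in a
  piece of rank \<open>r\<close>, and adding the whole coset gives rank \<open>b\<close>. The finer
  of the two divisors survives: the rounded ranks of the parts combine to a multiple of it, which is
  what comparability buys. The rounding of \<open>a\<close> for the coarser divisor cancels, because
  \<open>a\<close> exceeds the multiple \<open>m\<close> of \<open>h\<close> and therefore rounds up
  to at least one full divisor beyond \<open>m\<close>.\<close>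

lemma kneser_bound_glue:
  assumes d: "0 < d" "d dvd h" and d': "0 < d'" "d' dvd h" and comp: "d dvd d' \<or> d' dvd d"
    and m: "h dvd m" "m < a"
    and b1: "kneser_bound d' a r v1" and b2: "kneser_bound d a b v2"
    and r: "0 < r" and c: "0 < c" "c + h = b + r" and v: "v1 + v2 \<le> v + m + h"
  shows "kneser_bound d a c v \<or> kneser_bound d' a c v"
proof -
  have r': "r \<le> up d' r" and b': "b \<le> up d b" using d d' up_ge by auto
  have md: "m + d \<le> up d a" and md': "m + d' \<le> up d' a"
    using up_gt_multiple m d d' by (meson dvd_trans)+
  have le: "h \<le> up d b + up d' r" using r' b' c by linarith
  from comp show ?thesis
  proof
    assume "d dvd d'"
    then have "d dvd up d b + up d' r - h"
      using d le dvd_up by (meson dvd_add dvd_diff_nat dvd_trans)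
    then have "up d c \<le> up d b + up d' r - h" using c r' b' by (intro up_least) auto
    then have "kneser_bound d a c v" using le b1 b2 md' v unfolding kneser_bound_def by linarith
    then show ?thesis ..
  next
    assume "d' dvd d"
    then have "d' dvd up d b + up d' r - h"
      using d' le dvd_up by (meson dvd_add dvd_diff_nat dvd_trans)
    then have "up d' c \<le> up d b + up d' r - h" using c r' b' by (intro up_least) auto
    then have "kneser_bound d' a c v" using le b1 b2 md v unfolding kneser_bound_def by linarith
    then show ?thesis ..
  qed
qed

text \<open>In rank \<open>n\<close>, \<open>c\<close> stands for the rank of the orthogonal
  complement of a product \<open>S T\<close> and \<open>b\<close> for the rank of \<open>T\<close>;
  \<open>v + b \<le> n\<close> records that \<open>S\<close> maps this complement into the
  complement of \<open>T\<close>. Subtracting the bound for \<open>v\<close> from \<open>n\<close>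
  leaves a multiple of \<open>d\<close> that is at least \<open>b\<close>, hence at least
  \<open>up d b\<close>.\<close>

lemma kneser_bound_dual:
  assumes "0 < d" "d dvd n" "kneser_bound d a c v" "v + b \<le> n" "0 < b"
  shows "kneser_bound d a b (n - c)"
proof -
  have "c \<le> up d c" using assms up_ge by simp
  let ?w = "up d a + up d c - d"
  have ac: "d \<le> up d a" by (simp add: up_def)
  have w: "?w + b \<le> n" using assms(3,4) unfolding kneser_bound_def by linarith
  have "d dvd n - ?w"
    using assms(2) dvd_up by (meson dvd_add dvd_diff_nat dvd_refl)
  then have "up d b \<le> n - ?w" using w assms by (intro up_least) auto
  then show ?thesis using w ac \<open>c \<le> up d c\<close> unfolding kneser_bound_def by linarith
qed

section \<open>Translation invariant modular matroids\<close>

text \<open>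
  Models: all subsets of a finite abelian group, with the cardinality; and the sets \<open>V - {0}\<close> for the
  subspaces \<open>V\<close> of a finite field extension, with the dimension.
\<close>

locale translation_matroid = comm_group G for G (structure) +
  fixes flat :: "'a set \<Rightarrow> bool" and rk :: "'a set \<Rightarrow> nat"
  assumes flat_subset: "flat A \<Longrightarrow> A \<subseteq> carrier G"
    and flat_carrier: "flat (carrier G)"
    and flat_empty: "flat {}"
    and flat_Inter: "\<F> \<noteq> {} \<Longrightarrow> \<forall>A\<in>\<F>. flat A \<Longrightarrow> flat (\<Inter>\<F>)"
    and flat_translate: "flat A \<Longrightarrow> g \<in> carrier G \<Longrightarrow> flat (g <# A)"
    and rk_translate: "flat A \<Longrightarrow> g \<in> carrier G \<Longrightarrow> rk (g <# A) = rk A"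
    and rk_less: "flat A \<Longrightarrow> flat Y \<Longrightarrow> A \<subset> Y \<Longrightarrow> rk A < rk Y"
    and rk_empty: "rk {} = 0"
    and rk_one: "rk (\<Inter>{A. flat A \<and> \<one> \<in> A}) = 1"
    and rk_modular: "flat A \<Longrightarrow> flat Y \<Longrightarrow>
      rk (\<Inter>{W. flat W \<and> A \<union> Y \<subseteq> W}) + rk (A \<inter> Y) = rk A + rk Y"
begin

section \<open>Closure, translates and closed products\<close>

definition cl :: "'a set \<Rightarrow> 'a set" where
  "cl U = \<Inter>{A. flat A \<and> U \<subseteq> A}"

definition prd :: "'a set \<Rightarrow> 'a set \<Rightarrow> 'a set" where
  "prd S T = cl (S <#> T)"

text \<open>In a field these are the unit groups of the intermediate fields: the flat gives closure
  under addition, the subgroup closure under products and inverses.\<close>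

definition flat_subgroup :: "'a set \<Rightarrow> bool" where
  "flat_subgroup H \<longleftrightarrow> flat H \<and> subgroup H G"

lemma flat_Int: "flat A \<Longrightarrow> flat Y \<Longrightarrow> flat (A \<inter> Y)"
  using flat_Inter[of "{A, Y}"] by auto

lemma flat_cl: "U \<subseteq> carrier G \<Longrightarrow> flat (cl U)"
  unfolding cl_def using flat_carrier by (intro flat_Inter) auto

lemma cl_incl: "U \<subseteq> cl U"
  by (auto simp: cl_def)

lemma cl_least: "flat A \<Longrightarrow> U \<subseteq> A \<Longrightarrow> cl U \<subseteq> A"
  by (auto simp: cl_def)

lemma cl_flat: "flat A \<Longrightarrow> cl A = A"
  using cl_least cl_incl by blast

lemma cl_mono: "U \<subseteq> V \<Longrightarrow> cl U \<subseteq> cl V"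
  by (auto simp: cl_def)

lemma cl_carrier: "U \<subseteq> carrier G \<Longrightarrow> cl U \<subseteq> carrier G"
  by (intro cl_least flat_carrier)

lemma rk_mono: "flat A \<Longrightarrow> flat Y \<Longrightarrow> A \<subseteq> Y \<Longrightarrow> rk A \<le> rk Y"
  using rk_less by (metis order_le_less psubsetI nat_less_le)

lemma flat_eqI: "flat A \<Longrightarrow> flat Y \<Longrightarrow> A \<subseteq> Y \<Longrightarrow> rk Y \<le> rk A \<Longrightarrow> A = Y"
  using rk_less by (metis leD psubsetI)

lemma modular: "flat A \<Longrightarrow> flat Y \<Longrightarrow> rk (cl (A \<union> Y)) + rk (A \<inter> Y) = rk A + rk Y"
  using rk_modular by (simp add: cl_def)

lemma rk_pos: "flat A \<Longrightarrow> A \<noteq> {} \<Longrightarrow> 0 < rk A"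
  using rk_less[OF flat_empty] rk_empty by (metis bot.not_eq_extremum)

lemma mem_lcos:
  assumes "A \<subseteq> carrier G" "g \<in> carrier G" "y \<in> carrier G"
  shows "y \<in> g <# A \<longleftrightarrow> inv g \<otimes> y \<in> A"
proof
  assume "y \<in> g <# A"
  then obtain x where "x \<in> A" "y = g \<otimes> x" unfolding l_coset_def by auto
  then show "inv g \<otimes> y \<in> A" using assms by (simp add: m_assoc[symmetric] subset_iff)
next
  assume "inv g \<otimes> y \<in> A"
  moreover have "y = g \<otimes> (inv g \<otimes> y)" using assms by (simp add: m_assoc[symmetric])
  ultimately show "y \<in> g <# A" unfolding l_coset_def by blast
qed

lemma lcos_carrier: "A \<subseteq> carrier G \<Longrightarrow> g \<in> carrier G \<Longrightarrow> g <# A \<subseteq> carrier G"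
  unfolding l_coset_def by auto

lemma lcos_mono: "A \<subseteq> Y \<Longrightarrow> g <# A \<subseteq> g <# Y"
  unfolding l_coset_def by auto

lemma lcos_inv_lcos: "A \<subseteq> carrier G \<Longrightarrow> g \<in> carrier G \<Longrightarrow> inv g <# (g <# A) = A"
  by (simp add: lcos_m_assoc lcos_mult_one)

lemma lcos_lcos_inv: "A \<subseteq> carrier G \<Longrightarrow> g \<in> carrier G \<Longrightarrow> g <# (inv g <# A) = A"
  by (simp add: lcos_m_assoc lcos_mult_one)

lemma one_mem_inv_lcos: "x \<in> A \<Longrightarrow> A \<subseteq> carrier G \<Longrightarrow> \<one> \<in> inv x <# A"
  by (subst mem_lcos) auto

lemma cl_lcos:
  assumes "U \<subseteq> carrier G" "g \<in> carrier G"
  shows "cl (g <# U) = g <# cl U"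
proof
  show "cl (g <# U) \<subseteq> g <# cl U"
    using assms by (intro cl_least flat_translate flat_cl lcos_mono cl_incl)
  have "U \<subseteq> inv g <# cl (g <# U)"
    using lcos_mono[OF cl_incl[of "g <# U"], of "inv g"] lcos_inv_lcos[OF assms] by simp
  then have "cl U \<subseteq> inv g <# cl (g <# U)"
    using assms by (intro cl_least flat_translate flat_cl lcos_carrier) auto
  then have "g <# cl U \<subseteq> g <# (inv g <# cl (g <# U))" by (rule lcos_mono)
  then show "g <# cl U \<subseteq> cl (g <# U)"
    using assms by (simp add: lcos_lcos_inv cl_carrier lcos_carrier)
qed

lemma set_mult_carrier: "S \<subseteq> carrier G \<Longrightarrow> T \<subseteq> carrier G \<Longrightarrow> S <#> T \<subseteq> carrier G"
  by (rule set_mult_closed)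

lemma set_mult_commute:
  assumes "S \<subseteq> carrier G" "T \<subseteq> carrier G" shows "S <#> T = T <#> S"
proof -
  have "S' <#> T' \<subseteq> T' <#> S'" if "S' \<subseteq> carrier G" "T' \<subseteq> carrier G" for S' T'
  proof
    fix x assume "x \<in> S' <#> T'"
    then obtain s t where "s \<in> S'" "t \<in> T'" "x = s \<otimes> t" unfolding set_mult_def by auto
    moreover then have "x = t \<otimes> s" using that m_comm[of s t] by (simp add: subset_iff)
    ultimately show "x \<in> T' <#> S'" unfolding set_mult_def by blast
  qed
  then show ?thesis using assms by blast
qed

lemma set_mult_lcos:
  assumes "S \<subseteq> carrier G" "T \<subseteq> carrier G" "g \<in> carrier G"
  shows "S <#> (g <# T) = g <# (S <#> T)"
proof -
  have *: "s \<otimes> (g \<otimes> t) = g \<otimes> (s \<otimes> t)" if "s \<in> S" "t \<in> T" for s t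
    using that assms m_lcomm[of s g t] by (simp add: subset_iff)
  have "S <#> (g <# T) = (\<lambda>(s, t). s \<otimes> (g \<otimes> t)) ` (S \<times> T)"
    unfolding set_mult_def l_coset_def by auto
  also have "\<dots> = (\<lambda>(s, t). g \<otimes> (s \<otimes> t)) ` (S \<times> T)"
    using * by (intro image_cong) auto
  also have "\<dots> = g <# (S <#> T)"
    unfolding set_mult_def l_coset_def by auto
  finally show ?thesis .
qed

lemma set_mult_mem: "s \<in> S \<Longrightarrow> t \<in> T \<Longrightarrow> s \<otimes> t \<in> S <#> T"
  unfolding set_mult_def by auto

lemma set_mult_subset_iff: "S <#> T \<subseteq> A \<longleftrightarrow> (\<forall>s\<in>S. \<forall>t\<in>T. s \<otimes> t \<in> A)"
  unfolding set_mult_def by auto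

lemma flat_prd: "S \<subseteq> carrier G \<Longrightarrow> T \<subseteq> carrier G \<Longrightarrow> flat (prd S T)"
  unfolding prd_def by (intro flat_cl set_mult_carrier)

lemma prd_commute: "S \<subseteq> carrier G \<Longrightarrow> T \<subseteq> carrier G \<Longrightarrow> prd S T = prd T S"
  unfolding prd_def using set_mult_commute by simp

lemma prd_mono: "S \<subseteq> S' \<Longrightarrow> T \<subseteq> T' \<Longrightarrow> prd S T \<subseteq> prd S' T'"
  unfolding prd_def by (intro cl_mono mono_set_mult)

lemma prd_mem: "s \<in> S \<Longrightarrow> t \<in> T \<Longrightarrow> s \<otimes> t \<in> prd S T"
  unfolding prd_def using cl_incl set_mult_mem by blast

lemma prd_least: "flat A \<Longrightarrow> S <#> T \<subseteq> A \<Longrightarrow> prd S T \<subseteq> A"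
  unfolding prd_def by (rule cl_least)

lemma prd_lcos:
  "S \<subseteq> carrier G \<Longrightarrow> T \<subseteq> carrier G \<Longrightarrow> g \<in> carrier G \<Longrightarrow> prd S (g <# T) = g <# prd S T"
  unfolding prd_def by (simp add: set_mult_lcos cl_lcos set_mult_carrier)

text \<open>Translation by a single \<open>s\<close> is an automorphism of the lattice of flats and
  so commutes with closure. Associativity of \<open>prd\<close> rests on this.\<close>

lemma set_mult_cl_subset:
  assumes "S \<subseteq> carrier G" "T \<subseteq> carrier G"
  shows "S <#> cl T \<subseteq> cl (S <#> T)"
proof -
  have "s \<otimes> t \<in> cl (S <#> T)" if "s \<in> S" "t \<in> cl T" for s t
  proof -
    have s: "s \<in> carrier G" using that assms by auto
    have "s <# T \<subseteq> S <#> T" using that unfolding l_coset_def set_mult_def by auto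
    then have "s <# cl T \<subseteq> cl (S <#> T)" using cl_lcos[OF assms(2) s] cl_mono by metis
    then show ?thesis using that unfolding l_coset_def by auto
  qed
  then show ?thesis unfolding set_mult_subset_iff by blast
qed

lemma prd_cl_right:
  assumes "S \<subseteq> carrier G" "T \<subseteq> carrier G"
  shows "prd S (cl T) = prd S T"
proof
  show "prd S (cl T) \<subseteq> prd S T"
    using assms by (intro prd_least flat_prd) (auto simp: prd_def dest: subsetD[OF set_mult_cl_subset])
  show "prd S T \<subseteq> prd S (cl T)" by (intro prd_mono cl_incl order_refl)
qed

lemma prd_cl_left:
  assumes "S \<subseteq> carrier G" "T \<subseteq> carrier G"
  shows "prd (cl S) T = prd S T"
  using assms prd_cl_right prd_commute cl_carrier by metis

lemma prd_assoc:
  assumes "S \<subseteq> carrier G" "T \<subseteq> carrier G" "U \<subseteq> carrier G"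
  shows "prd (prd S T) U = prd S (prd T U)"
proof -
  have "prd (prd S T) U = cl ((S <#> T) <#> U)"
    using prd_cl_left[OF set_mult_carrier[OF assms(1,2)] assms(3)] by (simp add: prd_def)
  also have "\<dots> = cl (S <#> (T <#> U))" using assms by (simp add: set_mult_assoc)
  also have "\<dots> = prd S (prd T U)"
    using prd_cl_right[OF assms(1) set_mult_carrier[OF assms(2,3)]] by (simp add: prd_def)
  finally show ?thesis .
qed

lemma prd_join:
  assumes "S \<subseteq> carrier G" "A \<subseteq> carrier G" "Y \<subseteq> carrier G"
  shows "prd S (cl (A \<union> Y)) = cl (prd S A \<union> prd S Y)"
proof
  have "prd S (cl (A \<union> Y)) = prd S (A \<union> Y)" using assms prd_cl_right by simp
  moreover have "S <#> (A \<union> Y) \<subseteq> prd S A \<union> prd S Y"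
    using prd_mem unfolding set_mult_subset_iff by blast
  ultimately show "prd S (cl (A \<union> Y)) \<subseteq> cl (prd S A \<union> prd S Y)"
    by (simp add: prd_def cl_mono)
  show "cl (prd S A \<union> prd S Y) \<subseteq> prd S (cl (A \<union> Y))"
    using assms cl_incl[of "A \<union> Y"] by (intro cl_least flat_prd Un_least prd_mono cl_carrier) auto
qed

text \<open>Products commute with joins, but for intersections only one inclusion holds; this turns
  the modular law into an inequality.\<close>

lemma submodular:
  assumes "S \<subseteq> carrier G" "flat A" "flat Y"
  shows "rk (prd S (cl (A \<union> Y))) + rk (prd S (A \<inter> Y)) \<le> rk (prd S A) + rk (prd S Y)"
proof -
  have A: "A \<subseteq> carrier G" and Y: "Y \<subseteq> carrier G" using assms flat_subset by auto
  have "rk (prd S (A \<inter> Y)) \<le> rk (prd S A \<inter> prd S Y)"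
    using assms A Y by (intro rk_mono flat_prd flat_Int Int_greatest prd_mono) auto
  moreover have "rk (prd S (cl (A \<union> Y))) + rk (prd S A \<inter> prd S Y) = rk (prd S A) + rk (prd S Y)"
    using assms A Y by (simp add: prd_join modular flat_prd)
  ultimately show ?thesis by linarith
qed

lemma flat_subset_prd_lcos:
  assumes "s \<in> S" shows "s <# T \<subseteq> prd S T"
  using prd_mem[OF assms] unfolding l_coset_def by auto

lemma rk_le_prd_right:
  assumes "S \<subseteq> carrier G" "S \<noteq> {}" "flat T"
  shows "rk T \<le> rk (prd S T)"
proof -
  obtain s where s: "s \<in> S" using assms by auto
  have "rk (s <# T) \<le> rk (prd S T)"
    using assms s flat_subset[OF assms(3)]
    by (intro rk_mono flat_translate flat_prd flat_subset_prd_lcos) auto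
  moreover have "rk (s <# T) = rk T" using rk_translate[OF assms(3)] assms s by blast
  ultimately show ?thesis by simp
qed

lemma rk_le_prd_left: "S \<noteq> {} \<Longrightarrow> flat S \<Longrightarrow> T \<noteq> {} \<Longrightarrow> T \<subseteq> carrier G \<Longrightarrow> rk S \<le> rk (prd S T)"
  using rk_le_prd_right[of T S] prd_commute[of S T] flat_subset[of S] by simp

lemma rk_prd_lcos:
  "S \<subseteq> carrier G \<Longrightarrow> T \<subseteq> carrier G \<Longrightarrow> g \<in> carrier G \<Longrightarrow> rk (prd S (g <# T)) = rk (prd S T)"
  by (simp add: prd_lcos rk_translate flat_prd)

section \<open>Flat subgroups and the flats stable under them\<close>

lemma flat_subgroupD:
  assumes "flat_subgroup H"
  shows "flat H" "subgroup H G" "H \<subseteq> carrier G" "\<one> \<in> H" "H \<noteq> {}" "0 < rk H"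
    "\<And>x y. x \<in> H \<Longrightarrow> y \<in> H \<Longrightarrow> x \<otimes> y \<in> H" "\<And>x. x \<in> H \<Longrightarrow> inv x \<in> H"
proof -
  show "flat H" "subgroup H G" using assms by (auto simp: flat_subgroup_def)
  then interpret subgroup H G by simp
  show "H \<subseteq> carrier G" "\<one> \<in> H" "H \<noteq> {}" using subset one_closed by blast+
  then show "0 < rk H" using rk_pos[OF \<open>flat H\<close>] by simp
  show "\<And>x y. x \<in> H \<Longrightarrow> y \<in> H \<Longrightarrow> x \<otimes> y \<in> H" "\<And>x. x \<in> H \<Longrightarrow> inv x \<in> H"
    by (rule m_closed, assumption+) (rule m_inv_closed)
qed

lemma prd_subgroup_subset:
  assumes "flat_subgroup M" "S \<subseteq> M" "T \<subseteq> M"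
  shows "prd S T \<subseteq> M"
proof (rule prd_least)
  show "S <#> T \<subseteq> M"
    unfolding set_mult_subset_iff using flat_subgroupD(7)[OF assms(1)] assms(2,3) by blast
qed (rule flat_subgroupD(1)[OF assms(1)])

lemma prd_subgroup_self:
  assumes "flat_subgroup H" shows "prd H H = H"
proof
  show "prd H H \<subseteq> H" using assms prd_subgroup_subset by blast
  show "H \<subseteq> prd H H"
  proof
    fix x assume x: "x \<in> H"
    then have "\<one> \<otimes> x \<in> prd H H" using flat_subgroupD(4)[OF assms] by (intro prd_mem)
    then show "x \<in> prd H H" using x flat_subgroupD(3)[OF assms] by (simp add: subset_iff)
  qed
qed

lemma subset_prd_subgroup:
  assumes "flat_subgroup H" "A \<subseteq> carrier G"
  shows "A \<subseteq> prd A H"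
proof
  fix x assume "x \<in> A"
  then show "x \<in> prd A H"
    using prd_mem[of x A \<one> H] flat_subgroupD(4)[OF assms(1)] assms(2) by (simp add: subset_iff)
qed

lemma lcos_subgroup_mem:
  assumes "flat_subgroup H" "x \<in> carrier G" shows "x \<in> x <# H"
  using mem_lcos[OF flat_subgroupD(3)[OF assms(1)] assms(2,2)] flat_subgroupD(4)[OF assms(1)] assms(2)
  by simp

lemma lcos_subset_stable: "prd A H \<subseteq> A \<Longrightarrow> x \<in> A \<Longrightarrow> x <# H \<subseteq> A"
  using flat_subset_prd_lcos by blast

lemma prd_prd_subgroup:
  assumes "flat_subgroup H" "A \<subseteq> carrier G"
  shows "prd (prd A H) H = prd A H"
  using prd_assoc[OF assms(2)] prd_subgroup_self[OF assms(1)] flat_subgroupD(3)[OF assms(1)] by simp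

text \<open>A coset represented outside a stable flat is disjoint from it, so modularity adds the
  full \<open>rk H\<close>. Stability persists because \<open>prd\<close> distributes over
  joins.\<close>

lemma stable_join_lcos:
  assumes H: "flat_subgroup H" and A: "flat A" "prd A H \<subseteq> A" and x: "x \<in> carrier G" "x \<notin> A"
  shows "rk (cl (A \<union> (x <# H))) = rk A + rk H" and "prd (cl (A \<union> (x <# H))) H \<subseteq> cl (A \<union> (x <# H))"
proof -
  note HD = flat_subgroupD[OF H]
  have "A \<inter> (x <# H) = {}"
  proof (rule ccontr)
    assume "A \<inter> (x <# H) \<noteq> {}"
    then obtain h where h: "h \<in> H" "x \<otimes> h \<in> A" unfolding l_coset_def by auto
    then have "(x \<otimes> h) \<otimes> inv h \<in> A"
      using A(2) prd_mem[OF h(2) HD(8)[OF h(1)]] by blast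
    then show False using x h HD(3) by (simp add: m_assoc subset_iff)
  qed
  then show "rk (cl (A \<union> (x <# H))) = rk A + rk H"
    using modular[OF A(1) flat_translate[OF HD(1) x(1)]] rk_translate[OF HD(1) x(1)] rk_empty by simp
  have c: "A \<subseteq> carrier G" "x <# H \<subseteq> carrier G" using flat_subset[OF A(1)] lcos_carrier[OF HD(3) x(1)] by auto
  then have c': "cl (A \<union> (x <# H)) \<subseteq> carrier G" by (intro cl_carrier) simp
  have "prd H (cl (A \<union> (x <# H))) = cl (prd H A \<union> prd H (x <# H))"
    by (rule prd_join[OF HD(3) c])
  also have "prd H (x <# H) = x <# H" using prd_lcos[OF HD(3,3) x(1)] prd_subgroup_self[OF H] by simp
  also have "prd H A = prd A H" by (rule prd_commute[OF HD(3) c(1)])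
  also have "cl (prd A H \<union> (x <# H)) \<subseteq> cl (A \<union> (x <# H))"
    using A(2) by (intro cl_mono) auto
  finally show "prd (cl (A \<union> (x <# H))) H \<subseteq> cl (A \<union> (x <# H))"
    using prd_commute[OF HD(3) c'] by simp
qed

text \<open>Starting from the empty flat, cosets are added one at a time, each contributing
  \<open>rk H\<close>, until \<open>A\<close> is exhausted. This serves as Lagrange's theorem for
  groups and as the choice of a basis over an intermediate field.\<close>

lemma rk_subgroup_dvd_stable:
  assumes H: "flat_subgroup H" and A: "flat A" "prd A H \<subseteq> A"
  shows "rk H dvd rk A"
proof -
  have "rk H dvd rk A" if "flat Y" "prd Y H \<subseteq> Y" "Y \<subseteq> A" "rk H dvd rk Y" for Y
    using that
  proof (induction "rk A - rk Y" arbitrary: Y rule: less_induct)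
    case less
    show ?case
    proof (cases "Y = A")
      case False
      then obtain x where x: "x \<in> A" "x \<notin> Y" using less.prems by auto
      have xc: "x \<in> carrier G" using x A flat_subset by auto
      let ?Y = "cl (Y \<union> (x <# H))"
      note j = stable_join_lcos[OF H less.prems(1,2) xc x(2)]
      have f: "flat ?Y" using less.prems flat_subset lcos_carrier flat_subgroupD[OF H] xc
        by (intro flat_cl) auto
      have s: "?Y \<subseteq> A" using lcos_subset_stable[OF A(2) x(1)] less.prems A by (intro cl_least) auto
      have "rk ?Y \<le> rk A" using rk_mono f s A by simp
      then have "rk A - rk ?Y < rk A - rk Y" using j(1) flat_subgroupD[OF H] by linarith
      then show ?thesis using less.hyps[of ?Y] f s j less.prems by simp
    qed (use less in auto)
  qed
  from this[of "{}"] show ?thesis using flat_empty rk_empty flat_subset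
    by (simp add: prd_def cl_flat set_mult_def)
qed

section \<open>Points, hyperplanes and orthogonal complements\<close>

lemma rk_insert:
  assumes A: "flat A" and x: "x \<in> carrier G" "x \<notin> A"
  shows "rk (cl (insert x A)) = rk A + 1"
proof -
  have "rk (cl {\<one>}) = 1" using rk_one by (simp add: cl_def)
  moreover have "x <# {\<one>} = {x}" using x by (simp add: l_coset_def)
  ultimately have r: "rk (cl {x}) = 1"
    using cl_lcos[of "{\<one>}" x] rk_translate[OF flat_cl] x by (metis empty_subsetI insert_subset one_closed)
  have f: "flat (cl {x})" using x flat_cl by simp
  have lt: "rk (A \<inter> cl {x}) < rk (cl {x})"
    using x cl_incl[of "{x}"] f A by (intro rk_less flat_Int) auto
  have "cl (A \<union> cl {x}) = cl (insert x A)"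
  proof
    show "cl (A \<union> cl {x}) \<subseteq> cl (insert x A)"
      using cl_incl[of "insert x A"] x A flat_subset
      by (intro cl_least flat_cl Un_least cl_mono) auto
    show "cl (insert x A) \<subseteq> cl (A \<union> cl {x})"
      using cl_incl[of "{x}"] by (intro cl_mono) auto
  qed
  then show ?thesis using modular[OF A f] r lt by simp
qed

lemma flat_insert: "flat A \<Longrightarrow> x \<in> carrier G \<Longrightarrow> flat (cl (insert x A))"
  using flat_subset by (intro flat_cl) auto

text \<open>A flat of greatest rank among those in \<open>M\<close> that avoid one will do. For
  groups it is \<open>M\<close> without the identity; for fields it is the kernel, without zero, of
  a linear functional that does not vanish at 1.\<close>

lemma hyperplane_exists:
  assumes M: "flat_subgroup M"
  obtains Z where "flat Z" "Z \<subseteq> M" "\<one> \<notin> Z" "rk Z + 1 = rk M"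
proof -
  note MD = flat_subgroupD[OF M]
  let ?P = "\<lambda>Z. flat Z \<and> Z \<subseteq> M \<and> \<one> \<notin> Z"
  have "rk Y < rk M" if "?P Y" for Y using that rk_less[of Y M] MD(1,4) by blast
  then have "\<exists>Z. ?P Z \<and> (\<forall>Y. ?P Y \<longrightarrow> rk Y \<le> rk Z)"
    using flat_empty by (intro ex_has_greatest_nat[of _ "{}" _ "rk M"]) auto
  then obtain Z where Z: "?P Z" and max: "\<And>Y. ?P Y \<Longrightarrow> rk Y \<le> rk Z" by blast
  have one: "rk (cl (insert \<one> Z)) = rk Z + 1" using Z rk_insert by simp
  have "M \<subseteq> cl (insert \<one> Z)"
  proof
    fix g assume g: "g \<in> M"
    show "g \<in> cl (insert \<one> Z)"
    proof (cases "g \<in> Z")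
      case False
      have gc: "g \<in> carrier G" using g MD by auto
      have f: "flat (cl (insert g Z))" using Z gc flat_insert by simp
      have "cl (insert g Z) \<subseteq> M" using Z g MD by (intro cl_least) auto
      moreover have r: "rk (cl (insert g Z)) = rk Z + 1" using rk_insert Z gc False by simp
      \<comment> \<open>Exchange: \<open>Z\<close> enlarged by \<open>g\<close> has greater rank, so
        it can no longer avoid one; equality of ranks then identifies it with \<open>Z\<close>
        enlarged by one.\<close>
      ultimately have "\<one> \<in> cl (insert g Z)" using max f by fastforce
      then have "cl (insert \<one> Z) \<subseteq> cl (insert g Z)"
        using f cl_incl[of "insert g Z"] by (intro cl_least) auto
      then have "cl (insert \<one> Z) = cl (insert g Z)"
        using r one f flat_insert Z by (intro flat_eqI) auto
      then show ?thesis using cl_incl by blast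
    qed (use cl_incl in blast)
  qed
  moreover have "cl (insert \<one> Z) \<subseteq> M" using Z MD by (intro cl_least) auto
  ultimately have "rk Z + 1 = rk M" using one by simp
  then show thesis using that Z by blast
qed

text \<open>If \<open>Z\<close> is the kernel of a functional f, this is the orthogonal complement
  for the form f(x y). In a group, where \<open>Z\<close> misses only the identity, it is
  \<open>M\<close> without the inverses of the elements of \<open>A\<close>. A trace form would
  degenerate for inseparable extensions; a functional with f(1) nonzero never does.\<close>

definition perp :: "'a set \<Rightarrow> 'a set \<Rightarrow> 'a set \<Rightarrow> 'a set" where
  "perp M Z A = {y \<in> M. \<forall>x\<in>A. x \<otimes> y \<in> Z}"

definition hyperplane :: "'a set \<Rightarrow> 'a set \<Rightarrow> bool" where
  "hyperplane M Z \<longleftrightarrow> flat Z \<and> Z \<subseteq> M \<and> \<one> \<notin> Z \<and> rk Z + 1 = rk M"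

context
  fixes M Z
  assumes M: "flat_subgroup M" and Z: "hyperplane M Z"
begin

lemma hyperplaneD: "flat Z" "Z \<subseteq> M" "\<one> \<notin> Z" "rk Z + 1 = rk M" "Z \<subseteq> carrier G"
  using Z flat_subset[of Z] by (auto simp: hyperplane_def)

lemma subgroup_lcos:
  assumes "x \<in> M" "A \<subseteq> M" shows "x <# A \<subseteq> M"
  unfolding l_coset_def using assms flat_subgroupD(7)[OF M] by blast

lemma perp_subset: "perp M Z A \<subseteq> M"
  by (auto simp: perp_def)

lemma perp_singleton:
  assumes x: "x \<in> M"
  shows "perp M Z {x} = inv x <# Z"
proof -
  note MD = flat_subgroupD[OF M]
  have xc: "x \<in> carrier G" using x MD(3) by blast
  have sub: "inv x <# Z \<subseteq> M" using subgroup_lcos[OF MD(8)[OF x] hyperplaneD(2)] .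
  have "y \<in> perp M Z {x} \<longleftrightarrow> y \<in> inv x <# Z" if "y \<in> M" for y
  proof -
    have "y \<in> carrier G" using that MD(3) by blast
    then show ?thesis using mem_lcos[OF hyperplaneD(5), of "inv x" y] xc that by (simp add: perp_def)
  qed
  then show ?thesis using sub perp_subset by blast
qed

lemma flat_perp:
  assumes "A \<subseteq> M" shows "flat (perp M Z A)"
proof -
  have eq: "perp M Z A = \<Inter>(insert M ((\<lambda>x. perp M Z {x}) ` A))"
    by (auto simp: perp_def)
  have "\<forall>W\<in>insert M ((\<lambda>x. perp M Z {x}) ` A). flat W"
  proof -
    have "flat (perp M Z {x})" if "x \<in> A" for x
    proof -
      have x: "x \<in> M" using that assms by blast
      then have "x \<in> carrier G" using flat_subgroupD(3)[OF M] by blast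
      then show ?thesis unfolding perp_singleton[OF x]
        by (intro flat_translate hyperplaneD(1) inv_closed)
    qed
    then show ?thesis using flat_subgroupD(1)[OF M] by blast
  qed
  then show ?thesis unfolding eq by (intro flat_Inter) auto
qed

lemma perp_antimono: "A \<subseteq> B \<Longrightarrow> perp M Z B \<subseteq> perp M Z A"
  by (auto simp: perp_def)

lemma perp_sym:
  assumes "A \<subseteq> M" "B \<subseteq> perp M Z A"
  shows "A \<subseteq> perp M Z B"
proof
  fix x assume x: "x \<in> A"
  have "y \<otimes> x \<in> Z" if "y \<in> B" for y
  proof -
    have "y \<in> perp M Z A" using that assms(2) by blast
    then have "x \<otimes> y \<in> Z" "y \<in> carrier G"
      using x flat_subgroupD(3)[OF M] unfolding perp_def by blast+
    moreover have "x \<in> carrier G" using x assms(1) flat_subgroupD(3)[OF M] by blast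
    ultimately show ?thesis using m_comm[of x y] by simp
  qed
  then show "x \<in> perp M Z B" using x assms(1) unfolding perp_def by blast
qed

lemma perp_cl:
  assumes "A \<subseteq> M" shows "perp M Z (cl A) = perp M Z A"
proof
  show "perp M Z (cl A) \<subseteq> perp M Z A" by (intro perp_antimono cl_incl)
  have "A \<subseteq> perp M Z (perp M Z A)" by (rule perp_sym[OF assms order_refl])
  then have "cl A \<subseteq> perp M Z (perp M Z A)" by (rule cl_least[OF flat_perp[OF perp_subset]])
  then show "perp M Z A \<subseteq> perp M Z (cl A)" by (rule perp_sym[OF perp_subset])
qed

text \<open>A further point cuts the complement with \<open>perp M Z {x}\<close>, which is a
  translate of the hyperplane; by modularity at most one rank is lost.\<close>

lemma rk_perp_insert:
  assumes "A \<subseteq> M" "x \<in> M"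
  shows "rk (perp M Z A) \<le> rk (perp M Z (cl (insert x A))) + 1"
proof -
  have xc: "x \<in> carrier G" using assms flat_subgroupD(3)[OF M] by blast
  have f: "flat (perp M Z A)" "flat (perp M Z {x})" using assms by (auto intro: flat_perp)
  have "perp M Z (cl (insert x A)) = perp M Z (insert x A)"
    using assms by (intro perp_cl) simp
  also have "\<dots> = perp M Z A \<inter> perp M Z {x}" by (auto simp: perp_def)
  finally have "rk (cl (perp M Z A \<union> perp M Z {x})) + rk (perp M Z (cl (insert x A)))
      = rk (perp M Z A) + rk (perp M Z {x})" using modular[OF f] by simp
  moreover have "rk (perp M Z {x}) + 1 = rk M"
    using perp_singleton[OF assms(2)] rk_translate[OF hyperplaneD(1)] hyperplaneD(4) xc by simp
  moreover have "rk (cl (perp M Z A \<union> perp M Z {x})) \<le> rk M"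
  proof -
    have "perp M Z A \<union> perp M Z {x} \<subseteq> M" using perp_subset by blast
    then show ?thesis using flat_subgroupD(1,3)[OF M] by (intro rk_mono cl_least flat_cl) auto
  qed
  ultimately show ?thesis by linarith
qed

text \<open>Nondegeneracy: \<open>y\<close> pairs with its own inverse to one, which lies outside
  \<open>Z\<close>.\<close>

lemma perp_self: "perp M Z M = {}"
proof -
  note MD = flat_subgroupD[OF M]
  have False if "y \<in> perp M Z M" for y
  proof -
    have y: "y \<in> M" "\<And>x. x \<in> M \<Longrightarrow> x \<otimes> y \<in> Z" using that by (auto simp: perp_def)
    then have "inv y \<otimes> y \<in> Z" using MD(8) by blast
    then show False using y(1) MD(3) hyperplaneD(3) by (simp add: subset_iff)
  qed
  then show ?thesis by blast
qed

text \<open>Each new point costs the complement at most one rank. Counting from the empty flat,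
  whose complement is \<open>M\<close>, up to \<open>A\<close> gives one inequality; counting from
  \<open>A\<close> up to \<open>M\<close>, whose complement is empty, gives the other.\<close>

lemma rk_perp:
  assumes A: "flat A" "A \<subseteq> M"
  shows "rk (perp M Z A) + rk A = rk M"
proof (rule antisym)
  note MD = flat_subgroupD[OF M]
  have "\<exists>Y. flat Y \<and> Y \<subseteq> A \<and> rk Y = k \<and> rk M \<le> rk (perp M Z Y) + k" if "k \<le> rk A" for k
    using that
  proof (induction k)
    case 0
    have "perp M Z {} = M" by (simp add: perp_def)
    then show ?case using flat_empty rk_empty by (intro exI[of _ "{}"]) simp
  next
    case (Suc k)
    then obtain Y where Y: "flat Y" "Y \<subseteq> A" "rk Y = k" "rk M \<le> rk (perp M Z Y) + k" by auto
    then obtain x where x: "x \<in> A" "x \<notin> Y" using Suc.prems by (metis Suc_n_not_le_n subsetI subset_antisym)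
    then have xM: "x \<in> M" and xc: "x \<in> carrier G" using A MD(3) by auto
    let ?Y = "cl (insert x Y)"
    have "flat ?Y" "?Y \<subseteq> A" "rk ?Y = Suc k"
      using flat_insert[OF Y(1) xc] cl_least[OF A(1), of "insert x Y"] x Y rk_insert[OF Y(1) xc x(2)] by auto
    moreover have "rk M \<le> rk (perp M Z ?Y) + Suc k"
      using rk_perp_insert[OF subset_trans[OF Y(2) A(2)] xM] Y(4) by linarith
    ultimately show ?case by blast
  qed
  from this[of "rk A"] obtain Y where "flat Y" "Y \<subseteq> A" "rk Y = rk A" "rk M \<le> rk (perp M Z Y) + rk A" by auto
  then show "rk M \<le> rk (perp M Z A) + rk A" using flat_eqI[of Y A] A by simp
  show "rk (perp M Z A) + rk A \<le> rk M" using A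
  proof (induction "rk M - rk A" arbitrary: A rule: less_induct)
    case less
    show ?case
    proof (cases "A = M")
      case True
      then show ?thesis using perp_self rk_empty by simp
    next
      case False
      then obtain x where x: "x \<in> M" "x \<notin> A" using less.prems by auto
      have xc: "x \<in> carrier G" using x MD(3) by blast
      let ?A = "cl (insert x A)"
      have f: "flat ?A" "?A \<subseteq> M" "rk ?A = rk A + 1"
        using flat_insert[OF less.prems(1) xc] cl_least[OF MD(1), of "insert x A"] x less.prems(2)
          rk_insert[OF less.prems(1) xc x(2)] by auto
      have "rk ?A \<le> rk M" using rk_mono[OF f(1) MD(1) f(2)] .
      then have "rk (perp M Z ?A) + rk ?A \<le> rk M" using less.hyps[of ?A] f by simp
      then show ?thesis using rk_perp_insert[OF less.prems(2) x(1)] f(3) by linarith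
    qed
  qed
qed

lemma perp_nonempty:
  assumes "flat A" "A \<subseteq> M" "A \<noteq> M" shows "perp M Z A \<noteq> {}"
proof -
  have "rk A < rk M" using rk_less[OF assms(1) flat_subgroupD(1)[OF M]] assms(2,3) by blast
  then show ?thesis using rk_perp[OF assms(1,2)] rk_empty by auto
qed

text \<open>Multiplication by \<open>s\<close> is self-adjoint for the pairing, since
  \<open>t (s y) = (s t) y\<close>.\<close>

lemma prd_perp_prd:
  assumes "S \<subseteq> M" "T \<subseteq> M"
  shows "prd S (perp M Z (prd S T)) \<subseteq> perp M Z T"
proof (rule prd_least)
  show "flat (perp M Z T)" by (rule flat_perp[OF assms(2)])
  note MD = flat_subgroupD[OF M]
  show "S <#> perp M Z (prd S T) \<subseteq> perp M Z T"
    unfolding set_mult_subset_iff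
  proof (intro ballI)
    fix s y assume s: "s \<in> S" and y: "y \<in> perp M Z (prd S T)"
    have sM: "s \<in> M" and yM: "y \<in> M" using s y assms perp_subset by auto
    have "t \<otimes> (s \<otimes> y) \<in> Z" if "t \<in> T" for t
    proof -
      have "(s \<otimes> t) \<otimes> y \<in> Z" using y prd_mem[OF s that] by (auto simp: perp_def)
      moreover have "s \<in> carrier G" "t \<in> carrier G" "y \<in> carrier G" using sM yM that assms MD(3) by auto
      ultimately show ?thesis by (simp add: m_ac)
    qed
    then show "s \<otimes> y \<in> perp M Z T" using MD(7)[OF sM yM] by (simp add: perp_def)
  qed
qed

end

lemma rk_less_of_proper:
  assumes "flat A" "flat B" "A \<subseteq> B" "A \<noteq> B" shows "rk A < rk B"
  using rk_less assms by blast

section \<open>Atoms\<close>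

text \<open>
  Two distinct translates \<open>A\<close>, \<open>B\<close> of a smallest minimiser cannot intersect: by submodularity \<open>S (A \<union> B)\<close> would have to
  span \<open>M\<close>, but duality gives \<open>rk A + rk (S A) \<le> rk M\<close>, which makes \<open>S (A \<union> B)\<close> too small.
\<close>

lemma atom_exists:
  assumes M: "flat_subgroup M" and S: "flat S" "S \<noteq> {}" "S \<subseteq> M"
    and T0: "flat T0" "T0 \<noteq> {}" "T0 \<subseteq> M" "prd S T0 \<noteq> M"
  obtains H where "flat_subgroup H" "H \<subseteq> M" "prd S H \<noteq> M"
    "\<forall>T. flat T \<longrightarrow> T \<noteq> {} \<longrightarrow> T \<subseteq> M \<longrightarrow> prd S T \<noteq> M \<longrightarrow>
      rk T + rk (prd S H) \<le> rk (prd S T) + rk H"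
proof -
  note MD = flat_subgroupD[OF M]
  obtain Z where "flat Z" "Z \<subseteq> M" "\<one> \<notin> Z" "rk Z + 1 = rk M" using hyperplane_exists[OF M] .
  then have Z: "hyperplane M Z" by (simp add: hyperplane_def)
  have Sc: "S \<subseteq> carrier G" using S MD(3) by blast
  define E where "E T \<longleftrightarrow> flat T \<and> T \<noteq> {} \<and> T \<subseteq> M \<and> rk (prd S T) < rk M" for T
  define f where "f T = rk (prd S T) - rk T" for T
  have sub: "prd S T \<subseteq> M" if "T \<subseteq> M" for T using prd_subgroup_subset[OF M S(3) that] .
  have c: "T \<subseteq> carrier G" if "T \<subseteq> M" for T using that MD(3) by blast
  have EI: "E T" if "flat T" "T \<noteq> {}" "T \<subseteq> M" "prd S T \<noteq> M" for T
    unfolding E_def using that rk_less_of_proper[OF flat_prd[OF Sc c[OF that(3)]] MD(1) sub[OF that(3)]] by blast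
  \<comment> \<open>The subtraction in \<open>f\<close> does not truncate here, because
    \<open>prd S T\<close> contains a translate of \<open>T\<close>.\<close>
  have fE: "rk (prd S T) = f T + rk T" if "E T" for T
    using rk_le_prd_right[OF Sc S(2), of T] that by (simp add: f_def E_def)
  have "E T0" using EI T0 by blast
  then obtain A0 where A0: "E A0" "\<And>T. E T \<Longrightarrow> f A0 \<le> f T"
    using ex_has_least_nat[of E T0 f] by blast
  then obtain A1 where A1: "E A1" "f A1 = f A0" "\<And>T. E T \<Longrightarrow> f T = f A0 \<Longrightarrow> rk A1 \<le> rk T"
    using ex_has_least_nat[of "\<lambda>T. E T \<and> f T = f A0" A0 rk] by blast
  have A1min: "f A1 \<le> f T" if "E T" for T using A0(2)[OF that] A1(2) by simp
  have tr: "E (g <# T)" "f (g <# T) = f T" "rk (g <# T) = rk T" if "E T" "g \<in> M" for g T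
  proof -
    have T: "flat T" "T \<noteq> {}" "T \<subseteq> M" "rk (prd S T) < rk M" using that(1) by (auto simp: E_def)
    have gc: "g \<in> carrier G" using that MD(3) by blast
    have "rk (prd S (g <# T)) = rk (prd S T)" using rk_prd_lcos[OF Sc c[OF T(3)] gc] .
    moreover show "rk (g <# T) = rk T" using rk_translate[OF T(1) gc] .
    moreover have "g <# T \<subseteq> M" using subgroup_lcos[OF M Z that(2) T(3)] .
    moreover have "g <# T \<noteq> {}" using T(2) by (auto simp: l_coset_def)
    ultimately show "E (g <# T)" "f (g <# T) = f T"
      using flat_translate[OF T(1) gc] T(4) by (auto simp: E_def f_def)
  qed
  obtain a0 where a0: "a0 \<in> A1" using A1(1) by (auto simp: E_def)
  have A1M: "A1 \<subseteq> M" using A1(1) by (simp add: E_def)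
  define A where "A = inv a0 <# A1"
  have a0M: "inv a0 \<in> M" using a0 A1M MD(8) by blast
  have A: "E A" "f A = f A1" "rk A = rk A1" using tr[OF A1(1) a0M] by (simp_all add: A_def)
  have oneA: "\<one> \<in> A" using one_mem_inv_lcos[OF a0 c[OF A1M]] by (simp add: A_def)
  have AM: "A \<subseteq> M" "flat A" "A \<noteq> {}" "rk (prd S A) < rk M" using A(1) by (simp_all add: E_def)
  have Amin: "f A \<le> f T" if "E T" for T using A1min[OF that] A(2) by simp
  have Amin2: "rk A \<le> rk T" if "E T" "f T = f A" for T using A1(3)[of T] that A A1(2) by simp
  let ?D = "perp M Z (prd S A)"
  have D1: "rk ?D + rk (prd S A) = rk M"
    using rk_perp[OF M Z flat_prd[OF Sc c[OF AM(1)]] sub[OF AM(1)]] .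
  have fD: "flat ?D" by (rule flat_perp[OF M Z sub[OF AM(1)]])
  have DM: "?D \<subseteq> M" by (rule perp_subset[OF M Z])
  have "rk (prd S ?D) \<le> rk (perp M Z A)"
    using prd_perp_prd[OF M Z S(3) AM(1)] by (intro rk_mono flat_prd Sc c DM flat_perp[OF M Z AM(1)])
  then have D2: "rk (prd S ?D) + rk A \<le> rk M" using rk_perp[OF M Z AM(2,1)] by simp
  have Apos: "0 < rk A" using rk_pos AM by blast
  have "?D \<noteq> {}" using D1 AM(4) rk_empty by auto
  then have ED: "E ?D" using fD DM D2 Apos by (simp add: E_def)
  \<comment> \<open>By \<open>D1\<close> and \<open>D2\<close> the complement \<open>?D\<close> does
    at least as well as \<open>A\<close>, so it is a minimiser too. The choice of \<open>A\<close>
    as a minimiser of least rank then gives \<open>rk A \<le> rk ?D\<close>, which is the inequality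
    \<open>AD\<close>.\<close>
  have "f ?D = f A" using Amin[OF ED] fE[OF ED] fE[OF A(1)] D1 D2 by linarith
  then have AD: "rk A + rk (prd S A) \<le> rk M" using Amin2[OF ED] D1 by linarith
  have inv: "inv a <# A = A" if a: "a \<in> A" for a
  proof -
    have aM: "inv a \<in> M" using a AM MD(8) by blast
    let ?B = "inv a <# A"
    note B = tr[OF A(1) aM]
    have BM: "?B \<subseteq> M" "flat ?B" using B(1) by (simp_all add: E_def)
    have oneB: "\<one> \<in> ?B" using one_mem_inv_lcos[OF a c[OF AM(1)]] .
    have "A \<inter> ?B = A"
    proof (rule ccontr)
      assume ne: "A \<inter> ?B \<noteq> A"
      let ?I = "A \<inter> ?B" and ?J = "cl (A \<union> ?B)"
      have fI: "flat ?I" and IM: "?I \<subseteq> M" using flat_Int AM BM by auto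
      have Ilt: "rk ?I < rk A" using rk_less_of_proper[OF fI AM(2)] ne by blast
      have "rk (prd S ?I) \<le> rk (prd S A)"
        by (intro rk_mono flat_prd Sc c IM AM(1) prd_mono) auto
      then have EI: "E ?I" using fI IM oneA oneB AM(4) by (auto simp: E_def)
      \<comment> \<open>The intersection contains one and has smaller rank than \<open>A\<close>, so
        it cannot be a minimiser.\<close>
      have fI': "f A < f ?I" using Amin[OF EI] Amin2[OF EI] Ilt by linarith
      have J: "rk ?J + rk ?I = rk A + rk A" using modular[OF AM(2) BM(2)] B(3) by simp
      have SJ: "rk (prd S ?J) + rk (prd S ?I) \<le> rk (prd S A) + rk (prd S A)"
        using submodular[OF Sc AM(2) BM(2)] fE[OF B(1)] fE[OF A(1)] B(2,3) by simp
      have "rk (prd S ?J) < rk M" using SJ AD fE[OF EI] fE[OF A(1)] fI' by linarith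
      moreover have "flat ?J" "?J \<subseteq> M" "?J \<noteq> {}"
        using flat_cl[of "A \<union> ?B"] cl_least[OF MD(1), of "A \<union> ?B"] AM BM c cl_incl[of "A \<union> ?B"] oneA by auto
      ultimately have EJ: "E ?J" by (simp add: E_def)
      \<comment> \<open>By modularity the ranks in the submodular inequality cancel. What remains is
        that \<open>f ?J + f ?I\<close> is at most \<open>2 * f A\<close>, although
        \<open>f ?J\<close> is at least \<open>f A\<close> and \<open>f ?I\<close> is
        larger.\<close>
      show False using SJ fE[OF EJ] fE[OF EI] fE[OF A(1)] Amin[OF EJ] fI' J by linarith
    qed
    then show ?thesis using flat_eqI[OF AM(2) BM(2)] B(3) by auto
  qed
  have inv': "a <# A = A" if "a \<in> A" for a
    using lcos_lcos_inv[OF c[OF AM(1)], of a] inv[OF that] c[OF AM(1)] that by auto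
  have "subgroup A G"
  proof (rule subgroupI)
    show "A \<subseteq> carrier G" "A \<noteq> {}" using c AM by auto
    show "inv a \<in> A" if "a \<in> A" for a
    proof -
      have "inv a \<otimes> \<one> \<in> inv a <# A" using oneA unfolding l_coset_def by blast
      then show ?thesis using inv[OF that] that c[OF AM(1)] by (simp add: subset_iff)
    qed
    show "a \<otimes> b \<in> A" if "a \<in> A" "b \<in> A" for a b
      using inv'[OF that(1)] that(2) unfolding l_coset_def by blast
  qed
  then have "flat_subgroup A" using AM by (simp add: flat_subgroup_def)
  moreover have "prd S A \<noteq> M" using AM(4) by auto
  moreover have "rk T + rk (prd S A) \<le> rk (prd S T) + rk A"
    if "flat T" "T \<noteq> {}" "T \<subseteq> M" "prd S T \<noteq> M" for T
    using Amin[OF EI[OF that]] fE[OF EI[OF that]] fE[OF A(1)] by linarith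
  ultimately show thesis using AM(1) by (intro that[of A]) auto
qed

section \<open>Cutting along the cosets of a subgroup\<close>

lemma rk_join_lcos:
  assumes H: "flat_subgroup H" and T: "flat T" "x \<in> T"
  shows "flat (T \<inter> (x <# H))" "T \<inter> (x <# H) \<noteq> {}" "inv x <# (T \<inter> (x <# H)) \<subseteq> H"
    "rk (cl (T \<union> (x <# H))) + rk (T \<inter> (x <# H)) = rk T + rk H"
    "flat (cl (T \<union> (x <# H)))" "T \<subseteq> cl (T \<union> (x <# H))"
    "rk (T \<inter> (x <# H)) \<le> rk H"
proof -
  note HD = flat_subgroupD[OF H]
  have xc: "x \<in> carrier G" using T flat_subset by blast
  have fx: "flat (x <# H)" using flat_translate[OF HD(1) xc] .
  have rx: "rk (x <# H) = rk H" using rk_translate[OF HD(1) xc] .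
  show f: "flat (T \<inter> (x <# H))" by (rule flat_Int[OF T(1) fx])
  show "T \<inter> (x <# H) \<noteq> {}" using T(2) lcos_subgroup_mem[OF H xc] by blast
  have "inv x <# (T \<inter> (x <# H)) \<subseteq> inv x <# (x <# H)" by (intro lcos_mono) blast
  then show "inv x <# (T \<inter> (x <# H)) \<subseteq> H" using lcos_inv_lcos[OF HD(3) xc] by simp
  show "rk (cl (T \<union> (x <# H))) + rk (T \<inter> (x <# H)) = rk T + rk H" using modular[OF T(1) fx] rx by simp
  show "flat (cl (T \<union> (x <# H)))" using flat_subset[OF T(1)] flat_subset[OF fx] by (intro flat_cl) simp
  show "T \<subseteq> cl (T \<union> (x <# H))" using cl_incl by blast
  show "rk (T \<inter> (x <# H)) \<le> rk H" using rk_mono[OF f fx] rx by simp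
qed

text \<open>Termination of the coset inductions: adding a coset that meets \<open>T\<close> keeps
  the hull \<open>prd T H\<close> and raises the rank, which the hull bounds.\<close>

lemma join_lcos_measure:
  assumes H: "flat_subgroup H" and T: "flat T" "x \<in> T" "\<not> x <# H \<subseteq> T"
  shows "prd (cl (T \<union> (x <# H))) H = prd T H" "rk T < rk (cl (T \<union> (x <# H)))"
    "rk (cl (T \<union> (x <# H))) \<le> rk (prd T H)"
proof -
  note HD = flat_subgroupD[OF H] and J = rk_join_lcos[OF H T(1,2)]
  have Tc: "T \<subseteq> carrier G" using flat_subset T by blast
  have fP: "flat (prd T H)" using flat_prd[OF Tc HD(3)] .
  have JP: "cl (T \<union> (x <# H)) \<subseteq> prd T H"
    using subset_prd_subgroup[OF H Tc] flat_subset_prd_lcos[OF T(2)] by (intro cl_least fP) simp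
  have "prd (cl (T \<union> (x <# H))) H \<subseteq> prd (prd T H) H" by (intro prd_mono JP order_refl)
  then show "prd (cl (T \<union> (x <# H))) H = prd T H"
    using prd_prd_subgroup[OF H Tc] prd_mono[OF J(6) order_refl, of H] by simp
  have "T \<noteq> cl (T \<union> (x <# H))" using cl_incl[of "T \<union> (x <# H)"] T(3) by auto
  then show "rk T < rk (cl (T \<union> (x <# H)))" using rk_less_of_proper T(1) J(5,6) by blast
  show "rk (cl (T \<union> (x <# H))) \<le> rk (prd T H)" using rk_mono[OF J(5) fP JP] .
qed

lemma not_stableE:
  assumes "\<not> prd T H \<subseteq> T" "flat T"
  obtains x where "x \<in> T" "\<not> x <# H \<subseteq> T"
proof -
  have "\<not> T <#> H \<subseteq> T" using assms prd_least by blast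
  then obtain x h where "x \<in> T" "h \<in> H" "x \<otimes> h \<notin> T" unfolding set_mult_def by blast
  then show thesis using that[of x] unfolding l_coset_def by blast
qed

text \<open>A numerical form of Kneser's theorem: \<open>d\<close> is any divisor of
  \<open>rk H\<close> and need not be the rank of a stabilizer. The sets \<open>S\<close> and
  \<open>T\<close> need not lie in \<open>H\<close>.\<close>

definition divisor_bounded :: "'a set \<Rightarrow> 'a set \<Rightarrow> 'a set \<Rightarrow> bool" where
  "divisor_bounded H S T \<longleftrightarrow> (\<exists>d. d dvd rk H \<and> kneser_bound d (rk S) (rk T) (rk (prd S T)))"

context
  fixes H
  assumes H: "flat_subgroup H"
    and kneser_H: "\<And>U R. flat U \<Longrightarrow> U \<noteq> {} \<Longrightarrow> U \<subseteq> H \<Longrightarrow> flat R \<Longrightarrow> R \<noteq> {} \<Longrightarrow> R \<subseteq> H \<Longrightarrow>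
      \<exists>d. d dvd rk H \<and> kneser_bound d (rk U) (rk R) (rk (prd U R))"
    and divisors_chain: "\<And>d d'. d dvd rk H \<Longrightarrow> d' dvd rk H \<Longrightarrow> d dvd d' \<or> d' dvd d"
begin

lemma up_stable:
  assumes "flat T" "prd T H \<subseteq> T" "T \<noteq> {}" shows "up (rk H) (rk T) = rk T"
  using up_least[OF rk_subgroup_dvd_stable[OF H assms(1,2)] order_refl] rk_pos[OF assms(1,3)]
    up_ge[of "rk H" "rk T"] flat_subgroupD(6)[OF H] by simp

text \<open>Only one factor lies in \<open>H\<close>. The other is enlarged coset by coset, and its
  piece in the added coset is translated into \<open>H\<close>, where the bound is assumed. As
  \<open>prd R H\<close> has rank at most \<open>rk H\<close>, the pieces are glued with
  \<open>m = 0\<close>. For a stable \<open>U\<close> the divisor \<open>rk H\<close> serves,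
  because \<open>rk R\<close> rounds up to \<open>rk H\<close>.\<close>

lemma kneser_bound_extend:
  assumes R: "flat R" "R \<noteq> {}" "R \<subseteq> H" and U: "flat U" "U \<noteq> {}"
  shows "\<exists>d. d dvd rk H \<and> kneser_bound d (rk R) (rk U) (rk (prd R U))"
  using U
proof (induction "rk (prd U H) - rk U" arbitrary: U rule: less_induct)
  case less
  note HD = flat_subgroupD[OF H]
  have Rc: "R \<subseteq> carrier G" using R(3) HD(3) by blast
  have Uc: "U \<subseteq> carrier G" using flat_subset less.prems by blast
  show ?case
  proof (cases "prd U H \<subseteq> U")
    case True
    have "up (rk H) (rk R) \<le> rk H" using rk_mono[OF R(1) HD(1) R(3)] rk_pos[OF R(1,2)] by (intro up_least) auto
    moreover have "rk U \<le> rk (prd R U)" using rk_le_prd_right[OF Rc R(2) less.prems(1)] .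
    ultimately show ?thesis using up_stable[OF less.prems(1) True less.prems(2)]
      by (intro exI[of _ "rk H"]) (simp add: kneser_bound_def)
  next
    case False
    obtain x where x: "x \<in> U" "\<not> x <# H \<subseteq> U" using not_stableE[OF False less.prems(1)] .
    have xc: "x \<in> carrier G" using x Uc by blast
    let ?U1 = "cl (U \<union> (x <# H))" and ?U2 = "U \<inter> (x <# H)"
    note J = rk_join_lcos[OF H less.prems(1) x(1)] and K = join_lcos_measure[OF H less.prems(1) x]
    have "?U1 \<noteq> {}" using J(6) x by blast
    moreover have "rk (prd ?U1 H) - rk ?U1 < rk (prd U H) - rk U"
      unfolding K(1) using K(2,3) by linarith
    ultimately obtain d where d: "d dvd rk H" "kneser_bound d (rk R) (rk ?U1) (rk (prd R ?U1))"
      using less.hyps[OF _ J(5)] by blast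
    have U2c: "?U2 \<subseteq> carrier G" using Uc by blast
    have ne: "inv x <# ?U2 \<noteq> {}" using J(2) by (auto simp: l_coset_def)
    obtain d' where d': "d' dvd rk H" "kneser_bound d' (rk R) (rk (inv x <# ?U2)) (rk (prd R (inv x <# ?U2)))"
      using kneser_H[OF R flat_translate[OF J(1) inv_closed[OF xc]] ne J(3)] by blast
    have d'': "kneser_bound d' (rk R) (rk ?U2) (rk (prd R ?U2))"
      using d'(2) rk_translate[OF J(1)] rk_prd_lcos[OF Rc U2c] xc by simp
    have "prd R H \<subseteq> H" by (rule prd_subgroup_subset[OF H R(3) order_refl])
    then have "rk (prd R H) \<le> rk H" using rk_mono[OF flat_prd[OF Rc HD(3)] HD(1)] by blast
    then have "rk (prd R ?U1) + rk (prd R ?U2) \<le> rk (prd R U) + rk H"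
      using submodular[OF Rc less.prems(1) flat_translate[OF HD(1) xc]] rk_prd_lcos[OF Rc HD(3) xc] by simp
    then have "kneser_bound d (rk R) (rk U) (rk (prd R U)) \<or> kneser_bound d' (rk R) (rk U) (rk (prd R U))"
      using divisors_chain[OF d(1) d'(1)] rk_pos[OF R(1,2)] J(4) rk_pos[OF J(1,2)] rk_pos[OF less.prems]
      by (intro kneser_bound_glue[where m = 0 and h = "rk H",
            OF dvd_pos_nat[OF HD(6) d(1)] d(1) dvd_pos_nat[OF HD(6) d'(1)] d'(1) _ _ _ d'' d(2)]) auto
    then show ?thesis using d d' by blast
  qed
qed

context
  fixes M Z S
  assumes M: "flat_subgroup M" and Z: "hyperplane M Z" and HM: "H \<subseteq> M"
    and S: "flat S" "S \<noteq> {}" "S \<subseteq> M" "prd S H \<noteq> M"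
    and least: "\<And>T. flat T \<Longrightarrow> T \<noteq> {} \<Longrightarrow> T \<subseteq> M \<Longrightarrow> prd S T \<noteq> M \<Longrightarrow>
      rk T + rk (prd S H) \<le> rk (prd S T) + rk H"
begin

abbreviation bounded :: "'a set \<Rightarrow> bool" where
  "bounded \<equiv> divisor_bounded H S"

lemma carrierI: "T \<subseteq> M \<Longrightarrow> T \<subseteq> carrier G"
  using flat_subgroupD(3)[OF M] by blast

lemma prd_M: "T \<subseteq> M \<Longrightarrow> prd S T \<subseteq> M"
  by (rule prd_subgroup_subset[OF M S(3)])

lemma flat_prd_S: "T \<subseteq> M \<Longrightarrow> flat (prd S T)"
  using flat_prd carrierI S(3) by blast

lemma up_S_le: "up (rk H) (rk S) \<le> rk (prd S H)" "rk H dvd rk (prd S H)"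
proof -
  note HD = flat_subgroupD[OF H]
  have Sc: "S \<subseteq> carrier G" using carrierI S(3) .
  show "rk H dvd rk (prd S H)"
    using rk_subgroup_dvd_stable[OF H flat_prd[OF Sc HD(3)]] prd_prd_subgroup[OF H Sc] by simp
  then show "up (rk H) (rk S) \<le> rk (prd S H)"
    using rk_le_prd_left[OF S(2,1) HD(5,3)] rk_pos[OF S(1,2)] by (intro up_least)
qed

text \<open>If \<open>rk (prd S H)\<close> exceeds the rounded rank of \<open>S\<close>, it does so
  by at least \<open>rk H\<close>, and this slack pays for rounding \<open>rk T\<close> in the
  minimality inequality.\<close>

lemma bounded_wide:
  assumes T: "flat T" "T \<noteq> {}" "T \<subseteq> M" "prd S T \<noteq> M" and wide: "up (rk H) (rk S) \<noteq> rk (prd S H)"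
  shows "bounded T"
proof -
  have "up (rk H) (rk S) + rk H \<le> up (rk H) (rk (prd S H))"
    using up_S_le wide flat_subgroupD(6)[OF H] by (intro up_gt_multiple dvd_up) auto
  also have "\<dots> \<le> rk (prd S H)"
    using up_S_le wide by (intro up_least) auto
  finally have "up (rk H) (rk S) + up (rk H) (rk T) \<le> rk (prd S T) + rk H"
    using least[OF T] up_le_add[OF rk_pos[OF T(1,2)], of "rk H"] by linarith
  then show ?thesis unfolding divisor_bounded_def by (intro exI[of _ "rk H"]) (simp add: kneser_bound_def)
qed

text \<open>Submodularity splits the product into \<open>S\<close> times the join and
  \<open>S\<close> times the piece of \<open>T\<close> in \<open>x H\<close>. The piece is
  translated into \<open>H\<close>, and \<open>kneser_bound_extend\<close> applies with the piece as
  the factor inside \<open>H\<close> and \<open>S\<close> as the arbitrary one.\<close>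

lemma bounded_step:
  assumes slim: "up (rk H) (rk S) = rk (prd S H)"
    and T: "flat T" "x \<in> T" "T \<subseteq> M" and J: "bounded (cl (T \<union> (x <# H)))"
  shows "bounded T"
proof -
  note HD = flat_subgroupD[OF H] and j = rk_join_lcos[OF H T(1,2)]
  let ?J = "cl (T \<union> (x <# H))" and ?I = "T \<inter> (x <# H)"
  have Sc: "S \<subseteq> carrier G" and Tc: "T \<subseteq> carrier G" using carrierI S(3) T(3) by auto
  then have xc: "x \<in> carrier G" and Ic: "?I \<subseteq> carrier G" using T(2) by auto
  have ne: "inv x <# ?I \<noteq> {}" using j(2) by (auto simp: l_coset_def)
  have f: "flat (inv x <# ?I)" using flat_translate[OF j(1)] xc by simp
  obtain d where d: "d dvd rk H" "kneser_bound d (rk S) (rk ?J) (rk (prd S ?J))"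
    using J unfolding divisor_bounded_def by blast
  obtain d' where d': "d' dvd rk H"
    "kneser_bound d' (rk (inv x <# ?I)) (rk S) (rk (prd (inv x <# ?I) S))"
    using kneser_bound_extend[OF f ne j(3) S(1,2)] by blast
  have d'': "kneser_bound d' (rk S) (rk ?I) (rk (prd S ?I))"
    using d'(2) rk_translate[OF j(1)] rk_prd_lcos[OF Sc Ic] xc prd_commute[OF flat_subset[OF f] Sc]
    by (simp add: kneser_bound_commute)
  \<comment> \<open>By \<open>slim\<close>, \<open>prd S H\<close> has exactly the rounded rank of
    \<open>S\<close>, so \<open>?m\<close> is the last multiple of \<open>rk H\<close> below
    \<open>rk S\<close>, as gluing requires.\<close>
  let ?m = "rk (prd S H) - rk H"
  have "rk H \<le> rk (prd S H)" using slim[symmetric] by (simp add: up_def)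
  then have m: "?m + rk H = rk (prd S H)" by simp
  have "rk (prd S ?J) + rk (prd S ?I) \<le> rk (prd S T) + rk (prd S H)"
    using submodular[OF Sc T(1) flat_translate[OF HD(1) xc]] rk_prd_lcos[OF Sc HD(3) xc] by simp
  then have v: "rk (prd S ?I) + rk (prd S ?J) \<le> rk (prd S T) + ?m + rk H" using m by linarith
  have "T \<noteq> {}" using T by blast
  have ms: "?m < rk S" using slim up_le_add[OF rk_pos[OF S(1,2)], of "rk H"] m by linarith
  have md: "rk H dvd ?m" using up_S_le(2) by simp
  have "kneser_bound d (rk S) (rk T) (rk (prd S T)) \<or> kneser_bound d' (rk S) (rk T) (rk (prd S T))"
    using j(4) rk_pos[OF j(1,2)] rk_pos[OF T(1) \<open>T \<noteq> {}\<close>] v divisors_chain[OF d(1) d'(1)]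
    by (intro kneser_bound_glue[where h = "rk H",
          OF dvd_pos_nat[OF HD(6) d(1)] d(1) dvd_pos_nat[OF HD(6) d'(1)] d'(1) _ md ms d'' d(2)]) auto
  then show ?thesis using d(1) d'(1) unfolding divisor_bounded_def by blast
qed

text \<open>Adding cosets does not change the hull, so the assumption that its product with
  \<open>S\<close> is proper survives until \<open>T\<close> is itself stable. There
  \<open>least\<close> and \<open>slim\<close> together are the bound for
  \<open>d = rk H\<close>.\<close>

lemma bounded_of_stable_hull:
  assumes slim: "up (rk H) (rk S) = rk (prd S H)"
    and T: "flat T" "T \<noteq> {}" "T \<subseteq> M" "prd S (prd T H) \<noteq> M"
  shows "bounded T"
  using T
proof (induction "rk (prd T H) - rk T" arbitrary: T rule: less_induct)
  case less
  note HD = flat_subgroupD[OF H]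
  have Tc: "T \<subseteq> carrier G" using carrierI less.prems by blast
  have THM: "prd T H \<subseteq> M" by (rule prd_subgroup_subset[OF M less.prems(3) HM])
  show ?case
  proof (cases "prd T H \<subseteq> T")
    case True
    then have "prd T H = T" using subset_prd_subgroup[OF H Tc] by blast
    then have "rk T + rk (prd S H) \<le> rk (prd S T) + rk H" using least less.prems by simp
    then show ?thesis using up_stable[OF less.prems(1) True less.prems(2)] slim unfolding divisor_bounded_def
      by (intro exI[of _ "rk H"]) (simp add: kneser_bound_def)
  next
    case False
    obtain x where x: "x \<in> T" "\<not> x <# H \<subseteq> T" using not_stableE[OF False less.prems(1)] .
    let ?J = "cl (T \<union> (x <# H))"
    note J = rk_join_lcos[OF H less.prems(1) x(1)] and K = join_lcos_measure[OF H less.prems(1) x]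
    have "x <# H \<subseteq> M" using subgroup_lcos[OF M Z _ HM] x less.prems by blast
    then have "?J \<subseteq> M" using less.prems flat_subgroupD(1)[OF M] by (intro cl_least) auto
    moreover have "?J \<noteq> {}" using J(6) x by blast
    moreover have "rk (prd ?J H) - rk ?J < rk (prd T H) - rk T"
      unfolding K(1) using K(2,3) by linarith
    moreover have "prd S (prd ?J H) \<noteq> M" unfolding K(1) by (rule less.prems(4))
    ultimately have "bounded ?J" using less.hyps[OF _ J(5)] by blast
    then show ?thesis using bounded_step[OF slim less.prems(1) x(1) less.prems(3)] by blast
  qed
qed

text \<open>The complement of the product is a candidate of the same kind as \<open>T\<close>, with
  its ranks related as \<open>kneser_bound_dual\<close> expects.\<close>

lemma dual:
  assumes T: "flat T" "T \<noteq> {}" "T \<subseteq> M" "prd S T \<noteq> M"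
  defines "D \<equiv> perp M Z (prd S T)"
  shows "flat D" "D \<noteq> {}" "D \<subseteq> M" "prd S D \<noteq> M" "rk D + rk (prd S T) = rk M"
    "rk (prd S D) + rk T \<le> rk M"
proof -
  show fD: "flat D" unfolding D_def by (rule flat_perp[OF M Z prd_M[OF T(3)]])
  show "D \<noteq> {}" unfolding D_def by (rule perp_nonempty[OF M Z flat_prd_S[OF T(3)] prd_M[OF T(3)] T(4)])
  show DM: "D \<subseteq> M" unfolding D_def by (rule perp_subset[OF M Z])
  show "rk D + rk (prd S T) = rk M"
    unfolding D_def by (rule rk_perp[OF M Z flat_prd_S[OF T(3)] prd_M[OF T(3)]])
  have "rk (prd S D) \<le> rk (perp M Z T)"
    using prd_perp_prd[OF M Z S(3) T(3)] unfolding D_def[symmetric]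
    by (intro rk_mono flat_prd_S DM flat_perp[OF M Z T(3)])
  then show le: "rk (prd S D) + rk T \<le> rk M" using rk_perp[OF M Z T(1,3)] by linarith
  show "prd S D \<noteq> M"
  proof
    assume "prd S D = M"
    then have "rk (prd S D) = rk M" by (rule arg_cong)
    then show False using le rk_pos[OF T(1,2)] by linarith
  qed
qed

lemma bounded_dual:
  assumes T: "flat T" "T \<noteq> {}" "T \<subseteq> M" "prd S T \<noteq> M" and "bounded (perp M Z (prd S T))"
  shows "bounded T"
proof -
  note D = dual[OF T]
  let ?D = "perp M Z (prd S T)"
  obtain d where d: "d dvd rk H" "kneser_bound d (rk S) (rk ?D) (rk (prd S ?D))"
    using assms(5) unfolding divisor_bounded_def by blast
  have "rk H dvd rk M"
    using rk_subgroup_dvd_stable[OF H flat_subgroupD(1)[OF M]] prd_subgroup_subset[OF M order_refl HM] by blast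
  then have "d dvd rk M" using d dvd_trans by blast
  moreover have "0 < d" using d(1) flat_subgroupD(6)[OF H] dvd_pos_nat by blast
  ultimately have "kneser_bound d (rk S) (rk T) (rk M - rk ?D)"
    using kneser_bound_dual[OF _ _ d(2) D(6) rk_pos[OF T(1,2)]] by blast
  moreover have "rk M - rk ?D = rk (prd S T)" using D(5) by linarith
  ultimately show ?thesis using d(1) unfolding divisor_bounded_def by auto
qed

text \<open>
  The dual \<open>D\<close> of the join \<open>J\<close> of \<open>T\<close> and \<open>x H\<close> is orthogonal to \<open>x S H\<close>, so \<open>S D H\<close> is proper although \<open>S T H\<close> need
  not be. The bound is therefore transferred from \<open>D\<close> to \<open>J\<close> by duality and from \<open>J\<close> to \<open>T\<close> by submodularity.
\<close>

lemma bounded_join: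
  assumes slim: "up (rk H) (rk S) = rk (prd S H)"
    and T: "flat T" "x \<in> T" "T \<subseteq> M" and J: "prd S (cl (T \<union> (x <# H))) \<noteq> M"
  shows "bounded T"
proof -
  note HD = flat_subgroupD[OF H] and MD = flat_subgroupD[OF M] and j = rk_join_lcos[OF H T(1,2)]
  let ?J = "cl (T \<union> (x <# H))"
  let ?D = "perp M Z (prd S ?J)"
  have xM: "x \<in> M" using T by blast
  have "x <# H \<subseteq> M" using subgroup_lcos[OF M Z xM HM] .
  then have JM: "?J \<subseteq> M" using T MD(1) by (intro cl_least) auto
  have Jne: "?J \<noteq> {}" using j(6) T by blast
  note D = dual[OF j(5) Jne JM J]
  have fx: "flat (perp M Z {x})" by (rule flat_perp[OF M Z]) (use xM in blast)
  \<comment> \<open>Pairing \<open>x\<close> with \<open>s y h\<close> is the same as pairing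
    \<open>s (x h)\<close> with \<open>y\<close>, and \<open>x h\<close> belongs to the
    join.\<close>
  have "S <#> (?D <#> H) \<subseteq> perp M Z {x}"
  proof
    fix w assume "w \<in> S <#> (?D <#> H)"
    then obtain s y h where w: "s \<in> S" "y \<in> ?D" "h \<in> H" "w = s \<otimes> (y \<otimes> h)"
      unfolding set_mult_def by blast
    have m: "s \<in> M" "y \<in> M" "h \<in> M" using w S(3) D(3) HM by auto
    have "x \<otimes> h \<in> ?J" using cl_incl[of "T \<union> (x <# H)"] w(3) by (auto simp: l_coset_def)
    then have "(s \<otimes> (x \<otimes> h)) \<otimes> y \<in> Z" using w(2) prd_mem[OF w(1)] unfolding perp_def by blast
    moreover have "(s \<otimes> (x \<otimes> h)) \<otimes> y = x \<otimes> w"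
      using m xM MD(3) w(4) by (simp add: m_ac subset_iff)
    ultimately show "w \<in> perp M Z {x}" using m MD(7) w(4) by (simp add: perp_def)
  qed
  moreover have "prd S (prd ?D H) = cl (S <#> (?D <#> H))"
    using prd_cl_right[OF carrierI[OF S(3)] set_mult_carrier[OF carrierI[OF D(3)] HD(3)]] by (simp add: prd_def)
  ultimately have sub: "prd S (prd ?D H) \<subseteq> perp M Z {x}" using cl_least[OF fx] by simp
  have "x \<notin> perp M Z (perp M Z {x}) \<or> perp M Z {x} \<noteq> M"
    using perp_self[OF M Z] by auto
  moreover have "x \<in> perp M Z (perp M Z {x})" using perp_sym[OF M Z, of "{x}" "perp M Z {x}"] xM by auto
  ultimately have "prd S (prd ?D H) \<noteq> M" using sub perp_subset[OF M Z, of "{x}"] by blast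
  then have "bounded ?D" by (rule bounded_of_stable_hull[OF slim D(1-3)])
  then have "bounded ?J" by (rule bounded_dual[OF j(5) Jne JM J])
  then show ?thesis by (rule bounded_step[OF slim T])
qed

text \<open>The piece of \<open>T\<close> in \<open>x H\<close> is nonempty, so its product with
  \<open>S\<close> has rank at least \<open>rk S\<close>; submodularity turns this into a lower
  bound for \<open>rk (prd S T)\<close>.\<close>

lemma rk_prd_join_full:
  assumes T: "flat T" "x \<in> T" "T \<subseteq> M" and J: "prd S (cl (T \<union> (x <# H))) = M"
  shows "rk M + rk S \<le> rk (prd S T) + rk (prd S H)"
proof -
  note HD = flat_subgroupD[OF H] and j = rk_join_lcos[OF H T(1,2)]
  have Sc: "S \<subseteq> carrier G" and xc: "x \<in> carrier G" using carrierI S(3) T by auto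
  have "rk S \<le> rk (prd S (T \<inter> (x <# H)))"
    using rk_le_prd_left[OF S(2,1) j(2)] T carrierI by blast
  then show ?thesis
    using submodular[OF Sc T(1) flat_translate[OF HD(1) xc]] rk_prd_lcos[OF Sc HD(3) xc] J by simp
qed

text \<open>
  If neither \<open>T\<close> nor its dual can be enlarged by a coset of \<open>H\<close> while its product with \<open>S\<close> stays proper, then
  both have rank less than \<open>rk H\<close>, and the bound for \<open>d = rk H\<close> is immediate.
\<close>

theorem bounded_all:
  assumes T: "flat T" "T \<noteq> {}" "T \<subseteq> M" "prd S T \<noteq> M"
  shows "bounded T"
proof (cases "up (rk H) (rk S) = rk (prd S H)")
  case False
  then show ?thesis using bounded_wide[OF T] by blast
next
  case slim: True
  note D = dual[OF T] and HD = flat_subgroupD[OF H] and MD = flat_subgroupD[OF M]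
  let ?D = "perp M Z (prd S T)"
  obtain x y where x: "x \<in> T" and y: "y \<in> ?D" using T(2) D(2) by blast
  consider "prd S (cl (T \<union> (x <# H))) \<noteq> M" | "prd S (cl (?D \<union> (y <# H))) \<noteq> M"
    | "prd S (cl (T \<union> (x <# H))) = M" "prd S (cl (?D \<union> (y <# H))) = M" by blast
  then show ?thesis
  proof cases
    case 1
    then show ?thesis by (rule bounded_join[OF slim T(1) x T(3)])
  next
    case 2
    then show ?thesis by (intro bounded_dual[OF T] bounded_join[OF slim D(1) y D(3)])
  next
    case 3
    have Tpos: "0 < rk T" and Spos: "0 < rk S" using rk_pos T S by auto
    have a: "rk (prd S H) < rk S + rk H" using up_le_add[OF Spos, of "rk H"] slim by simp
    have 1: "rk M + rk S \<le> rk (prd S T) + rk (prd S H)" by (rule rk_prd_join_full[OF T(1) x T(3) 3(1)])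
    have 2: "rk M + rk S \<le> rk (prd S ?D) + rk (prd S H)" by (rule rk_prd_join_full[OF D(1) y D(3) 3(2)])
    \<comment> \<open>A full join on the dual side makes \<open>rk (prd S ?D)\<close> larger than
      \<open>rk M - rk H\<close>, and duality leaves less than \<open>rk H\<close> for
      \<open>T\<close>.\<close>
    have "rk T < rk H" using 2 a D(6) by linarith
    then have b: "up (rk H) (rk T) \<le> rk H" using Tpos by (intro up_least) auto
    \<comment> \<open>Both ranks are multiples of \<open>rk H\<close>, so the proper flat
      \<open>prd S H\<close> falls short of \<open>M\<close> by at least \<open>rk H\<close>. With
      the full join on the side of \<open>T\<close> this makes \<open>rk (prd S T)\<close> at least
      \<open>rk (prd S H)\<close>.\<close>
    have "rk (prd S H) < rk M" by (rule rk_less_of_proper[OF flat_prd_S[OF HM] MD(1) prd_M[OF HM] S(4)])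
    moreover have "rk H dvd rk M"
      using rk_subgroup_dvd_stable[OF H MD(1)] prd_subgroup_subset[OF M order_refl HM] by blast
    ultimately have "rk (prd S H) + rk H \<le> up (rk H) (rk M)"
      using up_S_le(2) HD(6) by (intro up_gt_multiple) auto
    also have "\<dots> \<le> rk M" using \<open>rk H dvd rk M\<close> MD(6) by (intro up_least) auto
    finally have "rk (prd S H) \<le> rk (prd S T)" using 1 a by linarith
    then show ?thesis using slim b unfolding divisor_bounded_def
      by (intro exI[of _ "rk H"]) (simp add: kneser_bound_def)
  qed
qed

end

end

end

section \<open>The bound in prime power rank, and atoms of prime power rank\<close>

lemma prime_power_divisors_chain:
  assumes "Factorial_Ring.prime (p::nat)" "d dvd p ^ k" "d' dvd p ^ k"
  shows "d dvd d' \<or> d' dvd d"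
proof -
  obtain i j where ij: "d = p ^ i" "d' = p ^ j"
    using assms(2,3) unfolding divides_primepow_nat[OF assms(1)] by blast
  show ?thesis
  proof (cases "i \<le> j")
    case True
    then show ?thesis using ij le_imp_power_dvd by blast
  next
    case False
    then have "p ^ j dvd p ^ i" by (intro le_imp_power_dvd) simp
    then show ?thesis using ij by blast
  qed
qed

lemma dvd_prime_mult_cases:
  assumes "Factorial_Ring.prime (p::nat)" "Factorial_Ring.prime q" "d dvd q * p"
  shows "d = 1 \<or> d = q \<or> d = p \<or> d = q * p"
proof -
  obtain b c where d: "d = b * c" "b dvd q" "c dvd p" using division_decomp[OF assms(3)] by blast
  have "b = 1 \<or> b = q" "c = 1 \<or> c = p"
    using assms(1,2)[unfolded prime_nat_iff] d(2,3) by blast+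
  then show ?thesis using d(1) by auto
qed

lemma up_self: "0 < a \<Longrightarrow> a \<le> n \<Longrightarrow> up n a = n"
  by (simp add: up_def)

lemma up_dvd: "d dvd a \<Longrightarrow> 0 < a \<Longrightarrow> up d a = a"
  using up_least[of d a a] up_ge[of d a] dvd_pos_nat[of a d] by simp

lemma kneser_bound_top: "0 < a \<Longrightarrow> a \<le> n \<Longrightarrow> 0 < b \<Longrightarrow> b \<le> n \<Longrightarrow> n \<le> v \<Longrightarrow> kneser_bound n a b v"
  by (simp add: kneser_bound_def up_self)

context translation_matroid
begin

lemma prd_subgroup_absorb:
  assumes "flat_subgroup M" "S \<subseteq> M" "S \<noteq> {}"
  shows "prd S M = M"
proof -
  note MD = flat_subgroupD[OF assms(1)]
  have Sc: "S \<subseteq> carrier G" using assms(2) MD(3) by blast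
  have sub: "prd S M \<subseteq> M" by (rule prd_subgroup_subset[OF assms(1,2) order_refl])
  show ?thesis
    by (rule flat_eqI[OF flat_prd[OF Sc MD(3)] MD(1) sub rk_le_prd_right[OF Sc assms(3) MD(1)]])
qed

lemma rk_subgroup_dvd:
  assumes "flat_subgroup H" "flat_subgroup M" "H \<subseteq> M" shows "rk H dvd rk M"
  using rk_subgroup_dvd_stable[OF assms(1) flat_subgroupD(1)[OF assms(2)]]
    prd_subgroup_subset[OF assms(2) order_refl assms(3)] by blast

text \<open>\<open>H\<close> is known only once it has been obtained, so the bound inside
  \<open>H\<close> enters as the premise of an implication, to be discharged by the caller, for
  instance from an induction hypothesis.\<close>

lemma atom_bounded:
  assumes M: "flat_subgroup M" and S: "flat S" "S \<noteq> {}" "S \<subseteq> M"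
    and T: "flat T" "T \<noteq> {}" "T \<subseteq> M" "prd S T \<noteq> M"
  obtains H where "flat_subgroup H" "H \<subseteq> M" "prd S H \<noteq> M" "rk H dvd rk M" "rk H < rk M"
    "rk T + rk (prd S H) \<le> rk (prd S T) + rk H"
    "(\<forall>U R. flat U \<and> U \<noteq> {} \<and> U \<subseteq> H \<and> flat R \<and> R \<noteq> {} \<and> R \<subseteq> H \<longrightarrow> divisor_bounded H U R) \<longrightarrow>
      (\<forall>d d'. d dvd rk H \<longrightarrow> d' dvd rk H \<longrightarrow> d dvd d' \<or> d' dvd d) \<longrightarrow> divisor_bounded H S T"
proof -
  note MD = flat_subgroupD[OF M]
  obtain Z where "flat Z" "Z \<subseteq> M" "\<one> \<notin> Z" "rk Z + 1 = rk M" using hyperplane_exists[OF M] .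
  then have Z: "hyperplane M Z" by (simp add: hyperplane_def)
  obtain H where H: "flat_subgroup H" "H \<subseteq> M" "prd S H \<noteq> M"
    and least: "\<forall>T. flat T \<longrightarrow> T \<noteq> {} \<longrightarrow> T \<subseteq> M \<longrightarrow> prd S T \<noteq> M \<longrightarrow>
      rk T + rk (prd S H) \<le> rk (prd S T) + rk H"
    using atom_exists[OF M S T] .
  have "H \<noteq> M" using H(3) prd_subgroup_absorb[OF M S(3,2)] by blast
  then have lt: "rk H < rk M" by (rule rk_less_of_proper[OF flat_subgroupD(1)[OF H(1)] MD(1) H(2)])
  have "divisor_bounded H S T"
    if kneser: "\<forall>U R. flat U \<and> U \<noteq> {} \<and> U \<subseteq> H \<and> flat R \<and> R \<noteq> {} \<and> R \<subseteq> H \<longrightarrow> divisor_bounded H U R"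
      and chain: "\<forall>d d'. d dvd rk H \<longrightarrow> d' dvd rk H \<longrightarrow> d dvd d' \<or> d' dvd d"
  proof -
    have k: "\<exists>d. d dvd rk H \<and> kneser_bound d (rk U) (rk R) (rk (prd U R))"
      if "flat U" "U \<noteq> {}" "U \<subseteq> H" "flat R" "R \<noteq> {}" "R \<subseteq> H" for U R
      using kneser[rule_format, of U R] that unfolding divisor_bounded_def by simp
    show ?thesis
      by (rule bounded_all[OF H(1) k chain[rule_format] M Z H(2) S H(3) least[rule_format] T])
  qed
  then show thesis
    using that[OF H rk_subgroup_dvd[OF H(1) M H(2)] lt least[rule_format, OF T]] by simp
qed

text \<open>If the product is all of \<open>M\<close>, then \<open>d = rk M\<close> works. Otherwise
  the atom is proper and its rank is again a power of \<open>p\<close>, so that both the induction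
  hypothesis and the chain of divisors are available.\<close>

lemma kneser_prime_power:
  assumes p: "Factorial_Ring.prime p" and "flat_subgroup M" "rk M = p ^ m"
    and "flat S" "S \<noteq> {}" "S \<subseteq> M" "flat T" "T \<noteq> {}" "T \<subseteq> M"
  shows "divisor_bounded M S T"
  using assms(2-)
proof (induction "rk M" arbitrary: M m S T rule: less_induct)
  case less
  note M = less.prems(1) and S = less.prems(3-5) and T = less.prems(6-8)
  note MD = flat_subgroupD[OF M]
  show ?case
  proof (cases "prd S T = M")
    case True
    have "rk S \<le> rk M" "rk T \<le> rk M" using rk_mono[OF S(1) MD(1) S(3)] rk_mono[OF T(1) MD(1) T(3)] by auto
    then have "kneser_bound (rk M) (rk S) (rk T) (rk (prd S T))"
      using rk_pos[OF S(1,2)] rk_pos[OF T(1,2)] True by (intro kneser_bound_top) auto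
    then show ?thesis unfolding divisor_bounded_def by (intro exI[of _ "rk M"] conjI dvd_refl)
  next
    case False
    obtain H where H: "flat_subgroup H" "H \<subseteq> M" "prd S H \<noteq> M" "rk H dvd rk M" "rk H < rk M"
      "rk T + rk (prd S H) \<le> rk (prd S T) + rk H"
      and bound: "(\<forall>U R. flat U \<and> U \<noteq> {} \<and> U \<subseteq> H \<and> flat R \<and> R \<noteq> {} \<and> R \<subseteq> H \<longrightarrow> divisor_bounded H U R) \<longrightarrow>
      (\<forall>d d'. d dvd rk H \<longrightarrow> d' dvd rk H \<longrightarrow> d dvd d' \<or> d' dvd d) \<longrightarrow> divisor_bounded H S T"
      using atom_bounded[OF M S T False] .
    obtain k where k: "rk H = p ^ k" using divides_primepow_nat[OF p, of "rk H" m] less.prems(2) H(4) by auto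
    have "divisor_bounded H S T"
    proof (rule bound[rule_format])
      show "divisor_bounded H U R" if "flat U \<and> U \<noteq> {} \<and> U \<subseteq> H \<and> flat R \<and> R \<noteq> {} \<and> R \<subseteq> H" for U R
        using less.hyps[OF H(5) H(1) k, of U R] that by simp
    qed (rule prime_power_divisors_chain[OF p, of _ k], simp_all only: k)
    then obtain d where "d dvd rk H" "kneser_bound d (rk S) (rk T) (rk (prd S T))"
      unfolding divisor_bounded_def by blast
    then show ?thesis using dvd_trans[OF _ H(4)] unfolding divisor_bounded_def by (intro exI[of _ d]) simp
  qed
qed

text \<open>Prime power rank is asked of the atom only, not of \<open>M\<close>. For degrees such as
  6 or a product of two primes every proper divisor qualifies.\<close>

lemma atom_prime_power:
  assumes M: "flat_subgroup M" and S: "flat S" "S \<noteq> {}" "S \<subseteq> M"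
    and T: "flat T" "T \<noteq> {}" "T \<subseteq> M" "prd S T \<noteq> M"
  obtains H where "flat_subgroup H" "H \<subseteq> M" "prd S H \<noteq> M" "rk H dvd rk M" "rk H < rk M"
    "rk T + rk (prd S H) \<le> rk (prd S T) + rk H"
    "\<forall>p k. Factorial_Ring.prime p \<longrightarrow> rk H = p ^ k \<longrightarrow> divisor_bounded H S T"
proof -
  obtain H where H: "flat_subgroup H" "H \<subseteq> M" "prd S H \<noteq> M" "rk H dvd rk M" "rk H < rk M"
    "rk T + rk (prd S H) \<le> rk (prd S T) + rk H"
    and bound: "(\<forall>U R. flat U \<and> U \<noteq> {} \<and> U \<subseteq> H \<and> flat R \<and> R \<noteq> {} \<and> R \<subseteq> H \<longrightarrow> divisor_bounded H U R) \<longrightarrow>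
      (\<forall>d d'. d dvd rk H \<longrightarrow> d' dvd rk H \<longrightarrow> d dvd d' \<or> d' dvd d) \<longrightarrow> divisor_bounded H S T"
    using atom_bounded[OF M S T] .
  have "divisor_bounded H S T" if "Factorial_Ring.prime p" "rk H = p ^ k" for p k
  proof (rule bound[rule_format])
    show "divisor_bounded H U R" if "flat U \<and> U \<noteq> {} \<and> U \<subseteq> H \<and> flat R \<and> R \<noteq> {} \<and> R \<subseteq> H" for U R
      using kneser_prime_power[OF \<open>Factorial_Ring.prime p\<close> H(1) \<open>rk H = p ^ k\<close>, of U R] that by simp
  qed (rule prime_power_divisors_chain[OF that(1), of _ k], simp_all only: that(2))
  then show thesis using that[OF H] by simp
qed

end

lemma dvd_prime_cases: "Factorial_Ring.prime (p::nat) \<Longrightarrow> d dvd p \<Longrightarrow> d = 1 \<or> d = p"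
  unfolding prime_nat_iff by blast

lemma prime_three: "Factorial_Ring.prime (3::nat)"
  by simp

section \<open>Flags of a given tower type\<close>

text \<open>The common meeting point of both estimates: for \<open>v = T(i, j) + 1\<close> it is
  proved for every flag of the tower type, and for the tower flag any single \<open>s\<close> yields
  the matching upper bound.\<close>

definition tower_bounded :: "nat list \<Rightarrow> nat \<Rightarrow> nat \<Rightarrow> nat \<Rightarrow> bool" where
  "tower_bounded ns i j v \<longleftrightarrow> (\<exists>s\<le>length ns. kneser_bound (prod_list (take s ns)) (i + 1) (j + 1) v)"

lemma tower_boundedI:
  "kneser_bound (prod_list (take s ns)) (i + 1) (j + 1) v \<Longrightarrow> s \<le> length ns \<Longrightarrow> tower_bounded ns i j v"
  unfolding tower_bounded_def by blast

lemma tower_bounded_commute: "tower_bounded ns i j v \<longleftrightarrow> tower_bounded ns j i v"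
  unfolding tower_bounded_def using kneser_bound_commute by blast

lemma tower_bounded_one: "i + j + 1 \<le> v \<Longrightarrow> tower_bounded ns i j v"
  by (rule tower_boundedI[of 0]) (auto simp: kneser_bound_def up_def)

lemma tower_bounded_top:
  "i < prod_list ns \<Longrightarrow> j < prod_list ns \<Longrightarrow> prod_list ns \<le> v \<Longrightarrow> tower_bounded ns i j v"
  by (rule tower_boundedI[of "length ns"]) (auto intro!: kneser_bound_top)

context translation_matroid
begin

text \<open>
  The last clause is all that is used of the tower type: a subgroup containing a member of the flag
  of rank more than \<open>n\<^sub>1 \<dots> n\<^sub>s\<close> contains the member of the tower of rank \<open>n\<^sub>1 \<dots> n\<^sub>s\<^sub>+\<^sub>1\<close>.
\<close>

definition flag_along :: "nat list \<Rightarrow> (nat \<Rightarrow> 'a set) \<Rightarrow> bool" where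
  "flag_along ns F \<longleftrightarrow>
     rk (carrier G) = prod_list ns \<and> (\<forall>i<prod_list ns. flat (F i) \<and> rk (F i) = i + 1) \<and>
     (\<forall>i j. i \<le> j \<longrightarrow> j < prod_list ns \<longrightarrow> F i \<subseteq> F j) \<and> \<one> \<in> F 0 \<and>
     (\<forall>s<length ns. \<exists>C. flat_subgroup C \<and> rk C = prod_list (take (Suc s) ns) \<and>
        (\<forall>i H. prod_list (take s ns) \<le> i \<longrightarrow> i < prod_list ns \<longrightarrow> flat_subgroup H \<longrightarrow> F i \<subseteq> H \<longrightarrow> C \<subseteq> H))"

definition stabilizer :: "'a set \<Rightarrow> 'a set" where
  "stabilizer T = {g \<in> carrier G. g <# T \<subseteq> T}"

text \<open>The stabilizer is the intersection of the translates of \<open>T\<close> by inverses of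
  its elements, hence a flat. Since ranks are finite, \<open>g T\<close> inside \<open>T\<close>
  already means equality, which gives inverses.\<close>

lemma flat_subgroup_stabilizer:
  assumes "flat T" "T \<noteq> {}"
  shows "flat_subgroup (stabilizer T)"
proof -
  have Tc: "T \<subseteq> carrier G" using flat_subset assms by blast
  have "g \<in> stabilizer T \<longleftrightarrow> g \<in> (\<Inter>t\<in>T. inv t <# T)" for g
  proof
    assume g: "g \<in> stabilizer T"
    show "g \<in> (\<Inter>t\<in>T. inv t <# T)"
    proof
      fix t assume t: "t \<in> T"
      have c: "g \<in> carrier G" "t \<in> carrier G" using g t Tc by (auto simp: stabilizer_def)
      have "g \<otimes> t \<in> T" using g t by (auto simp: stabilizer_def l_coset_def)
      then show "g \<in> inv t <# T" using mem_lcos[OF Tc inv_closed[OF c(2)] c(1)] c m_comm[of g t] by simp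
    qed
  next
    assume g: "g \<in> (\<Inter>t\<in>T. inv t <# T)"
    obtain t0 where t0: "t0 \<in> T" using assms by blast
    then have "g \<in> inv t0 <# T" using g by blast
    then have gc: "g \<in> carrier G" using lcos_carrier[OF Tc, of "inv t0"] t0 Tc by blast
    have "g \<otimes> t \<in> T" if "t \<in> T" for t
    proof -
      have c: "t \<in> carrier G" using that Tc by blast
      have "g \<in> inv t <# T" using g that by blast
      then show ?thesis using mem_lcos[OF Tc inv_closed[OF c] gc] c gc m_comm[of g t] by simp
    qed
    then show "g \<in> stabilizer T" using gc by (auto simp: stabilizer_def l_coset_def)
  qed
  then have "stabilizer T = \<Inter>((\<lambda>t. inv t <# T) ` T)" by blast
  moreover have "\<forall>W\<in>(\<lambda>t. inv t <# T) ` T. flat W"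
    using Tc by (auto intro!: flat_translate assms)
  ultimately have f: "flat (stabilizer T)" using assms(2) flat_Inter[of "(\<lambda>t. inv t <# T) ` T"] by simp
  have eq: "g <# T = T" if "g \<in> stabilizer T" for g
    using that flat_eqI[OF flat_translate[OF assms(1)] assms(1)] rk_translate[OF assms(1)]
    by (auto simp: stabilizer_def)
  have "subgroup (stabilizer T) G"
  proof (rule subgroupI)
    show "stabilizer T \<subseteq> carrier G" by (auto simp: stabilizer_def)
    have "\<one> \<in> stabilizer T" using lcos_mult_one[OF Tc] by (simp add: stabilizer_def)
    then show "stabilizer T \<noteq> {}" by blast
    show "inv g \<in> stabilizer T" if "g \<in> stabilizer T" for g
    proof -
      have c: "g \<in> carrier G" using that by (simp add: stabilizer_def)
      then show ?thesis using lcos_inv_lcos[OF Tc c] eq[OF that] by (simp add: stabilizer_def)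
    qed
    show "g \<otimes> h \<in> stabilizer T" if "g \<in> stabilizer T" "h \<in> stabilizer T" for g h
    proof -
      have c: "g \<in> carrier G" "h \<in> carrier G" using that by (simp_all add: stabilizer_def)
      have "(g \<otimes> h) <# T = g <# (h <# T)" using lcos_m_assoc[OF Tc c] by simp
      then show ?thesis using eq[OF that(1)] eq[OF that(2)] c by (simp add: stabilizer_def)
    qed
  qed
  then show ?thesis using f by (simp add: flat_subgroup_def)
qed

lemma subset_of_prd_rk_eq:
  assumes "flat_subgroup H" "S \<subseteq> carrier G" "S \<noteq> {}" "\<one> \<in> S" "rk (prd S H) \<le> rk H"
  shows "S \<subseteq> H"
proof -
  note HD = flat_subgroupD[OF assms(1)]
  have "H \<subseteq> prd S H"
  proof
    fix h assume "h \<in> H"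
    then show "h \<in> prd S H" using prd_mem[OF assms(4), of h H] HD(3) by (simp add: subset_iff)
  qed
  then have "H = prd S H" using flat_eqI[OF HD(1) flat_prd[OF assms(2) HD(3)]] assms(5) by blast
  then show ?thesis using subset_prd_subgroup[OF assms(1,2)] by blast
qed

section \<open>Lower bounds for flags, by tower type\<close>

context
  fixes ns F
  assumes FA: "flag_along ns F"
begin

lemma flagD:
  shows "rk (carrier G) = prod_list ns"
    and "i < prod_list ns \<Longrightarrow> flat (F i)" "i < prod_list ns \<Longrightarrow> rk (F i) = i + 1"
    and "i < prod_list ns \<Longrightarrow> \<one> \<in> F i" "i < prod_list ns \<Longrightarrow> F i \<noteq> {}" "i < prod_list ns \<Longrightarrow> F i \<subseteq> carrier G"
    and "i \<le> j \<Longrightarrow> j < prod_list ns \<Longrightarrow> F i \<subseteq> F j"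
proof -
  show 1: "rk (carrier G) = prod_list ns" and 2: "i < prod_list ns \<Longrightarrow> flat (F i)"
    and "i < prod_list ns \<Longrightarrow> rk (F i) = i + 1"
    and 3: "i \<le> j \<Longrightarrow> j < prod_list ns \<Longrightarrow> F i \<subseteq> F j" for i j
    using FA by (simp_all add: flag_along_def)
  have "\<one> \<in> F 0" using FA by (simp add: flag_along_def)
  then show "i < prod_list ns \<Longrightarrow> \<one> \<in> F i" "i < prod_list ns \<Longrightarrow> F i \<noteq> {}" using 3[of 0 i] by auto
  show "i < prod_list ns \<Longrightarrow> F i \<subseteq> carrier G" using 2 flat_subset by blast
qed

lemma flag_subgroup:
  assumes "s < length ns"
  obtains C where "flat_subgroup C" "rk C = prod_list (take (Suc s) ns)"
    "\<And>i H. prod_list (take s ns) \<le> i \<Longrightarrow> i < prod_list ns \<Longrightarrow> flat_subgroup H \<Longrightarrow> F i \<subseteq> H \<Longrightarrow> C \<subseteq> H"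
proof -
  have "\<exists>C. flat_subgroup C \<and> rk C = prod_list (take (Suc s) ns) \<and>
        (\<forall>i H. prod_list (take s ns) \<le> i \<longrightarrow> i < prod_list ns \<longrightarrow> flat_subgroup H \<longrightarrow> F i \<subseteq> H \<longrightarrow> C \<subseteq> H)"
    using FA assms unfolding flag_along_def by blast
  then obtain C where C: "flat_subgroup C" "rk C = prod_list (take (Suc s) ns)"
     "\<forall>i H. prod_list (take s ns) \<le> i \<longrightarrow> i < prod_list ns \<longrightarrow> flat_subgroup H \<longrightarrow> F i \<subseteq> H \<longrightarrow> C \<subseteq> H"
    by blast
  then show thesis using that[OF C(1,2) C(3)[rule_format]] by simp
qed

lemma carrier_flat_subgroup: "flat_subgroup (carrier G)"
  using flat_carrier subgroup_self by (simp add: flat_subgroup_def)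

lemma flag_generates:
  assumes "s < length ns" "Suc s = length ns" "prod_list (take s ns) \<le> i" "i < prod_list ns" "flat_subgroup H"
    "F i \<subseteq> H"
  shows "rk H = rk (carrier G)"
proof -
  obtain C where C: "flat_subgroup C" "rk C = prod_list (take (Suc s) ns)" "C \<subseteq> H"
    using flag_subgroup[OF assms(1)] assms(3-6) by metis
  have "rk C \<le> rk H" "rk H \<le> rk (carrier G)"
    using rk_mono flat_subgroupD[OF assms(5)] flat_subgroupD[OF C(1)] C(3) flat_carrier by auto
  moreover have "rk C = rk (carrier G)" using C(2) assms(2) flagD(1) by simp
  ultimately show ?thesis by simp
qed

abbreviation flag_bounded where
  "flag_bounded i j \<equiv> tower_bounded ns i j (rk (prd (F i) (F j)))"

lemma flag_bounded_commute:
  "i < prod_list ns \<Longrightarrow> j < prod_list ns \<Longrightarrow> flag_bounded i j \<Longrightarrow> flag_bounded j i"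
  using tower_bounded_commute prd_commute[OF flagD(6) flagD(6)] by simp

lemma flag_le_right: "i < prod_list ns \<Longrightarrow> j < prod_list ns \<Longrightarrow> j + 1 \<le> rk (prd (F i) (F j))"
  using rk_le_prd_right[OF flagD(6) flagD(5) flagD(2)] flagD(3) by metis

lemma flag_bounded_0: "i = 0 \<Longrightarrow> i < prod_list ns \<Longrightarrow> j < prod_list ns \<Longrightarrow> flag_bounded i j"
  using flag_le_right[of i j] by (intro tower_bounded_one) simp

lemma flag_bounded_full:
  assumes "i < prod_list ns" "j < prod_list ns" "prd (F i) (F j) = carrier G"
  shows "flag_bounded i j"
  using tower_bounded_top[OF assms(1,2)] flagD(1) assms(3) by simp

text \<open>Either multiplication by \<open>F 1\<close> gains a rank, which is the bound for
  \<open>d = 1\<close>, or it fixes \<open>F j\<close>. In the second case the stabilizer of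
  \<open>F j\<close> contains \<open>F 1\<close>, hence the first step of the tower, so
  \<open>ns ! 0\<close> divides \<open>j + 1\<close> and the bound holds with
  \<open>d = ns ! 0\<close>.\<close>

lemma flag_bounded_1:
  assumes i: "i = 1" and ij: "i < prod_list ns" "j < prod_list ns" and ns: "ns \<noteq> []" "2 \<le> ns ! 0"
  shows "flag_bounded i j"
proof (cases "j + 2 \<le> rk (prd (F i) (F j))")
  case True
  then show ?thesis using i by (intro tower_bounded_one) simp
next
  case False
  note T = flagD(2,3,5,6)[OF ij(2)] and S = flagD(4,6)[OF ij(1)]
  have P: "rk (prd (F i) (F j)) = j + 1" using False flag_le_right[OF ij] by simp
  have "F j \<subseteq> prd (F i) (F j)"
    using prd_mem[OF S(1), of _ "F j"] T(4) by (metis l_one subsetD subsetI)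
  then have eq: "F j = prd (F i) (F j)" using flat_eqI[OF T(1) flat_prd[OF S(2) T(4)]] P T(2) by simp
  have "F i \<subseteq> stabilizer (F j)"
    using S(2) flat_subset_prd_lcos[of _ "F i" "F j"] eq by (auto simp: stabilizer_def)
  moreover have "0 < length ns" using ns by simp
  ultimately obtain C where C: "flat_subgroup C" "rk C = prod_list (take (Suc 0) ns)" "C \<subseteq> stabilizer (F j)"
    using flag_subgroup[of 0] i ij flat_subgroup_stabilizer[OF T(1,3)] by (metis le_refl prod_list.Nil take0)
  note CD = flat_subgroupD[OF C(1)]
  have rC: "rk C = ns ! 0" using C(2) ns by (cases ns) auto
  have "c \<otimes> t \<in> F j" if "c \<in> C" "t \<in> F j" for c t
    using that C(3) by (auto simp: stabilizer_def l_coset_def)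
  then have "prd C (F j) \<subseteq> F j" using T(1) by (intro prd_least) (auto simp: set_mult_subset_iff)
  then have "ns ! 0 dvd j + 1"
    using rk_subgroup_dvd_stable[OF C(1) T(1)] prd_commute[OF CD(3) T(4)] T(2) rC by simp
  then have "up (ns ! 0) (j + 1) = j + 1" by (intro up_dvd) auto
  moreover have "up (ns ! 0) (i + 1) = ns ! 0" using ns i by (intro up_self) auto
  moreover have "prod_list (take 1 ns) = ns ! 0" using ns by (cases ns) auto
  ultimately show ?thesis using P ns
    by (intro tower_boundedI[of 1]) (simp_all add: kneser_bound_def Suc_leI)
qed

text \<open>The divisors of \<open>p ^ t\<close> are exactly the degrees of this tower.\<close>

lemma flag_bounded_replicate:
  assumes p: "Factorial_Ring.prime p" "ns = replicate t p" and ij: "i < prod_list ns" "j < prod_list ns"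
  shows "flag_bounded i j"
proof -
  have rk: "rk (carrier G) = p ^ t" using flagD(1) p by simp
  obtain d where d: "d dvd p ^ t" "kneser_bound d (i + 1) (j + 1) (rk (prd (F i) (F j)))"
    using kneser_prime_power[OF p(1) carrier_flat_subgroup rk flagD(2,5,6)[OF ij(1)] flagD(2,5,6)[OF ij(2)]]
      flagD(3)[OF ij(1)] flagD(3)[OF ij(2)] rk unfolding divisor_bounded_def by auto
  obtain s where "d = p ^ s" "s \<le> t" using d(1) divides_primepow_nat[OF p(1)] by blast
  then show ?thesis using d(2) p(2) by (intro tower_boundedI[of s]) (auto simp: min_def)
qed

text \<open>The only divisor that is not a degree of the tower is 2. Indices 0 and 1 are known
  already; beyond them the bound for 2 implies an allowed one.\<close>

lemma flag_bounded_power2: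
  assumes ns: "ns = [4] \<or> ns = [4, 2]" and ij: "i < prod_list ns" "j < prod_list ns"
  shows "flag_bounded i j"
proof -
  obtain k :: nat where k: "prod_list ns = 2 ^ k" "k = 2 \<or> k = 3"
    using ns by (auto intro: that[of 2] that[of 3])
  have ne: "ns \<noteq> []" "2 \<le> ns ! 0" using ns by auto
  have rk: "rk (carrier G) = 2 ^ k" using flagD(1) k by simp
  consider "i = 0" | "j = 0" | "i = 1" | "j = 1" | "2 \<le> i" "2 \<le> j" by linarith
  then show ?thesis
  proof cases
    case 5
    let ?v = "rk (prd (F i) (F j))"
    obtain d where d: "d dvd 2 ^ k" "kneser_bound d (i + 1) (j + 1) ?v"
      using kneser_prime_power[OF two_is_prime_nat carrier_flat_subgroup rk flagD(2,5,6)[OF ij(1)] flagD(2,5,6)[OF ij(2)]]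
        flagD(3)[OF ij(1)] flagD(3)[OF ij(2)] rk unfolding divisor_bounded_def by auto
    obtain s where s: "d = 2 ^ s" "s \<le> k" using d(1) divides_primepow_nat[OF two_is_prime_nat] by blast
    consider "d = 1" | "d = 2" | "d = 4" | "d = 2 ^ k" using s k(2) by (auto simp: le_Suc_eq numeral_eq_Suc)
    then show ?thesis
    proof cases
      case 1
      then show ?thesis using d(2) by (intro tower_boundedI[of 0]) auto
    next
      case 3
      then show ?thesis using d(2) ns by (intro tower_boundedI[of 1]) auto
    next
      case 4
      then show ?thesis using d(2) k by (intro tower_boundedI[of "length ns"]) auto
    next
      case 2
      have i: "i \<in> {2,3,4,5,6,7}" and j: "j \<in> {2,3,4,5,6,7}" using ij ns 5 by auto
      \<comment> \<open>If one of the ranks is odd, rounding to even numbers gains enough for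
        \<open>d = 1\<close>. If both are even, they are at least 4: the pair (4,4) satisfies the
        bound for 4, and every larger pair forces \<open>8 \<le> ?v\<close>.\<close>
      have "(i + 1) + (j + 1) \<le> ?v + 1 \<or> up 4 (i + 1) + up 4 (j + 1) \<le> ?v + 4 \<or> 8 \<le> ?v"
        using d(2) i j unfolding 2 kneser_bound_def up_def by auto
      moreover have "prod_list (take 1 ns) = 4" using ns by auto
      moreover have "prod_list ns \<le> 8" using ns by auto
      ultimately show ?thesis
        using tower_bounded_one[of i j ?v ns] tower_boundedI[of 1 ns i j ?v] tower_bounded_top[OF ij, of ?v] ns
        by (auto simp: kneser_bound_def)
    qed
  qed (use ij ne flag_bounded_0 flag_bounded_1 flag_bounded_commute in blast)+
qed

text \<open>Rank data of the atom, ready for arithmetic. The clause placing \<open>F i\<close>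
  inside \<open>H\<close> is where the tower type can rule out a rank.\<close>

lemma flag_atom:
  assumes ij: "i < prod_list ns" "j < prod_list ns" and "prd (F i) (F j) \<noteq> carrier G"
  obtains H where "flat_subgroup H" "rk H dvd prod_list ns" "rk H < prod_list ns"
    "rk (prd (F i) H) < prod_list ns" "rk H dvd rk (prd (F i) H)" "rk H \<le> rk (prd (F i) H)"
    "rk (prd (F i) H) \<le> rk H \<longrightarrow> F i \<subseteq> H"
    "j + 1 + rk (prd (F i) H) \<le> rk (prd (F i) (F j)) + rk H"
    "\<forall>p k. Factorial_Ring.prime p \<longrightarrow> rk H = p ^ k \<longrightarrow>
      (\<exists>d. d dvd rk H \<and> kneser_bound d (i + 1) (j + 1) (rk (prd (F i) (F j))))"
proof -
  note S = flagD(2,5,6)[OF ij(1)] and T = flagD(2,5,6)[OF ij(2)]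
  obtain H where H: "flat_subgroup H" "H \<subseteq> carrier G" "prd (F i) H \<noteq> carrier G" "rk H dvd rk (carrier G)"
    "rk H < rk (carrier G)" "rk (F j) + rk (prd (F i) H) \<le> rk (prd (F i) (F j)) + rk H"
    "\<forall>p k. Factorial_Ring.prime p \<longrightarrow> rk H = p ^ k \<longrightarrow> divisor_bounded H (F i) (F j)"
    using atom_prime_power[OF carrier_flat_subgroup S T assms(3)] .
  have P: "flat (prd (F i) H)" using flat_prd[OF S(3) H(2)] .
  show thesis
  proof (rule that[OF H(1)])
    show "rk (prd (F i) H) < prod_list ns"
      using rk_less_of_proper[OF P flat_carrier flat_subset[OF P] H(3)] flagD(1) by simp
    show "rk H dvd rk (prd (F i) H)"
      using rk_subgroup_dvd_stable[OF H(1) P] prd_prd_subgroup[OF H(1) S(3)] by simp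
    show "rk H \<le> rk (prd (F i) H)" using rk_le_prd_right[OF S(3,2) flat_subgroupD(1)[OF H(1)]] .
    show "rk (prd (F i) H) \<le> rk H \<longrightarrow> F i \<subseteq> H"
      by (rule impI, rule subset_of_prd_rk_eq[OF H(1) S(3,2) flagD(4)[OF ij(1)]])
    show "\<forall>p k. Factorial_Ring.prime p \<longrightarrow> rk H = p ^ k \<longrightarrow>
      (\<exists>d. d dvd rk H \<and> kneser_bound d (i + 1) (j + 1) (rk (prd (F i) (F j))))"
      using H(7) flagD(3)[OF ij(1)] flagD(3)[OF ij(2)] unfolding divisor_bounded_def by auto
  qed (use H flagD(1) flagD(3)[OF ij(2)] in auto)
qed

text \<open>For an atom of rank 4, \<open>rk (prd (F i) H)\<close> is a multiple of 4 below 8, so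
  \<open>F i\<close> lies in \<open>H\<close>; but from index 2 on a member of the flag generates
  everything. Ordering the indices by \<open>j \<le> i\<close> makes \<open>i\<close> the one that
  is large enough.\<close>

lemma flag_bounded_24:
  assumes ns: "ns = [2, 4]" and ij: "i < prod_list ns" "j < prod_list ns"
  shows "flag_bounded i j"
proof -
  have *: "flag_bounded i j" if ij: "i < prod_list ns" "j < prod_list ns" "j \<le> i" for i j
  proof -
    consider "j = 0" | "i = 1" | "prd (F i) (F j) = carrier G" | "2 \<le> i" "prd (F i) (F j) \<noteq> carrier G"
      using ij(3) by linarith
    then show ?thesis
    proof cases
      case 4
      obtain H where H: "flat_subgroup H" "rk H dvd prod_list ns" "rk H < prod_list ns"
        "rk (prd (F i) H) < prod_list ns" "rk H dvd rk (prd (F i) H)" "rk H \<le> rk (prd (F i) H)"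
        "rk (prd (F i) H) \<le> rk H \<longrightarrow> F i \<subseteq> H"
        "j + 1 + rk (prd (F i) H) \<le> rk (prd (F i) (F j)) + rk H"
        "\<forall>p k. Factorial_Ring.prime p \<longrightarrow> rk H = p ^ k \<longrightarrow>
          (\<exists>d. d dvd rk H \<and> kneser_bound d (i + 1) (j + 1) (rk (prd (F i) (F j))))"
        using flag_atom[OF ij(1,2) 4(2)] .
      have n8: "prod_list ns = 2 ^ 3" using ns by simp
      obtain k where k: "k \<le> 3" "rk H = 2 ^ k"
        using H(2) unfolding n8 divides_primepow_nat[OF two_is_prime_nat] by blast
      have "rk H \<noteq> 4"
      proof
        assume h: "rk H = 4"
        then have "rk (prd (F i) H) \<le> rk H" using H(4,5) n8 by (auto elim!: dvdE)
        then have "F i \<subseteq> H" by (rule H(7)[rule_format])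
        then show False using flag_generates[of 1 i H] ns 4 ij H(1) h flagD(1) by simp
      qed
      then have "rk H = 1 \<or> rk H = 2" using k H(3) n8 by (auto simp: le_Suc_eq numeral_eq_Suc)
      moreover obtain d where d: "d dvd rk H" "kneser_bound d (i + 1) (j + 1) (rk (prd (F i) (F j)))"
        using H(9)[rule_format, OF two_is_prime_nat k(2)] by blast
      ultimately have "d = 1 \<or> d = 2" using dvd_prime_cases[OF two_is_prime_nat, of d] by auto
      then show ?thesis
      proof
        assume "d = 1"
        then show ?thesis using d(2) by (intro tower_boundedI[of 0]) auto
      next
        assume "d = 2"
        then show ?thesis using d(2) ns by (intro tower_boundedI[of 1]) auto
      qed
    next
      case 1
      then show ?thesis by (rule flag_bounded_commute[OF ij(2,1) flag_bounded_0[OF _ ij(2,1)]])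
    next
      case 2
      then show ?thesis using ns by (intro flag_bounded_1 ij) auto
    qed (rule flag_bounded_full[OF ij(1,2)])
  qed
  show ?thesis using *[OF ij] *[OF ij(2,1)] flag_bounded_commute[OF ij(2,1)] by (cases "j \<le> i") auto
qed

text \<open>Rank 3 is impossible for the atom: it would contain \<open>F i\<close>, which generates
  everything as soon as \<open>i\<close> is positive. Rank 2 may occur, but for \<open>i\<close> and
  \<open>j\<close> at least 2 both ranks round up to at least 4, and the bound for 2 makes the
  product full.\<close>

lemma flag_bounded_6:
  assumes ns: "ns = [6]" and ij: "i < prod_list ns" "j < prod_list ns"
  shows "flag_bounded i j"
proof -
  consider "i = 0" | "j = 0" | "i = 1" | "j = 1" | "prd (F i) (F j) = carrier G"
    | "2 \<le> i" "2 \<le> j" "prd (F i) (F j) \<noteq> carrier G"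
  proof (cases "prd (F i) (F j) = carrier G")
    case False
    then show ?thesis using that by (cases "i < 2"; cases "j < 2") (auto simp: less_2_cases_iff)
  qed (use that in blast)
  then show ?thesis
  proof cases
    case 6
    let ?v = "rk (prd (F i) (F j))"
    obtain H where H: "flat_subgroup H" "rk H dvd prod_list ns" "rk H < prod_list ns"
      "rk (prd (F i) H) < prod_list ns" "rk H dvd rk (prd (F i) H)" "rk H \<le> rk (prd (F i) H)"
      "rk (prd (F i) H) \<le> rk H \<longrightarrow> F i \<subseteq> H"
      "j + 1 + rk (prd (F i) H) \<le> ?v + rk H"
      and bound: "\<forall>p k. Factorial_Ring.prime p \<longrightarrow> rk H = p ^ k \<longrightarrow>
        (\<exists>d. d dvd rk H \<and> kneser_bound d (i + 1) (j + 1) ?v)"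
      using flag_atom[OF ij 6(3)] .
    have n6: "prod_list ns = 6" using ns by simp
    have "(6::nat) = 2 * 3" by simp
    then have "rk H dvd 2 * 3" using H(2) unfolding n6 by (rule subst)
    then have "rk H = 1 \<or> rk H = 2 \<or> rk H = 3 \<or> rk H = 2 * 3"
      by (rule dvd_prime_mult_cases[OF prime_three two_is_prime_nat])
    then have "rk H = 1 \<or> rk H = 2 \<or> rk H = 3"
    proof (elim disjE)
      assume "rk H = 2 * 3"
      then show ?thesis using H(3) n6 by linarith
    qed simp_all
    moreover have "rk H \<noteq> 3"
    proof
      assume h: "rk H = 3"
      obtain k where k: "rk (prd (F i) H) = 3 * k" using H(5)[unfolded h] unfolding dvd_def by blast
      then have "k \<le> 1" using H(4) n6 by linarith
      then have "rk (prd (F i) H) \<le> rk H" using k h by linarith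
      then have "F i \<subseteq> H" by (rule H(7)[rule_format])
      moreover have "Suc 0 = length ns" "prod_list (take 0 ns) \<le> i" using ns 6(1) by auto
      ultimately have "rk H = rk (carrier G)" using ij(1) H(1) by (intro flag_generates[of 0 i]) auto
      then show False using h n6 flagD(1) by linarith
    qed
    ultimately have h: "rk H = 1 \<or> rk H = 2" by blast
    then have "rk H = 2 ^ 0 \<or> rk H = 2 ^ 1" by simp
    then obtain d where "d dvd rk H" and d: "kneser_bound d (i + 1) (j + 1) ?v"
      using bound[rule_format, OF two_is_prime_nat] by blast
    then have "d = 1 \<or> d = 2" using h dvd_prime_cases[OF two_is_prime_nat, of d] by auto
    then show ?thesis
    proof
      assume "d = 1"
      then show ?thesis using d by (intro tower_boundedI[of 0]) auto
    next
      assume "d = 2"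
      moreover have "4 \<le> up 2 (i + 1)" "4 \<le> up 2 (j + 1)"
        using up_gt_multiple[of 2 2 "i + 1"] up_gt_multiple[of 2 2 "j + 1"] 6 by auto
      ultimately show ?thesis using d n6 by (intro tower_bounded_top[OF ij]) (simp add: kneser_bound_def)
    qed
  next
    case 1
    then show ?thesis by (intro flag_bounded_0 ij)
  next
    case 2
    then show ?thesis by (rule flag_bounded_commute[OF ij(2,1) flag_bounded_0[OF _ ij(2,1)]])
  next
    case 3
    then show ?thesis using ns by (intro flag_bounded_1 ij) auto
  next
    case 4
    then show ?thesis using ns by (intro flag_bounded_commute[OF ij(2,1)] flag_bounded_1 ij) auto
  qed (rule flag_bounded_full[OF ij])
qed

text \<open>The critical atom has rank \<open>p\<close>. It cannot contain \<open>F i\<close>, since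
  then it would contain the first step of the tower and \<open>q\<close> would divide
  \<open>p\<close>. So \<open>rk (prd (F i) H)\<close> is \<open>k * p\<close> with
  \<open>1 < k < q\<close>, which leaves \<open>k = 2\<close>, \<open>q = 3\<close>. For
  \<open>i \<le> p\<close> minimality of the atom is at least as strong as the bound for
  \<open>d = 1\<close>; for \<open>i > p\<close> both ranks round up to at least
  \<open>2 * p\<close>, and the product is full.\<close>

lemma flag_bounded_two_primes:
  assumes q: "q = 2 \<or> q = 3" and p: "Factorial_Ring.prime p" "p \<noteq> q" and ns: "ns = [q, p]"
    and ij: "i < prod_list ns" "j < prod_list ns"
  shows "flag_bounded i j"
proof -
  have prime_q: "Factorial_Ring.prime q" using q prime_three by auto
  have n: "prod_list ns = q * p" using ns by simp
  have *: "flag_bounded i j" if ij: "i < prod_list ns" "j < prod_list ns" "i \<le> j" for i j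
  proof -
    let ?v = "rk (prd (F i) (F j))"
    consider "i = 0" | "prd (F i) (F j) = carrier G" | "1 \<le> i" "prd (F i) (F j) \<noteq> carrier G"
      using ij(3) by linarith
    then show ?thesis
    proof cases
      case 3
      obtain H where H: "flat_subgroup H" "rk H dvd prod_list ns" "rk H < prod_list ns"
        "rk (prd (F i) H) < prod_list ns" "rk H dvd rk (prd (F i) H)" "rk H \<le> rk (prd (F i) H)"
        "rk (prd (F i) H) \<le> rk H \<longrightarrow> F i \<subseteq> H" "j + 1 + rk (prd (F i) H) \<le> ?v + rk H"
        and bound: "\<forall>p k. Factorial_Ring.prime p \<longrightarrow> rk H = p ^ k \<longrightarrow>
          (\<exists>d. d dvd rk H \<and> kneser_bound d (i + 1) (j + 1) ?v)"
        using flag_atom[OF ij(1,2) 3(2)] .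
      have "rk H = 1 \<or> rk H = q \<or> rk H = p"
        using dvd_prime_mult_cases[OF p(1) prime_q H(2)[unfolded n]] H(3) n by linarith
      then consider "rk H = q ^ 0 \<or> rk H = q ^ 1" "rk H dvd q" | "rk H = p" by auto
      then show ?thesis
      proof cases
        case 1
        then obtain d where "d dvd rk H" and d: "kneser_bound d (i + 1) (j + 1) ?v"
          using bound[rule_format, OF prime_q] by blast
        then have "d dvd q" using 1(2) dvd_trans by blast
        then have "d = 1 \<or> d = q" using dvd_prime_cases[OF prime_q] by blast
        then show ?thesis
        proof
          assume "d = 1"
          then show ?thesis using d by (intro tower_boundedI[of 0]) auto
        next
          assume "d = q"
          then show ?thesis using d ns by (intro tower_boundedI[of 1]) auto
        qed
      next
        case 2
        have "\<not> rk (prd (F i) H) \<le> rk H"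
        proof
          assume "rk (prd (F i) H) \<le> rk H"
          then have sub: "F i \<subseteq> H" by (rule H(7)[rule_format])
          obtain C where C: "flat_subgroup C" "rk C = prod_list (take (Suc 0) ns)" "C \<subseteq> H"
            using flag_subgroup[of 0] 3(1) ij(1) H(1) sub ns by (metis length_greater_0_conv list.distinct(1) prod_list.Nil take0)
          have "q dvd p" using rk_subgroup_dvd[OF C(1) H(1) C(3)] C(2) 2 ns by simp
          then show False using primes_dvd_imp_eq[OF prime_q p(1)] p(2) by simp
        qed
        moreover obtain k where "rk (prd (F i) H) = p * k" using H(5)[unfolded 2] unfolding dvd_def by blast
        ultimately have k: "rk (prd (F i) H) = p * k" "1 < k" using 2 by (auto intro: ccontr)
        then have "k < q" using H(4) n by (simp add: mult.commute)
        then have k2: "k = 2" "q = 3" using q k(2) by auto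
        show ?thesis
        proof (cases "i \<le> p")
          case True
          then show ?thesis using H(8) k(1) k2 2 by (intro tower_bounded_one) simp
        next
          case False
          have "rk H = p ^ 1" using 2 by simp
          then obtain d where "d dvd p" and d: "kneser_bound d (i + 1) (j + 1) ?v"
            using bound[rule_format, OF p(1)] 2 by blast
          then have "d = 1 \<or> d = p" using dvd_prime_cases[OF p(1)] by blast
          then show ?thesis
          proof
            assume "d = 1"
            then show ?thesis using d by (intro tower_boundedI[of 0]) auto
          next
            assume dp: "d = p"
            have "p + p \<le> up p (i + 1)" "p + p \<le> up p (j + 1)"
              using up_gt_multiple[of p p "i + 1"] up_gt_multiple[of p p "j + 1"] False ij(3)
                prime_gt_0_nat[OF p(1)] by auto
            then show ?thesis using d n k2 unfolding dp
              by (intro tower_bounded_top[OF ij(1,2)]) (simp add: kneser_bound_def)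
          qed
        qed
      qed
    next
      case 1
      then show ?thesis by (intro flag_bounded_0 ij)
    qed (rule flag_bounded_full[OF ij(1,2)])
  qed
  show ?thesis using *[OF ij] *[OF ij(2,1)] flag_bounded_commute[OF ij(2,1)] by (cases "i \<le> j") auto
qed

end

end

lemma prod_list_take_Suc: "s < length ns \<Longrightarrow> prod_list (take (Suc s) ns) = prod_list (take s ns) * ns ! s"
  by (simp add: take_Suc_conv_app_nth)

text \<open>Passage from the definition of the tower type to the form used above. \<open>g i\<close>
  stands for the object generated by \<open>F i\<close>, a subgroup or the unit group of a subfield,
  so that one proof serves both. The degree is not presupposed but read off from the chain.\<close>

lemma (in translation_matroid) flag_alongI:
  assumes n: "n = rk (carrier G)"
    and F: "\<And>i. i < n \<Longrightarrow> flat (F i)" "\<And>i. i < n \<Longrightarrow> rk (F i) = i + 1"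
      "\<And>i. Suc i < n \<Longrightarrow> F i \<subseteq> F (Suc i)" "\<one> \<in> F 0" "F (n - 1) = carrier G"
    and g: "\<And>i. i < n \<Longrightarrow> F i \<subseteq> g i" "\<And>i. i < n \<Longrightarrow> flat_subgroup (g i)"
      "\<And>i H. i < n \<Longrightarrow> flat_subgroup H \<Longrightarrow> F i \<subseteq> H \<Longrightarrow> g i \<subseteq> H" "rk (g 0) = 1"
    and Cs: "length Cs = length ns + 1" "sorted_wrt (\<subset>) Cs" "set Cs = g ` {..<n}"
      "\<And>s. s < length ns \<Longrightarrow> rk (Cs ! Suc s) = ns ! s * rk (Cs ! s)"
  shows "flag_along ns F" "n = prod_list ns"
proof -
  have npos: "0 < n" using n rk_pos[OF flat_carrier] by auto
  have mono: "F i \<subseteq> F j" if "i \<le> j" "j < n" for i j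
    using that
  proof (induction j)
    case (Suc j)
    then show ?case using F(3)[of j] by (cases "i = Suc j") auto
  qed simp
  have less: "Cs ! s \<subset> Cs ! t" if "s < t" "t \<le> length ns" for s t
    using Cs(1,2) that by (simp add: sorted_wrt_iff_nth_less)
  have le: "Cs ! s \<subseteq> Cs ! t" if "s \<le> t" "t \<le> length ns" for s t
    using that less[of s t] by (cases "s = t") auto
  have mem: "\<exists>i<n. Cs ! s = g i" if "s \<le> length ns" for s
  proof -
    have "Cs ! s \<in> set Cs" using that Cs(1) by simp
    then show ?thesis unfolding Cs(3) by auto
  qed
  have idx: "\<exists>s\<le>length ns. g i = Cs ! s" if "i < n" for i
  proof -
    have "g i \<in> set Cs" using that Cs(3) by simp
    then show ?thesis using Cs(1) by (auto simp: in_set_conv_nth less_Suc_eq_le)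
  qed
  have C0: "Cs ! 0 = g 0"
  proof
    show "Cs ! 0 \<subseteq> g 0" using idx[OF npos] le[of 0] by auto
    obtain i where i: "i < n" "Cs ! 0 = g i" using mem[of 0] by auto
    then show "g 0 \<subseteq> Cs ! 0" using g(3)[OF npos g(2)[OF i(1)]] g(1)[OF i(1)] mono[of 0 i] by auto
  qed
  have rkC: "rk (Cs ! s) = prod_list (take s ns)" if "s \<le> length ns" for s
    using that
  proof (induction s)
    case (Suc s)
    then show ?case using Cs(4)[of s] by (simp add: prod_list_take_Suc mult.commute)
  qed (simp add: C0 g(4))
  obtain s where s: "s \<le> length ns" "g (n - 1) = Cs ! s" using idx[of "n - 1"] npos by auto
  have gn: "g (n - 1) = carrier G"
    using F(5) g(1)[of "n - 1"] flat_subgroupD(3)[OF g(2)[of "n - 1"]] npos by auto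
  obtain i where i: "i < n" "Cs ! length ns = g i" using mem[of "length ns"] by auto
  then have "Cs ! length ns = carrier G"
    using flat_subgroupD(3)[OF g(2)[OF i(1)]] le[OF s(1)] s(2) gn by auto
  then show N: "n = prod_list ns" using rkC[of "length ns"] n by simp
  have "\<exists>C. flat_subgroup C \<and> rk C = prod_list (take (Suc s) ns) \<and>
        (\<forall>i H. prod_list (take s ns) \<le> i \<longrightarrow> i < prod_list ns \<longrightarrow> flat_subgroup H \<longrightarrow> F i \<subseteq> H \<longrightarrow> C \<subseteq> H)"
    if s: "s < length ns" for s
  proof (intro exI[of _ "Cs ! Suc s"] conjI allI impI)
    obtain i where "i < n" "Cs ! Suc s = g i" using mem[of "Suc s"] s by auto
    then show "flat_subgroup (Cs ! Suc s)" using g(2) by simp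
    show "rk (Cs ! Suc s) = prod_list (take (Suc s) ns)" using rkC[of "Suc s"] s by simp
  next
    fix i H assume i: "prod_list (take s ns) \<le> i" "i < prod_list ns" and H: "flat_subgroup H" "F i \<subseteq> H"
    have iN: "i < n" using i N by simp
    obtain t where t: "t \<le> length ns" "g i = Cs ! t" using idx[OF iN] by blast
    \<comment> \<open>\<open>F i\<close> has rank \<open>i + 1\<close>, which exceeds the rank of
      \<open>Cs ! s\<close>; so what it generates sits at a position beyond \<open>s\<close> in the
      chain.\<close>
    have "rk (F i) \<le> rk (g i)" using rk_mono[OF F(1)[OF iN] flat_subgroupD(1)[OF g(2)[OF iN]] g(1)[OF iN]] .
    then have "rk (Cs ! s) < rk (Cs ! t)" using F(2)[OF iN] i rkC[of s] s t by simp
    moreover have flatC: "flat (Cs ! u)" if u: "u \<le> length ns" for u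
    proof -
      obtain k where "k < n" "Cs ! u = g k" using mem[OF u] by blast
      then show ?thesis using flat_subgroupD(1)[OF g(2), of k] by simp
    qed
    have "flat (Cs ! s)" "flat (Cs ! t)" using flatC[of s] flatC[OF t(1)] s by simp_all
    ultimately have "\<not> t \<le> s" using le[of t s] rk_mono[of "Cs ! t" "Cs ! s"] s by auto
    then have "Cs ! Suc s \<subseteq> g i" using le[of "Suc s" t] t by simp
    then show "Cs ! Suc s \<subseteq> H" using g(3)[OF iN H] by blast
  qed
  then show "flag_along ns F" using n F mono unfolding flag_along_def N[symmetric] by blast
qed

section \<open>Groups and fields as matroids\<close>

lemma (in comm_group) card_lcos: "A \<subseteq> carrier G \<Longrightarrow> g \<in> carrier G \<Longrightarrow> card (g <# A) = card A"
proof -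
  assume *: "A \<subseteq> carrier G" "g \<in> carrier G"
  have "g <# A = (\<otimes>) g ` A" unfolding l_coset_def by auto
  moreover have "inj_on ((\<otimes>) g) A"
  proof (rule inj_onI)
    fix x y assume "x \<in> A" "y \<in> A" "g \<otimes> x = g \<otimes> y"
    moreover then have "x \<in> carrier G" "y \<in> carrier G" using * by blast+
    ultimately show "x = y" using * l_cancel by blast
  qed
  ultimately show ?thesis by (simp add: card_image)
qed

lemma group_translation_matroid:
  assumes "comm_group G" "finite (carrier G)"
  shows "translation_matroid G (\<lambda>A. A \<subseteq> carrier G) card"
proof -
  interpret comm_group G by fact
  have fin: "finite A" if "A \<subseteq> carrier G" for A using finite_subset[OF that assms(2)] .
  have Inter_eq: "\<Inter>{W. W \<subseteq> carrier G \<and> A \<subseteq> W} = A" if "A \<subseteq> carrier G" for A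
    using that by (intro antisym Inter_lower Inter_greatest) simp_all
  show ?thesis
  proof (unfold_locales, goal_cases)
    case (4 \<F>)
    then show ?case by blast
  next
    case (5 A g)
    then show ?case unfolding l_coset_def by auto
  next
    case (6 A g)
    then show ?case by (rule card_lcos)
  next
    case (7 A B)
    then show ?case by (intro psubset_card_mono fin)
  next
    case 9
    then show ?case using Inter_eq[of "{\<one>\<^bsub>G\<^esub>}"] by simp
  next
    case (10 A B)
    then show ?case using Inter_eq[of "A \<union> B"] card_Un_Int[OF fin[OF 10(1)] fin[OF 10(2)]] by simp
  qed simp_all
qed

section \<open>Subspaces of a finite field extension\<close>

locale finite_field_extension = field L for L (structure) +
  fixes K n
  assumes K: "subfield K L" and dim_L: "dimension n K (carrier L)"
begin

lemma K_carrier: "K \<subseteq> carrier L" and one_K: "\<one> \<in> K" and zero_K: "\<zero> \<in> K"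
  using subringE(1,2,3)[OF subfieldE(1)[OF K]] by auto

lemma dim_eq: "dimension m K V \<Longrightarrow> dim K V = m"
  using dimI[OF K] by (simp add: over_def)

text \<open>Despite its name, \<open>subalgebra K V L\<close> requires only closure under addition,
  negation and multiplication by \<open>K\<close>: it describes the
  \<open>K\<close>-subspaces.\<close>

lemma subalgebra_dimension: "subalgebra K V L \<Longrightarrow> dimension (dim K V) K V"
  using finite_dimensionE[OF K subalbegra_incl_imp_finite_dimension[OF K finite_dimensionI[OF dim_L]]]
    subalgebra_in_carrier by (simp add: over_def)

lemma dimension_subalgebra: "dimension m K V \<Longrightarrow> subalgebra K V L"
  using finite_dimension_imp_subalgebra[OF K finite_dimensionI] .

lemma subalgebra_zero: "subalgebra K V L \<Longrightarrow> \<zero> \<in> V"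
  using subgroup.one_closed[OF subalgebra.axioms(1)] by fastforce

lemma subalgebra_add: "subalgebra K V L \<Longrightarrow> x \<in> V \<Longrightarrow> y \<in> V \<Longrightarrow> x \<oplus> y \<in> V"
  using subgroup.m_closed[OF subalgebra.axioms(1)] by fastforce

lemma dimension_mono:
  assumes "dimension a K V" "dimension b K W" "V \<subseteq> W"
  shows "a \<le> b" "a = b \<Longrightarrow> V = W"
proof -
  obtain Us where Us: "set Us \<subseteq> carrier L" "independent K Us" "length Us = a" "Span K Us = V"
    using exists_base[OF K assms(1)] by blast
  have sub: "set Us \<subseteq> W" using Span_base_incl[OF K Us(1)] Us(4) assms(3) by blast
  show "a \<le> b" using independent_length_le_dimension[OF K assms(2) Us(2) sub] Us(3) by simp
  show "a = b \<Longrightarrow> V = W" using independent_length_eq_dimension[OF K assms(2) Us(2) sub] Us(3,4) by simp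
qed

lemma line_extension_scale:
  assumes "v \<in> carrier L" "E \<subseteq> carrier L" "g \<in> carrier L" "H \<subseteq> carrier L"
  shows "(\<otimes>) g ` line_extension H v E = line_extension H (g \<otimes> v) ((\<otimes>) g ` E)"
proof -
  have eq: "g \<otimes> (k \<otimes> v \<oplus> e) = k \<otimes> (g \<otimes> v) \<oplus> g \<otimes> e" if "k \<in> H" "e \<in> E" for k e
  proof -
    have "k \<in> carrier L" "e \<in> carrier L" using that assms by auto
    then show ?thesis using assms(1,3) by (simp add: r_distr m_lcomm)
  qed
  have img: "line_extension H w U = (\<lambda>(k, e). k \<otimes> w \<oplus> e) ` (H \<times> U)" for w U
    using line_extension_mem_iff[of _ H w U] by auto
  have "(\<otimes>) g ` line_extension H v E = (\<lambda>(k, e). g \<otimes> (k \<otimes> v \<oplus> e)) ` (H \<times> E)"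
    unfolding img image_image by (intro image_cong) auto
  also have "\<dots> = (\<lambda>(k, e). k \<otimes> (g \<otimes> v) \<oplus> g \<otimes> e) ` (H \<times> E)"
    using eq by (intro image_cong) auto
  also have "\<dots> = line_extension H (g \<otimes> v) ((\<otimes>) g ` E)"
    unfolding img by auto
  finally show ?thesis .
qed

text \<open>Scaling by a unit carries a basis to a basis, by induction along the definition of
  \<open>dimension\<close>. The inclusion \<open>E \<subseteq> carrier L\<close> is part of the
  conclusion because cancelling \<open>g\<close> in the step uses it.\<close>

lemma dimension_scale:
  assumes "dimension m H E" "H \<subseteq> carrier L" and g: "g \<in> carrier L" "g \<noteq> \<zero>"
  shows "E \<subseteq> carrier L \<and> dimension m H ((\<otimes>) g ` E)"
  using assms(1,2)
proof (induction m H E rule: dimension.induct)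
  case (zero_dim H)
  then show ?case using g by simp
next
  case (Suc_dim v E n H)
  then have IH: "E \<subseteq> carrier L" "dimension n H ((\<otimes>) g ` E)" by auto
  have "g \<otimes> v \<notin> (\<otimes>) g ` E"
  proof
    assume "g \<otimes> v \<in> (\<otimes>) g ` E"
    then obtain e where e: "e \<in> E" "g \<otimes> v = g \<otimes> e" by blast
    then have "v = e" using m_lcancel[OF g(2,1)] Suc_dim.hyps(1) IH(1) by blast
    then show False using e Suc_dim.hyps(2) by simp
  qed
  then have "dimension (Suc n) H (line_extension H (g \<otimes> v) ((\<otimes>) g ` E))"
    using dimension.Suc_dim IH(2) g(1) Suc_dim.hyps(1) by simp
  then show ?case
    using line_extension_scale[OF Suc_dim.hyps(1) IH(1) g(1) Suc_dim.prems] IH(1)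
      line_extension_in_carrier[OF Suc_dim.prems Suc_dim.hyps(1)] by simp
qed

lemma subalgebra_Inter:
  assumes "\<F> \<noteq> {}" "\<And>V. V \<in> \<F> \<Longrightarrow> subalgebra K V L"
  shows "subalgebra K (\<Inter>\<F>) L"
proof (intro subalgebra.intro subalgebra_axioms.intro)
  show "subgroup (\<Inter>\<F>) (add_monoid L)"
    using assms by (intro add.subgroups_Inter) (auto dest: subalgebra.axioms(1))
  show "k \<otimes> v \<in> \<Inter>\<F>" if "k \<in> K" "v \<in> \<Inter>\<F>" for k v
    using that assms(2) subalgebra.smult_closed by fastforce
qed

text \<open>Zero is removed so that flats live in the unit group; the zero subspace becomes the
  empty flat, of rank 0.\<close>

definition field_flat :: "'a set \<Rightarrow> bool" where
  "field_flat A \<longleftrightarrow> \<zero> \<notin> A \<and> subalgebra K (insert \<zero> A) L"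

definition field_rk :: "'a set \<Rightarrow> nat" where
  "field_rk A = dim K (insert \<zero> A)"

lemma field_flat_minus: "subalgebra K V L \<Longrightarrow> field_flat (V - {\<zero>})"
  using subalgebra_zero by (simp add: field_flat_def insert_absorb)

lemma field_rk_minus: "dimension m K V \<Longrightarrow> field_rk (V - {\<zero>}) = m"
  using dim_eq subalgebra_zero[OF dimension_subalgebra] by (simp add: field_rk_def insert_absorb)

lemma field_flat_dimension: "field_flat A \<Longrightarrow> dimension (field_rk A) K (insert \<zero> A)"
  using subalgebra_dimension by (simp add: field_flat_def field_rk_def)

lemma field_flat_carrier: "field_flat A \<Longrightarrow> A \<subseteq> carrier L - {\<zero>}"
  using subalgebra_in_carrier[of K "insert \<zero> A"] by (auto simp: field_flat_def)

lemma comm_group_mult_of: "comm_group (Multiplicative_Group.mult_of L)"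
  by (intro group.group_comm_groupI field_mult_group) (simp add: m_comm)

lemma field_translation_matroid: "translation_matroid (Multiplicative_Group.mult_of L) field_flat field_rk"
proof (intro translation_matroid.intro translation_matroid_axioms.intro comm_group_mult_of, goal_cases)
  case (1 A)
  then show ?case using field_flat_carrier by simp
next
  case 2
  then show ?case using field_flat_minus[OF carrier_is_subalgebra[OF K_carrier]] by simp
next
  case 3
  have "dimension 0 K {\<zero>}" by (rule zero_dim)
  then show ?case using field_flat_minus[OF dimension_subalgebra, of 0 "{\<zero>}"] by simp
next
  case (4 \<F>)
  have "subalgebra K (\<Inter>(insert \<zero> ` \<F>)) L"
    using 4 by (intro subalgebra_Inter) (auto simp: field_flat_def)
  moreover have "\<Inter>(insert \<zero> ` \<F>) = insert \<zero> (\<Inter>\<F>)" using 4(1) by auto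
  ultimately show ?case using 4 by (auto simp: field_flat_def)
next
  case (5 A g)
  have g: "g \<in> carrier L" "g \<noteq> \<zero>" using 5 by auto
  have eq: "(\<otimes>) g ` insert \<zero> A = insert \<zero> (g <#\<^bsub>Multiplicative_Group.mult_of L\<^esub> A)" using g by (auto simp: l_coset_def)
  have "\<zero> \<notin> g <#\<^bsub>Multiplicative_Group.mult_of L\<^esub> A"
  proof
    assume "\<zero> \<in> g <#\<^bsub>Multiplicative_Group.mult_of L\<^esub> A"
    then obtain x where "x \<in> A" "g \<otimes> x = \<zero>" by (auto simp: l_coset_def)
    then show False using field_flat_carrier[OF 5(1)] integral[of g x] g by blast
  qed
  then show ?case
    using dimension_scale[OF field_flat_dimension[OF 5(1)] K_carrier g] dimension_subalgebra unfolding field_flat_def eq by blast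
next
  case (6 A g)
  have g: "g \<in> carrier L" "g \<noteq> \<zero>" using 6 by auto
  have eq: "(\<otimes>) g ` insert \<zero> A = insert \<zero> (g <#\<^bsub>Multiplicative_Group.mult_of L\<^esub> A)" using g by (auto simp: l_coset_def)
  show ?case
    using dimension_scale[OF field_flat_dimension[OF 6(1)] K_carrier g] dim_eq unfolding eq field_rk_def by blast
next
  case (7 A B)
  note d = dimension_mono[OF field_flat_dimension[OF 7(1)] field_flat_dimension[OF 7(2)]]
  have "insert \<zero> A \<subseteq> insert \<zero> B" "insert \<zero> A \<noteq> insert \<zero> B"
    using 7 insert_ident[of \<zero> A B] unfolding field_flat_def by auto
  then show ?case using d by fastforce
next
  case 8
  have "dimension 0 K {\<zero>}" by (rule zero_dim)
  then show ?case using dim_eq by (simp add: field_rk_def)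
next
  case 9
  have "\<Inter>{A. field_flat A \<and> \<one>\<^bsub>Multiplicative_Group.mult_of L\<^esub> \<in> A} = K - {\<zero>}"
  proof
    have "field_flat (K - {\<zero>})" using field_flat_minus[OF dimension_subalgebra[OF dimension_one[OF K]]] .
    then show "\<Inter>{A. field_flat A \<and> \<one>\<^bsub>Multiplicative_Group.mult_of L\<^esub> \<in> A} \<subseteq> K - {\<zero>}" using one_K by (intro Inter_lower) simp
    have "K - {\<zero>} \<subseteq> A" if A: "field_flat A" "\<one> \<in> A" for A
    proof
      fix k assume k: "k \<in> K - {\<zero>}"
      then have "k \<otimes> \<one> \<in> insert \<zero> A" using A subalgebra.smult_closed unfolding field_flat_def by fast
      then show "k \<in> A" using k K_carrier by auto
    qed
    then show "K - {\<zero>} \<subseteq> \<Inter>{A. field_flat A \<and> \<one>\<^bsub>Multiplicative_Group.mult_of L\<^esub> \<in> A}" by (intro Inter_greatest) simp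
  qed
  then show ?case using field_rk_minus[OF dimension_one[OF K]] by simp
next
  case (10 A B)
  let ?A = "insert \<zero> A" and ?B = "insert \<zero> B"
  have zAB: "\<zero> \<notin> A" "\<zero> \<notin> B" using 10 by (auto simp: field_flat_def)
  have sA: "subalgebra K ?A L" and sB: "subalgebra K ?B L" using 10 by (auto simp: field_flat_def)
  have I: "?A \<inter> ?B = insert \<zero> (A \<inter> B)" by auto
  have dI: "dimension (field_rk (A \<inter> B)) K (?A \<inter> ?B)"
    using subalgebra_dimension[OF subalgebra_inter[OF sA sB]] unfolding I field_rk_def .
  have dS: "dimension (field_rk A + field_rk B - field_rk (A \<inter> B)) K (?A <+>\<^bsub>L\<^esub> ?B)"
    by (rule dimension_sum_space[OF K field_flat_dimension[OF 10(1)] field_flat_dimension[OF 10(2)] dI])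
  have le: "field_rk (A \<inter> B) \<le> field_rk A" using dimension_mono(1)[OF dI field_flat_dimension[OF 10(1)]] by blast
  have cA: "?A \<subseteq> carrier L" and cB: "?B \<subseteq> carrier L" using subalgebra_in_carrier sA sB by auto
  have sum: "?A <+>\<^bsub>L\<^esub> ?B = {a \<oplus> b | a b. a \<in> ?A \<and> b \<in> ?B}" unfolding set_add_def' by blast
  \<comment> \<open>Modularity is the dimension formula \<open>dS\<close> for the sum of two
    subspaces, once this sum is identified with the closure.\<close>
  have "\<Inter>{W. field_flat W \<and> A \<union> B \<subseteq> W} = (?A <+>\<^bsub>L\<^esub> ?B) - {\<zero>}"
  proof
    have "field_flat ((?A <+>\<^bsub>L\<^esub> ?B) - {\<zero>})" using field_flat_minus[OF dimension_subalgebra[OF dS]] .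
    moreover have "A \<union> B \<subseteq> (?A <+>\<^bsub>L\<^esub> ?B) - {\<zero>}"
    proof
      fix x assume x: "x \<in> A \<union> B"
      then have xc: "x \<in> carrier L" using cA cB by auto
      then have "x = x \<oplus> \<zero>" "x = \<zero> \<oplus> x" by auto
      then have "x \<in> ?A <+>\<^bsub>L\<^esub> ?B" using x unfolding sum by blast
      then show "x \<in> (?A <+>\<^bsub>L\<^esub> ?B) - {\<zero>}" using x zAB by auto
    qed
    ultimately show "\<Inter>{W. field_flat W \<and> A \<union> B \<subseteq> W} \<subseteq> (?A <+>\<^bsub>L\<^esub> ?B) - {\<zero>}" by (intro Inter_lower) simp
    have "(?A <+>\<^bsub>L\<^esub> ?B) - {\<zero>} \<subseteq> W" if W: "field_flat W" "A \<union> B \<subseteq> W" for W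
    proof
      fix x assume x: "x \<in> (?A <+>\<^bsub>L\<^esub> ?B) - {\<zero>}"
      then obtain a b where ab: "a \<in> ?A" "b \<in> ?B" "x = a \<oplus> b" unfolding sum by blast
      have "a \<in> insert \<zero> W" "b \<in> insert \<zero> W" using ab W(2) by auto
      then have "x \<in> insert \<zero> W" using subalgebra_add ab(3) W(1) unfolding field_flat_def by blast
      then show "x \<in> W" using x by simp
    qed
    then show "(?A <+>\<^bsub>L\<^esub> ?B) - {\<zero>} \<subseteq> \<Inter>{W. field_flat W \<and> A \<union> B \<subseteq> W}" by (intro Inter_greatest) simp
  qed
  then show ?case using field_rk_minus[OF dS] le by simp
qed

end

section \<open>Lower bounds for the flag types of groups and fields\<close>

lemma chain_mono:
  fixes F :: "nat \<Rightarrow> 'a set"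
  assumes "\<And>i. Suc i < n \<Longrightarrow> F i \<subseteq> F (Suc i)" "i \<le> j" "j < n"
  shows "F i \<subseteq> F j"
  using assms(2,3)
proof (induction j)
  case (Suc j)
  then show ?case using assms(1)[of j] by (cases "i = Suc j") auto
qed simp

lemma flag_type_obtain:
  assumes "i < n" "j < n" "sp (F i) (F j) \<subseteq> F (n - 1)"
  obtains k where "flag_type n sp F (i, j) = k" "k < n" "sp (F i) (F j) \<subseteq> F k"
proof -
  let ?k = "LEAST k. k < n \<and> sp (F i) (F j) \<subseteq> F k"
  have "?k < n \<and> sp (F i) (F j) \<subseteq> F ?k"
    by (rule LeastI[of _ "n - 1"]) (use assms in auto)
  then show thesis using that[of ?k] assms(1,2) by (simp add: flag_type_def)
qed

text \<open>The towers treated above. Prime degree and degree below 8 reduce to them, as does degree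
  8 apart from (8); equal primes fall under the first alternative, which with \<open>t = 0\<close>
  also covers the empty tower.\<close>

definition admissible :: "nat list \<Rightarrow> bool" where
  "admissible ns \<longleftrightarrow> (\<exists>p t. Factorial_Ring.prime p \<and> ns = replicate t p) \<or>
     (\<exists>q p. (q = 2 \<or> q = 3) \<and> Factorial_Ring.prime p \<and> p \<noteq> q \<and> ns = [q, p]) \<or>
     ns = [4] \<or> ns = [4, 2] \<or> ns = [2, 4] \<or> ns = [6]"

lemma (in translation_matroid) flag_bounded_admissible:
  assumes "flag_along ns F" "admissible ns" "i < prod_list ns" "j < prod_list ns"
  shows "tower_bounded ns i j (rk (prd (F i) (F j)))"
proof -
  note two = flag_bounded_two_primes[OF assms(1) _ _ _ _ assms(3,4)]
    and pow2 = flag_bounded_power2[OF assms(1) _ assms(3,4)]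
  consider p t where "Factorial_Ring.prime p" "ns = replicate t p"
    | q p where "q = 2 \<or> q = 3" "Factorial_Ring.prime p" "p \<noteq> q" "ns = [q, p]"
    | "ns = [4] \<or> ns = [4, 2]" | "ns = [2, 4]" | "ns = [6]"
    using assms(2) unfolding admissible_def by blast
  then show ?thesis
  proof cases
    case 1
    then show ?thesis by (rule flag_bounded_replicate[OF assms(1) _ _ assms(3,4)])
  next
    case 2
    then show ?thesis by (rule two)
  next
    case 3
    then show ?thesis by (rule pow2)
  next
    case 4
    then show ?thesis by (rule flag_bounded_24[OF assms(1) _ assms(3,4)])
  next
    case 5
    then show ?thesis by (rule flag_bounded_6[OF assms(1) _ assms(3,4)])
  qed
qed

lemma tower_bounded_mono: "tower_bounded ns i j v \<Longrightarrow> v \<le> w \<Longrightarrow> tower_bounded ns i j w"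
  unfolding tower_bounded_def using kneser_bound_mono by blast

lemma group_flag_subset:
  assumes "group_flag G F" "i < order G"
  shows "F i \<subseteq> carrier G"
proof -
  have "F i \<subseteq> F (order G - 1)"
  proof (rule chain_mono[of "order G"])
    show "F k \<subseteq> F (Suc k)" if "Suc k < order G" for k
      using assms(1) that unfolding group_flag_def by blast
  qed (use assms(2) in simp_all)
  then show ?thesis using assms(1) by (simp add: group_flag_def)
qed

lemma group_flag_along:
  assumes F: "group_flag G F" and ns: "group_flag_has_tower_type G F ns"
  shows "translation_matroid.flag_along G (\<lambda>A. A \<subseteq> carrier G) card ns F" "order G = prod_list ns"
proof -
  have G: "comm_group G" "finite (carrier G)" and F0: "F 0 = {\<one>\<^bsub>G\<^esub>}" and Fn: "F (order G - 1) = carrier G"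
    and Fs: "\<And>i. Suc i < order G \<Longrightarrow> F i \<subset> F (Suc i)" and Fc: "\<And>i. i < order G \<Longrightarrow> card (F i) = i + 1"
    using F by (auto simp: group_flag_def)
  interpret translation_matroid G "\<lambda>A. A \<subseteq> carrier G" card
    by (rule group_translation_matroid[OF G])
  obtain Gs where Gs: "length Gs = length ns + 1" "sorted_wrt (\<subset>) Gs"
    "set Gs = (\<lambda>i. generate G (F i)) ` {..<order G}"
    "\<And>s. s < length ns \<Longrightarrow> card (Gs ! Suc s) = ns ! s * card (Gs ! s)"
    using ns unfolding group_flag_has_tower_type_def by blast
  note sub = group_flag_subset[OF F]
  have *: "order G = card (carrier G)" "\<And>i. i < order G \<Longrightarrow> F i \<subseteq> carrier G"
    "\<And>i. i < order G \<Longrightarrow> card (F i) = i + 1" "\<And>i. Suc i < order G \<Longrightarrow> F i \<subseteq> F (Suc i)"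
    "\<one>\<^bsub>G\<^esub> \<in> F 0" "F (order G - 1) = carrier G"
    using sub Fs Fc F0 Fn by (auto simp: order_def)
  have g: "\<And>i. i < order G \<Longrightarrow> F i \<subseteq> generate G (F i)"
    "\<And>i. i < order G \<Longrightarrow> flat_subgroup (generate G (F i))"
    "\<And>i H. i < order G \<Longrightarrow> flat_subgroup H \<Longrightarrow> F i \<subseteq> H \<Longrightarrow> generate G (F i) \<subseteq> H"
    "card (generate G (F 0)) = 1"
  proof -
    show "F i \<subseteq> generate G (F i)" for i by (auto intro: generate.incl)
    show "flat_subgroup (generate G (F i))" if "i < order G" for i
      using generate_is_subgroup[OF sub[OF that]] generate_incl[OF sub[OF that]] by (simp add: flat_subgroup_def)
    show "generate G (F i) \<subseteq> H" if "flat_subgroup H" "F i \<subseteq> H" for i H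
      using generate_subgroup_incl[OF that(2)] that(1) by (simp add: flat_subgroup_def)
    show "card (generate G (F 0)) = 1" using generate_one F0 by simp
  qed
  show "flag_along ns F" by (rule flag_alongI(1)[OF * g Gs])
  show "order G = prod_list ns" by (rule flag_alongI(2)[OF * g Gs])
qed

lemma group_flag_type_bounded:
  assumes F: "group_flag G F" and ns: "group_flag_has_tower_type G F ns" "admissible ns"
    and ij: "i < order G" "j < order G"
  shows "tower_bounded ns i j (group_flag_type G F (i, j) + 1)"
proof -
  have G: "comm_group G" "finite (carrier G)" and Fn: "F (order G - 1) = carrier G"
    and Fc: "\<And>i. i < order G \<Longrightarrow> card (F i) = i + 1"
    using F by (auto simp: group_flag_def)
  interpret translation_matroid G "\<lambda>A. A \<subseteq> carrier G" card
    by (rule group_translation_matroid[OF G])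
  note sub = group_flag_subset[OF F]
  have "F i <#>\<^bsub>G\<^esub> F j \<subseteq> F (order G - 1)" using set_mult_carrier[OF sub[OF ij(1)] sub[OF ij(2)]] Fn by simp
  then obtain k where k: "group_flag_type G F (i, j) = k" "k < order G" "F i <#>\<^bsub>G\<^esub> F j \<subseteq> F k"
    unfolding group_flag_type_def by (rule flag_type_obtain[OF ij])
  have "prd (F i) (F j) \<subseteq> F k" by (rule prd_least[OF sub[OF k(2)] k(3)])
  then have "card (prd (F i) (F j)) \<le> k + 1"
    using card_mono[OF finite_subset[OF sub[OF k(2)] G(2)], of "prd (F i) (F j)"] Fc[OF k(2)] by simp
  moreover have "tower_bounded ns i j (card (prd (F i) (F j)))"
    by (rule flag_bounded_admissible[OF group_flag_along(1)[OF F ns(1)] ns(2)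
          ij[unfolded group_flag_along(2)[OF F ns(1)]]])
  ultimately show ?thesis unfolding k(1) using tower_bounded_mono by blast
qed

lemma field_flag_along:
  assumes F: "field_flag L K n F" and ns: "field_flag_has_tower_type L K n F ns"
  shows "finite_field_extension L K n"
    "translation_matroid.flag_along (Multiplicative_Group.mult_of L) (finite_field_extension.field_flat L K)
       (finite_field_extension.field_rk L K) ns (\<lambda>i. F i - {\<zero>\<^bsub>L\<^esub>})" "n = prod_list ns"
proof -
  have L: "field L" "subfield K L" "ring.dimension L n K (carrier L)"
    and F0: "F 0 = K" and Fn: "F (n - 1) = carrier L"
    and Fs: "\<And>i. Suc i < n \<Longrightarrow> F i \<subset> F (Suc i)" and Fd: "\<And>i. i < n \<Longrightarrow> ring.dimension L (i + 1) K (F i)"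
    using F by (auto simp: field_flag_def field_extension_def)
  show ext: "finite_field_extension L K n"
    using L by (simp add: finite_field_extension_def finite_field_extension_axioms_def)
  then interpret finite_field_extension L K n .
  interpret M: translation_matroid "Multiplicative_Group.mult_of L" field_flat field_rk
    by (rule field_translation_matroid)
  obtain Ls where Ls: "length Ls = length ns + 1" "sorted_wrt (\<subset>) Ls"
    "set Ls = (\<lambda>i. generate_field L (K \<union> F i)) ` {..<n}"
    "\<And>s. s < length ns \<Longrightarrow> dimension (ns ! s) (Ls ! s) (Ls ! Suc s)"
    using ns unfolding field_flag_has_tower_type_def by blast
  let ?g = "\<lambda>i. generate_field L (K \<union> F i)"
  have Fsub: "subalgebra K (F i) L" if "i < n" for i using dimension_subalgebra[OF Fd[OF that]] .
  have Fcar: "K \<union> F i \<subseteq> carrier L" if "i < n" for i using subalgebra_in_carrier[OF Fsub[OF that]] K_carrier by simp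
  have gfield: "subfield (?g i) L" if "i < n" for i using generate_field_is_subfield[OF Fcar[OF that]] .
  have gK: "K \<subseteq> ?g i" "F i \<subseteq> ?g i" for i by (auto intro: generate_field.incl)
  have gsub: "subalgebra K (?g i) L" if "i < n" for i
  proof (intro subalgebra.intro subalgebra_axioms.intro)
    show "subgroup (?g i) (add_monoid L)"
      using generate_field_is_add_subgroup[OF Fcar[OF that]] .
    show "k \<otimes>\<^bsub>L\<^esub> v \<in> ?g i" if "k \<in> K" "v \<in> ?g i" for k v
      using that gK(1) by (intro generate_field.eng_mult) auto
  qed
  have gz: "\<zero>\<^bsub>L\<^esub> \<in> ?g i" if "i < n" for i using subalgebra_zero[OF gsub[OF that]] .
  have *: "n = field_rk (carrier (Multiplicative_Group.mult_of L))"
    "\<And>i. i < n \<Longrightarrow> field_flat (F i - {\<zero>\<^bsub>L\<^esub>})"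
    "\<And>i. i < n \<Longrightarrow> field_rk (F i - {\<zero>\<^bsub>L\<^esub>}) = i + 1"
    "\<And>i. Suc i < n \<Longrightarrow> F i - {\<zero>\<^bsub>L\<^esub>} \<subseteq> F (Suc i) - {\<zero>\<^bsub>L\<^esub>}"
    "\<one>\<^bsub>Multiplicative_Group.mult_of L\<^esub> \<in> F 0 - {\<zero>\<^bsub>L\<^esub>}"
    "F (n - 1) - {\<zero>\<^bsub>L\<^esub>} = carrier (Multiplicative_Group.mult_of L)"
    using field_rk_minus[OF dim_L] field_flat_minus[OF Fsub] field_rk_minus[OF Fd] Fs F0 one_K Fn by auto
  have sg: "subgroup (?g i - {\<zero>\<^bsub>L\<^esub>}) (Multiplicative_Group.mult_of L)" if "i < n" for i
  proof (rule M.subgroupI)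
    note s = subfieldE[OF gfield[OF that]] and r = subringE[OF subfieldE(1)[OF gfield[OF that]]]
    show "?g i - {\<zero>\<^bsub>L\<^esub>} \<subseteq> carrier (Multiplicative_Group.mult_of L)" using s(3) by auto
    show "?g i - {\<zero>\<^bsub>L\<^esub>} \<noteq> {}" using r(3) by auto
    show "inv\<^bsub>Multiplicative_Group.mult_of L\<^esub> a \<in> ?g i - {\<zero>\<^bsub>L\<^esub>}" if a: "a \<in> ?g i - {\<zero>\<^bsub>L\<^esub>}" for a
    proof -
      have "a \<in> carrier (Multiplicative_Group.mult_of L)" using a s(3) by auto
      then show ?thesis using m_inv_mult_of subfield_m_inv(1)[OF gfield[OF \<open>i < n\<close>] a] by simp
    qed
    show "a \<otimes>\<^bsub>Multiplicative_Group.mult_of L\<^esub> b \<in> ?g i - {\<zero>\<^bsub>L\<^esub>}"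
      if ab: "a \<in> ?g i - {\<zero>\<^bsub>L\<^esub>}" "b \<in> ?g i - {\<zero>\<^bsub>L\<^esub>}" for a b
      using ab r(6) s(5) by auto
  qed
  have g: "\<And>i. i < n \<Longrightarrow> F i - {\<zero>\<^bsub>L\<^esub>} \<subseteq> ?g i - {\<zero>\<^bsub>L\<^esub>}"
    "\<And>i. i < n \<Longrightarrow> M.flat_subgroup (?g i - {\<zero>\<^bsub>L\<^esub>})"
    "\<And>i H. i < n \<Longrightarrow> M.flat_subgroup H \<Longrightarrow> F i - {\<zero>\<^bsub>L\<^esub>} \<subseteq> H \<Longrightarrow> ?g i - {\<zero>\<^bsub>L\<^esub>} \<subseteq> H"
    "field_rk (?g 0 - {\<zero>\<^bsub>L\<^esub>}) = 1"
  proof -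
    show "F i - {\<zero>\<^bsub>L\<^esub>} \<subseteq> ?g i - {\<zero>\<^bsub>L\<^esub>}" for i using gK(2) by blast
    show "M.flat_subgroup (?g i - {\<zero>\<^bsub>L\<^esub>})" if "i < n" for i
      using field_flat_minus[OF gsub[OF that]] sg[OF that] by (simp add: M.flat_subgroup_def)
    show "?g i - {\<zero>\<^bsub>L\<^esub>} \<subseteq> H" if i: "i < n" and H: "M.flat_subgroup H" "F i - {\<zero>\<^bsub>L\<^esub>} \<subseteq> H" for i H
    proof -
      note HD = M.flat_subgroupD[OF H(1)]
      have sH: "subalgebra K (insert \<zero>\<^bsub>L\<^esub> H) L" using HD(1) by (simp add: field_flat_def)
      have Hc: "insert \<zero>\<^bsub>L\<^esub> H \<subseteq> carrier L" using subalgebra_in_carrier[OF sH] .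
      \<comment> \<open>With zero added, a flat subgroup is a subfield: sums come from the flat,
        products and inverses from the subgroup. It contains \<open>K\<close> because
        \<open>K = F 0\<close>.\<close>
      have "subfield (insert \<zero>\<^bsub>L\<^esub> H) L"
      proof (rule subfieldI', rule subringI)
        show "insert \<zero>\<^bsub>L\<^esub> H \<subseteq> carrier L" by (rule Hc)
        show "\<one>\<^bsub>L\<^esub> \<in> insert \<zero>\<^bsub>L\<^esub> H" using HD(4) by simp
        show "\<ominus>\<^bsub>L\<^esub> h \<in> insert \<zero>\<^bsub>L\<^esub> H" if "h \<in> insert \<zero>\<^bsub>L\<^esub> H" for h
          using subgroup.m_inv_closed[OF subalgebra.axioms(1)[OF sH] that] by (simp add: a_inv_def)
        show "h1 \<otimes>\<^bsub>L\<^esub> h2 \<in> insert \<zero>\<^bsub>L\<^esub> H" if "h1 \<in> insert \<zero>\<^bsub>L\<^esub> H" "h2 \<in> insert \<zero>\<^bsub>L\<^esub> H" for h1 h2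
          using that HD(7)[of h1 h2] Hc by (auto simp: subset_iff)
        show "h1 \<oplus>\<^bsub>L\<^esub> h2 \<in> insert \<zero>\<^bsub>L\<^esub> H" if "h1 \<in> insert \<zero>\<^bsub>L\<^esub> H" "h2 \<in> insert \<zero>\<^bsub>L\<^esub> H" for h1 h2
          by (rule subalgebra_add[OF sH that])
        show "inv\<^bsub>L\<^esub> h \<in> insert \<zero>\<^bsub>L\<^esub> H" if h: "h \<in> insert \<zero>\<^bsub>L\<^esub> H - {\<zero>\<^bsub>L\<^esub>}" for h
        proof -
          have "h \<in> H" "h \<in> carrier (Multiplicative_Group.mult_of L)" using h Hc by auto
          then show ?thesis using HD(8)[of h] m_inv_mult_of[of h] by simp
        qed
      qed
      moreover have "K - {\<zero>\<^bsub>L\<^esub>} \<subseteq> F i - {\<zero>\<^bsub>L\<^esub>}"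
        using chain_mono[of n F 0 i] Fs i F0 by auto
      then have "K \<union> F i \<subseteq> insert \<zero>\<^bsub>L\<^esub> H" using H(2) by auto
      ultimately have "?g i \<subseteq> insert \<zero>\<^bsub>L\<^esub> H"
        using generate_field_min_subfield1[OF Fcar[OF i]] by blast
      then show ?thesis by auto
    qed
    have "generate_field L (K \<union> F 0) \<subseteq> K"
      using F0 generate_field_min_subfield1[OF _ K, of "K \<union> F 0"] K_carrier by simp
    then have "?g 0 = K" using gK(1)[of 0] by auto
    then show "field_rk (?g 0 - {\<zero>\<^bsub>L\<^esub>}) = 1" using field_rk_minus[OF dimension_one[OF K]] by simp
  qed
  let ?Cs = "map (\<lambda>V. V - {\<zero>\<^bsub>L\<^esub>}) Ls"
  have Lz: "\<exists>i<n. V = ?g i" if "V \<in> set Ls" for V using that unfolding Ls(3) by auto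
  have Cs: "length ?Cs = length ns + 1" "sorted_wrt (\<subset>) ?Cs" "set ?Cs = (\<lambda>i. ?g i - {\<zero>\<^bsub>L\<^esub>}) ` {..<n}"
    "\<And>s. s < length ns \<Longrightarrow> field_rk (?Cs ! Suc s) = ns ! s * field_rk (?Cs ! s)"
  proof -
    show "length ?Cs = length ns + 1" using Ls(1) by simp
    show "set ?Cs = (\<lambda>i. ?g i - {\<zero>\<^bsub>L\<^esub>}) ` {..<n}" by (simp add: Ls(3) image_image)
    have "V - {\<zero>\<^bsub>L\<^esub>} \<subset> W - {\<zero>\<^bsub>L\<^esub>}" if "V \<in> set Ls" "W \<in> set Ls" "V \<subset> W" for V W
      using Lz[OF that(1)] Lz[OF that(2)] gz that(3) by blast
    then have "sorted_wrt (\<lambda>V W. V - {\<zero>\<^bsub>L\<^esub>} \<subset> W - {\<zero>\<^bsub>L\<^esub>}) Ls"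
      using Ls(2) by (rule sorted_wrt_mono_rel)
    then show "sorted_wrt (\<subset>) ?Cs" by (simp add: sorted_wrt_map)
    show "field_rk (?Cs ! Suc s) = ns ! s * field_rk (?Cs ! s)" if s: "s < length ns" for s
    proof -
      have "Ls ! s \<in> set Ls" using s Ls(1) by simp
      then obtain i where i: "i < n" "Ls ! s = ?g i" using Lz by blast
      have d: "dimension (dim K (?g i)) K (?g i)" by (rule subalgebra_dimension[OF gsub[OF i(1)]])
      \<comment> \<open>The tower type gives relative degrees; the tower law converts them into
        dimensions over \<open>K\<close>.\<close>
      have "dimension (dim K (?g i) * ns ! s) K (Ls ! Suc s)"
        by (rule telescopic_base[OF K gfield[OF i(1)] d]) (use Ls(4)[OF s] i in simp)
      then show ?thesis using field_rk_minus[OF d] field_rk_minus i s Ls(1) by (simp add: mult.commute)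
    qed
  qed
  show "M.flag_along ns (\<lambda>i. F i - {\<zero>\<^bsub>L\<^esub>})" by (rule M.flag_alongI(1)[OF * g Cs])
  show "n = prod_list ns" by (rule M.flag_alongI(2)[OF * g Cs])
qed

lemma field_flag_type_bounded:
  assumes F: "field_flag L K n F" and ns: "field_flag_has_tower_type L K n F ns" "admissible ns"
    and ij: "i < n" "j < n"
  shows "tower_bounded ns i j (field_flag_type L K n F (i, j) + 1)"
proof -
  have Fn: "F (n - 1) = carrier L" and Fd: "\<And>i. i < n \<Longrightarrow> ring.dimension L (i + 1) K (F i)"
    using F by (auto simp: field_flag_def)
  note along = field_flag_along[OF F ns(1)]
  interpret finite_field_extension L K n by (rule along(1))
  interpret M: translation_matroid "Multiplicative_Group.mult_of L" field_flat field_rk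
    by (rule field_translation_matroid)
  have Fsub: "subalgebra K (F i) L" if "i < n" for i using dimension_subalgebra[OF Fd[OF that]] .
  have Fcar: "F i \<subseteq> carrier L" if "i < n" for i using subalgebra_in_carrier[OF Fsub[OF that]] .
  let ?P = "F i <#>\<^bsub>L\<^esub> F j"
  have Pc: "?P \<subseteq> carrier L" using Fcar[OF ij(1)] Fcar[OF ij(2)] unfolding set_mult_def by blast
  have "set_span L K ?P \<subseteq> carrier L"
    unfolding set_span_def using Span_in_carrier[OF K_carrier] Pc by blast
  then have "set_span L K ?P \<subseteq> F (n - 1)" using Fn by simp
  then obtain k where k: "field_flag_type L K n F (i, j) = k" "k < n" "set_span L K ?P \<subseteq> F k"
    unfolding field_flag_type_def
    by (rule flag_type_obtain[OF ij, where sp = "\<lambda>A B. set_span L K (A <#>\<^bsub>L\<^esub> B)" and F = F])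
  \<comment> \<open>Each product lies in the span of itself, so a bound on the span of all products
    also bounds the closed product in the unit group.\<close>
  have "x \<in> F k" if "x \<in> ?P" for x
  proof -
    have "x \<in> Span K [x]" using Span_base_incl[OF K, of "[x]"] that Pc by auto
    moreover have "Span K [x] \<subseteq> set_span L K ?P" using that unfolding set_span_def by (intro UN_upper) simp
    ultimately show ?thesis using k(3) by blast
  qed
  moreover have "a \<otimes>\<^bsub>L\<^esub> b \<in> ?P" "a \<otimes>\<^bsub>L\<^esub> b \<noteq> \<zero>\<^bsub>L\<^esub>"
    if "a \<in> F i - {\<zero>\<^bsub>L\<^esub>}" "b \<in> F j - {\<zero>\<^bsub>L\<^esub>}" for a b
  proof -
    show "a \<otimes>\<^bsub>L\<^esub> b \<in> ?P" using that unfolding set_mult_def by blast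
    show "a \<otimes>\<^bsub>L\<^esub> b \<noteq> \<zero>\<^bsub>L\<^esub>" using integral[of a b] that Fcar[OF ij(1)] Fcar[OF ij(2)] by blast
  qed
  ultimately have "(F i - {\<zero>\<^bsub>L\<^esub>}) <#>\<^bsub>Multiplicative_Group.mult_of L\<^esub> (F j - {\<zero>\<^bsub>L\<^esub>}) \<subseteq> F k - {\<zero>\<^bsub>L\<^esub>}"
    unfolding M.set_mult_subset_iff by simp
  then have sub: "M.prd (F i - {\<zero>\<^bsub>L\<^esub>}) (F j - {\<zero>\<^bsub>L\<^esub>}) \<subseteq> F k - {\<zero>\<^bsub>L\<^esub>}"
    by (rule M.prd_least[OF field_flat_minus[OF Fsub[OF k(2)]]])
  have c: "F i - {\<zero>\<^bsub>L\<^esub>} \<subseteq> carrier (Multiplicative_Group.mult_of L)" if "i < n" for i using Fcar[OF that] by auto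
  have "field_rk (M.prd (F i - {\<zero>\<^bsub>L\<^esub>}) (F j - {\<zero>\<^bsub>L\<^esub>})) \<le> field_rk (F k - {\<zero>\<^bsub>L\<^esub>})"
    by (rule M.rk_mono[OF M.flat_prd[OF c[OF ij(1)] c[OF ij(2)]] field_flat_minus[OF Fsub[OF k(2)]] sub])
  also have "\<dots> = k + 1" by (rule field_rk_minus[OF Fd[OF k(2)]])
  finally have "field_rk (M.prd (F i - {\<zero>\<^bsub>L\<^esub>}) (F j - {\<zero>\<^bsub>L\<^esub>})) \<le> k + 1" .
  moreover have "tower_bounded ns i j (field_rk (M.prd (F i - {\<zero>\<^bsub>L\<^esub>}) (F j - {\<zero>\<^bsub>L\<^esub>})))"
    by (rule M.flag_bounded_admissible[OF along(2) ns(2) ij[unfolded along(3)]])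
  ultimately show ?thesis unfolding k(1) using tower_bounded_mono by blast
qed

section \<open>The flag of the tower group\<close>

text \<open>Telescoping: a digit times its weight is the difference of two consecutive remainders of
  \<open>i\<close>.\<close>

lemma mixed_radix_sum:
  assumes "s \<le> k" "k \<le> length ns"
  shows "(\<Sum>r = s..<k. mixed_radix_digit ns i r * prod_list (take r ns)) + i mod prod_list (take s ns)
    = i mod prod_list (take k ns)"
  using assms
proof (induction k)
  case (Suc k)
  show ?case
  proof (cases "s = Suc k")
    case False
    then have "s \<le> k" using Suc.prems by simp
    moreover have "i mod prod_list (take (Suc k) ns)
        = mixed_radix_digit ns i k * prod_list (take k ns) + i mod prod_list (take k ns)"
    proof -
      have "prod_list (take (Suc k) ns) = prod_list (take k ns) * ns ! k"
        using Suc.prems by (intro prod_list_take_Suc) simp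
      then show ?thesis unfolding mixed_radix_digit_def by (simp add: mod_mult2_eq)
    qed
    ultimately show ?thesis using Suc by simp
  qed simp
qed simp

context
  fixes ns :: "nat list"
  assumes ns: "\<forall>m\<in>set ns. 1 < m"
begin

abbreviation (input) "T \<equiv> tower_group ns"
abbreviation (input) "N \<equiv> prod_list ns"
abbreviation (input) "P s \<equiv> prod_list (take s ns)"
abbreviation (input) "digit \<equiv> mixed_radix_digit ns"

lemma ns_gt: "s < length ns \<Longrightarrow> 1 < ns ! s"
  using ns by simp

lemma ns_pos: "s < length ns \<Longrightarrow> 0 < ns ! s"
  using ns_gt by fastforce

lemma P_pos: "0 < P s"
proof -
  have "0 \<notin> set (take s ns)" using ns in_set_takeD by fastforce
  then show ?thesis by (metis gr0I prod_list_zero_iff)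
qed

lemma P_dvd: "s \<le> k \<Longrightarrow> P s dvd P k"
proof -
  assume "s \<le> k"
  then have "take k ns = take s ns @ take (k - s) (drop s ns)" by (metis le_add_diff_inverse take_add)
  then show ?thesis by simp
qed

lemma P_mono: "s \<le> k \<Longrightarrow> P s \<le> P k"
  using P_dvd P_pos dvd_imp_le by blast

lemma P_strict: "s < k \<Longrightarrow> k \<le> length ns \<Longrightarrow> P s < P k"
proof -
  assume *: "s < k" "k \<le> length ns"
  have "P s * 1 < P s * ns ! s" using P_pos[of s] ns_gt[of s] * by (intro mult_strict_left_mono) auto
  also have "\<dots> = P (Suc s)" using * by (simp add: prod_list_take_Suc)
  also have "\<dots> \<le> P k" using * by (intro P_mono) simp
  finally show ?thesis by simp
qed

lemma P_le_N: "P s \<le> N"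
  using P_mono[of s "max s (length ns)"] by simp

lemma comm_group_tower: "comm_group T"
proof (rule group.group_comm_groupI)
  show "group T" unfolding tower_group_def by simp
  show "x \<otimes>\<^bsub>T\<^esub> y = y \<otimes>\<^bsub>T\<^esub> x" for x y
    by (simp add: tower_group_def add.commute)
qed

interpretation T: comm_group T by (rule comm_group_tower)

lemma carrier_tower: "carrier T = (\<Pi>\<^sub>E s\<in>{..<length ns}. {0..<int (ns ! s)})"
proof -
  have "carrier (integer_mod_group (ns ! s)) = {0..<int (ns ! s)}" if "s < length ns" for s
    using ns_gt[OF that] by (simp add: carrier_integer_mod_group)
  then show ?thesis unfolding tower_group_def carrier_product_group by (intro PiE_cong) auto
qed

lemma finite_tower: "finite (carrier T)"
  unfolding carrier_tower by (intro finite_PiE) auto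

lemma order_tower: "order T = N"
proof -
  have "order T = (\<Prod>s<length ns. ns ! s)" unfolding order_def carrier_tower by (simp add: card_PiE)
  then show ?thesis by (simp add: prod.list_conv_set_nth atLeast0LessThan)
qed

lemma mult_tower: "x \<otimes>\<^bsub>T\<^esub> y = (\<lambda>s\<in>{..<length ns}. (x s + y s) mod int (ns ! s))"
  by (simp add: tower_group_def)

lemma one_tower: "\<one>\<^bsub>T\<^esub> = (\<lambda>s\<in>{..<length ns}. 0)"
  by (simp add: tower_group_def)

lemma gen_carrier: "tower_gen ns s \<in> carrier T"
  using ns_gt ns_pos by (auto simp: carrier_tower tower_gen_def)

lemma gen_pow: "tower_gen ns s [^]\<^bsub>T\<^esub> (d::nat) = (\<lambda>r\<in>{..<length ns}. if r = s then int d mod int (ns ! s) else 0)"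
proof (induction d)
  case (Suc d)
  have "tower_gen ns s [^]\<^bsub>T\<^esub> Suc d = (\<lambda>r\<in>{..<length ns}. if r = s then int d mod int (ns ! s) else 0) \<otimes>\<^bsub>T\<^esub> tower_gen ns s"
    using Suc.IH by (simp only: T.nat_pow_Suc)
  also have "\<dots> = (\<lambda>r\<in>{..<length ns}. if r = s then int (Suc d) mod int (ns ! s) else 0)"
    unfolding mult_tower tower_gen_def by (intro restrict_ext) (auto simp: mod_simps add.commute)
  finally show ?case .
qed (auto simp: one_tower fun_eq_iff)

text \<open>The partial product of the powers of the first \<open>k\<close> generators, as an
  explicit function; it allows induction on \<open>k\<close>.\<close>

definition digits_below :: "nat \<Rightarrow> nat \<Rightarrow> nat \<Rightarrow> int" where
  "digits_below i k = (\<lambda>r\<in>{..<length ns}. if r < k then int (digit i r) else 0)"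

lemma digit_less: "s < length ns \<Longrightarrow> digit i s < ns ! s"
  using ns_gt[of s] by (simp add: mixed_radix_digit_def)

lemma digits_below_Suc:
  assumes "k < length ns"
  shows "digits_below i (Suc k) = tower_gen ns k [^]\<^bsub>T\<^esub> digit i k \<otimes>\<^bsub>T\<^esub> digits_below i k"
  unfolding gen_pow mult_tower digits_below_def
  by (intro restrict_ext) (use digit_less in \<open>auto simp: less_Suc_eq zmod_int[symmetric]\<close>)

lemma digits_below_carrier: "digits_below i k \<in> carrier T"
  using digit_less ns_pos by (auto simp: digits_below_def carrier_tower)

lemma tower_elem_eq: "tower_elem ns i = digits_below i (length ns)"
proof -
  have "finprod T (\<lambda>s. tower_gen ns s [^]\<^bsub>T\<^esub> digit i s) {..<k} = digits_below i k" if "k \<le> length ns" for k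
    using that
  proof (induction k)
    case 0
    then show ?case by (auto simp: digits_below_def one_tower fun_eq_iff)
  next
    case (Suc k)
    have "finprod T (\<lambda>s. tower_gen ns s [^]\<^bsub>T\<^esub> digit i s) (insert k {..<k})
        = tower_gen ns k [^]\<^bsub>T\<^esub> digit i k \<otimes>\<^bsub>T\<^esub> finprod T (\<lambda>s. tower_gen ns s [^]\<^bsub>T\<^esub> digit i s) {..<k}"
      by (intro T.finprod_insert) (auto intro: gen_carrier)
    then show ?case using Suc digits_below_Suc[of k i] by (simp add: lessThan_Suc)
  qed
  then show ?thesis by (simp add: tower_elem_def)
qed

lemma tower_elem_apply: "s < length ns \<Longrightarrow> tower_elem ns i s = int (digit i s)"
  by (simp add: tower_elem_eq digits_below_def)

lemma tower_elem_carrier: "tower_elem ns i \<in> carrier T"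
  by (simp add: tower_elem_eq digits_below_carrier)

lemma high_digits:
  assumes "s \<le> length ns" "i < N"
  shows "(\<Sum>r = s..<length ns. digit i r * P r) = i div P s * P s"
proof -
  have "(\<Sum>r = s..<length ns. digit i r * P r) + i mod P s = i"
    using mixed_radix_sum[of s "length ns" ns i] assms by simp
  then show ?thesis using div_mult_mod_eq[of i "P s"] by linarith
qed

lemma inj_tower_elem: "inj_on (tower_elem ns) {..<N}"
proof (rule inj_onI)
  fix i j assume ij: "i \<in> {..<N}" "j \<in> {..<N}" "tower_elem ns i = tower_elem ns j"
  then have "digit i r = digit j r" if "r < length ns" for r
    using tower_elem_apply[OF that] by (metis of_nat_eq_iff)
  then have "(\<Sum>r = 0..<length ns. digit i r * P r) = (\<Sum>r = 0..<length ns. digit j r * P r)"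
    by (intro sum.cong) auto
  then show "i = j" using high_digits[of 0 i] high_digits[of 0 j] ij by simp
qed

lemma tower_elem_image: "tower_elem ns ` {..<N} = carrier T"
proof (rule card_subset_eq[OF finite_tower])
  show "tower_elem ns ` {..<N} \<subseteq> carrier T" using tower_elem_carrier by blast
  show "card (tower_elem ns ` {..<N}) = card (carrier T)"
    using card_image[OF inj_tower_elem] order_tower by (simp add: order_def)
qed

text \<open>Multiplication in the product group has no carries, so each digit of the product is at
  most the sum of the two digits. Summing the positions from \<open>s\<close> on gives the
  inequality of quotients, for all \<open>s\<close> at once.\<close>

lemma tower_elem_mult:
  assumes ij: "i < N" "j < N"
  obtains m where "m < N" "tower_elem ns i \<otimes>\<^bsub>T\<^esub> tower_elem ns j = tower_elem ns m"
    "\<forall>s\<le>length ns. m div P s \<le> i div P s + j div P s"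
proof -
  have "tower_elem ns i \<otimes>\<^bsub>T\<^esub> tower_elem ns j \<in> tower_elem ns ` {..<N}"
    unfolding tower_elem_image by (intro T.m_closed tower_elem_carrier)
  then obtain m where m: "m < N" "tower_elem ns i \<otimes>\<^bsub>T\<^esub> tower_elem ns j = tower_elem ns m" by auto
  have dig: "digit m r \<le> digit i r + digit j r" if r: "r < length ns" for r
  proof -
    have "int (digit m r) = (int (digit i r) + int (digit j r)) mod int (ns ! r)"
      using fun_cong[OF m(2), of r] tower_elem_apply[OF r] r by (simp add: mult_tower)
    then have "int (digit m r) = int ((digit i r + digit j r) mod ns ! r)" by (simp only: zmod_int of_nat_add)
    then have "digit m r = (digit i r + digit j r) mod ns ! r" by (simp only: of_nat_eq_iff)
    then show ?thesis using mod_less_eq_dividend[of "digit i r + digit j r" "ns ! r"] by simp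
  qed
  have "m div P s \<le> i div P s + j div P s" if s: "s \<le> length ns" for s
  proof -
    have "m div P s * P s = (\<Sum>r = s..<length ns. digit m r * P r)" using high_digits[OF s m(1)] by simp
    also have "\<dots> \<le> (\<Sum>r = s..<length ns. (digit i r + digit j r) * P r)"
      using dig by (intro sum_mono mult_le_mono1) auto
    also have "\<dots> = (i div P s + j div P s) * P s"
      using high_digits[OF s ij(1)] high_digits[OF s ij(2)] by (simp add: sum.distrib add_mult_distrib)
    finally show ?thesis using P_pos[of s] by simp
  qed
  then show thesis using that m by blast
qed

lemma tower_flag_mono: "i \<le> j \<Longrightarrow> tower_flag ns i \<subseteq> tower_flag ns j"
  unfolding tower_flag_def by (intro image_mono) auto

text \<open>\<open>up (P s) (i + 1)\<close> is \<open>(i div P s + 1) * P s\<close>, so the bound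
  reads \<open>(i div P s + j div P s + 1) * P s \<le> v + 1\<close>. By
  \<open>tower_elem_mult\<close> every product has an index below the left hand side. If
  \<open>v\<close> is at least the degree, the claim is trivial.\<close>

lemma tower_flag_type_le:
  assumes ij: "i < N" "j < N" and "tower_bounded ns i j (v + 1)"
  shows "tower_flag_type ns (i, j) \<le> v"
proof (cases "v < N")
  case True
  obtain s where s: "s \<le> length ns" "kneser_bound (P s) (i + 1) (j + 1) (v + 1)"
    using assms(3) unfolding tower_bounded_def by blast
  then have v: "(i div P s + j div P s + 1) * P s \<le> v + 1"
    by (simp add: kneser_bound_def up_def algebra_simps)
  have "x \<otimes>\<^bsub>T\<^esub> y \<in> tower_flag ns v" if "x \<in> tower_flag ns i" "y \<in> tower_flag ns j" for x y
  proof -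
    obtain i' where i': "i' \<le> i" "x = tower_elem ns i'" using \<open>x \<in> tower_flag ns i\<close> by (auto simp: tower_flag_def)
    obtain j' where j': "j' \<le> j" "y = tower_elem ns j'" using \<open>y \<in> tower_flag ns j\<close> by (auto simp: tower_flag_def)
    obtain m where "m < N" and m: "tower_elem ns i' \<otimes>\<^bsub>T\<^esub> tower_elem ns j' = tower_elem ns m"
      "\<forall>s\<le>length ns. m div P s \<le> i' div P s + j' div P s"
      using tower_elem_mult[OF le_less_trans[OF i'(1) ij(1)] le_less_trans[OF j'(1) ij(2)]] .
    have mle: "m div P s \<le> i' div P s + j' div P s" using m(2) s(1) by blast
    have "m div P s < i div P s + j div P s + 1"
      using mle div_le_mono[OF i'(1), of "P s"] div_le_mono[OF j'(1), of "P s"] by linarith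
    then have "m < (i div P s + j div P s + 1) * P s" using P_pos[of s] by (simp only: div_less_iff_less_mult)
    then have "m \<le> v" using v by linarith
    then show ?thesis using m(1) i'(2) j'(2) by (simp add: tower_flag_def)
  qed
  then have "tower_flag ns i <#>\<^bsub>T\<^esub> tower_flag ns j \<subseteq> tower_flag ns v" unfolding set_mult_def by blast
  then show ?thesis using True ij order_tower
    by (auto simp: tower_flag_type_def group_flag_type_def flag_type_def intro: Least_le)
next
  case False
  have c: "tower_flag ns k \<subseteq> carrier T" for k using tower_elem_carrier unfolding tower_flag_def by blast
  have "{..N - 1} = {..<N}" using ij by auto
  then have "tower_flag ns (N - 1) = carrier T" using tower_elem_image by (simp add: tower_flag_def)
  then have "tower_flag ns i <#>\<^bsub>T\<^esub> tower_flag ns j \<subseteq> tower_flag ns (N - 1)"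
    using T.set_mult_closed[OF c c] by simp
  then have "tower_flag_type ns (i, j) \<le> N - 1" using ij order_tower
    by (auto simp: tower_flag_type_def group_flag_type_def flag_type_def intro: Least_le)
  then show ?thesis using False by simp
qed

lemma group_flag_tower: "group_flag T (tower_flag ns)"
proof -
  have N: "0 < N" using P_pos[of "length ns"] by simp
  have "{..N - 1} = {..<N}" using N by auto
  then have last: "tower_flag ns (N - 1) = carrier T" using tower_elem_image by (simp add: tower_flag_def)
  have "digit 0 r = 0" for r by (simp add: mixed_radix_digit_def)
  then have "tower_elem ns 0 = \<one>\<^bsub>T\<^esub>" by (auto simp: tower_elem_eq digits_below_def one_tower fun_eq_iff)
  then have first: "tower_flag ns 0 = {\<one>\<^bsub>T\<^esub>}" by (simp add: tower_flag_def)
  have card: "card (tower_flag ns i) = i + 1" if "i < N" for i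
  proof -
    have "inj_on (tower_elem ns) {..i}" by (rule inj_on_subset[OF inj_tower_elem]) (use that in auto)
    then show ?thesis by (simp add: tower_flag_def card_image)
  qed
  have strict: "tower_flag ns i \<subset> tower_flag ns (Suc i)" if "Suc i < N" for i
  proof (rule psubsetI)
    show "tower_flag ns i \<noteq> tower_flag ns (Suc i)" using card[of i] card[of "Suc i"] that by fastforce
  qed (rule tower_flag_mono, simp)
  show ?thesis
    unfolding group_flag_def order_tower using comm_group_tower finite_tower first last strict card by blast
qed

section \<open>The tower type of the tower flag\<close>

definition tower_subgroup :: "nat \<Rightarrow> (nat \<Rightarrow> int) set" where
  "tower_subgroup k = tower_elem ns ` {..<P k}"

lemma digit_zero_iff:
  assumes "i < N" "k \<le> length ns"
  shows "i < P k \<longleftrightarrow> (\<forall>r. k \<le> r \<longrightarrow> r < length ns \<longrightarrow> digit i r = 0)"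
proof
  assume i: "i < P k"
  show "\<forall>r. k \<le> r \<longrightarrow> r < length ns \<longrightarrow> digit i r = 0"
  proof (intro allI impI)
    fix r assume "k \<le> r"
    then have "i < P r" using P_mono[of k r] i by linarith
    then show "digit i r = 0" by (simp add: mixed_radix_digit_def)
  qed
next
  assume "\<forall>r. k \<le> r \<longrightarrow> r < length ns \<longrightarrow> digit i r = 0"
  then have "i div P k * P k = 0" using high_digits[OF assms(2,1)] by simp
  then show "i < P k" using P_pos[of k] by (simp add: div_eq_0_iff)
qed

lemma tower_subgroup_eq:
  assumes "k \<le> length ns"
  shows "tower_subgroup k = {f \<in> carrier T. \<forall>r. k \<le> r \<longrightarrow> r < length ns \<longrightarrow> f r = 0}"
proof -
  have "{f \<in> carrier T. \<forall>r. k \<le> r \<longrightarrow> r < length ns \<longrightarrow> f r = 0}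
      = tower_elem ns ` {i \<in> {..<N}. \<forall>r. k \<le> r \<longrightarrow> r < length ns \<longrightarrow> tower_elem ns i r = 0}"
    unfolding tower_elem_image[symmetric] by blast
  also have "{i \<in> {..<N}. \<forall>r. k \<le> r \<longrightarrow> r < length ns \<longrightarrow> tower_elem ns i r = 0} = {..<P k}"
  proof (intro equalityI subsetI)
    fix i assume "i \<in> {i \<in> {..<N}. \<forall>r. k \<le> r \<longrightarrow> r < length ns \<longrightarrow> tower_elem ns i r = 0}"
    then show "i \<in> {..<P k}" using digit_zero_iff[OF _ assms, of i] tower_elem_apply[of _ i] by simp
  next
    fix i assume "i \<in> {..<P k}"
    moreover then have "i < N" using P_le_N[of k] by simp
    ultimately show "i \<in> {i \<in> {..<N}. \<forall>r. k \<le> r \<longrightarrow> r < length ns \<longrightarrow> tower_elem ns i r = 0}"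
      using digit_zero_iff[OF _ assms, of i] tower_elem_apply[of _ i] by simp
  qed
  finally show ?thesis by (simp add: tower_subgroup_def)
qed

lemma subgroup_tower_subgroup:
  assumes "k \<le> length ns"
  shows "subgroup (tower_subgroup k) T"
proof (rule T.subgroupI)
  note mem = tower_subgroup_eq[OF assms]
  show "tower_subgroup k \<subseteq> carrier T" unfolding mem by blast
  have "0 \<in> {..<P k}" using P_pos[of k] by simp
  then show "tower_subgroup k \<noteq> {}" unfolding tower_subgroup_def by blast
  show "x \<otimes>\<^bsub>T\<^esub> y \<in> tower_subgroup k" if "x \<in> tower_subgroup k" "y \<in> tower_subgroup k" for x y
  proof -
    have x: "x \<in> carrier T" "\<And>r. k \<le> r \<Longrightarrow> r < length ns \<Longrightarrow> x r = 0"
      and y: "y \<in> carrier T" "\<And>r. k \<le> r \<Longrightarrow> r < length ns \<Longrightarrow> y r = 0"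
      using that unfolding mem by blast+
    have "(x \<otimes>\<^bsub>T\<^esub> y) r = 0" if "k \<le> r" "r < length ns" for r
      using x(2)[OF that] y(2)[OF that] that(2) unfolding mult_tower by simp
    then show ?thesis using T.m_closed[OF x(1) y(1)] unfolding mem by blast
  qed
  show "inv\<^bsub>T\<^esub> x \<in> tower_subgroup k" if x: "x \<in> tower_subgroup k" for x
  proof -
    have xc: "x \<in> carrier T" and x0: "\<And>r. k \<le> r \<Longrightarrow> r < length ns \<Longrightarrow> x r = 0"
      using x unfolding mem by blast+
    have ic: "inv\<^bsub>T\<^esub> x \<in> carrier T" using xc by (rule T.inv_closed)
    have "(inv\<^bsub>T\<^esub> x) r = 0" if r: "k \<le> r" "r < length ns" for r
    proof -
      have "(inv\<^bsub>T\<^esub> x \<otimes>\<^bsub>T\<^esub> x) r = \<one>\<^bsub>T\<^esub> r" by (simp only: T.l_inv[OF xc])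
      then have "(inv\<^bsub>T\<^esub> x) r mod int (ns ! r) = 0"
        using r x0[OF r] unfolding mult_tower one_tower by simp
      moreover have "(inv\<^bsub>T\<^esub> x) r \<in> {0..<int (ns ! r)}"
        using PiE_mem[OF ic[unfolded carrier_tower], of r] r(2) by simp
      ultimately show ?thesis by (simp only: atLeastLessThan_iff mod_pos_pos_trivial)
    qed
    then show ?thesis using ic unfolding mem by blast
  qed
qed

lemma tower_elem_generator:
  assumes "r < length ns" shows "tower_elem ns (P r) = tower_gen ns r"
proof -
  have "digit (P r) q = (if q = r then 1 else 0)" if q: "q < length ns" for q
  proof -
    consider "q < r" | "q = r" | "r < q" by linarith
    then show ?thesis
    proof cases
      case 1
      then have "P (Suc q) dvd P r" by (intro P_dvd) simp
      then obtain c where "P r = P q * ns ! q * c" unfolding prod_list_take_Suc[OF q] by (rule dvdE)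
      then have "digit (P r) q = ns ! q * c mod ns ! q" using P_pos[of q] by (simp add: mixed_radix_digit_def mult.assoc)
      then show ?thesis using 1 by simp
    next
      case 2
      then show ?thesis using P_pos[of r] ns_gt[OF q] by (simp add: mixed_radix_digit_def)
    next
      case 3
      then show ?thesis using P_strict[OF 3] q by (simp add: mixed_radix_digit_def)
    qed
  qed
  then show ?thesis by (auto simp: tower_elem_eq digits_below_def tower_gen_def fun_eq_iff)
qed

text \<open>For \<open>r \<le> s\<close> the index \<open>P r\<close> is at most \<open>i\<close>,
  and its element is the \<open>r\<close>-th generator; so the flag member contains all generators
  of the subgroup in which it lies.\<close>

lemma generate_tower_flag:
  assumes s: "s < length ns" and i: "P s \<le> i" "i < P (Suc s)"
  shows "generate T (tower_flag ns i) = tower_subgroup (Suc s)"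
proof
  have sub: "tower_flag ns i \<subseteq> carrier T" using tower_elem_carrier unfolding tower_flag_def by blast
  have le: "Suc s \<le> length ns" using s by simp
  have "tower_flag ns i \<subseteq> tower_subgroup (Suc s)"
    using i(2) unfolding tower_flag_def tower_subgroup_def by (intro image_mono) auto
  then show "generate T (tower_flag ns i) \<subseteq> tower_subgroup (Suc s)"
    by (rule T.generate_subgroup_incl[OF _ subgroup_tower_subgroup[OF le]])
  interpret H: subgroup "generate T (tower_flag ns i)" T by (rule T.generate_is_subgroup[OF sub])
  have gen: "tower_gen ns r \<in> generate T (tower_flag ns i)" if "r \<le> s" for r
  proof -
    have "P r \<le> i" using P_mono[OF that] i(1) by linarith
    then have "tower_elem ns (P r) \<in> tower_flag ns i" unfolding tower_flag_def by blast
    then show ?thesis using tower_elem_generator[of r] that s by (auto intro: generate.incl)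
  qed
  show "tower_subgroup (Suc s) \<subseteq> generate T (tower_flag ns i)"
  proof
    fix x assume "x \<in> tower_subgroup (Suc s)"
    then obtain j where j: "j < P (Suc s)" "x = tower_elem ns j" unfolding tower_subgroup_def by auto
    have "digits_below j k \<in> generate T (tower_flag ns i)" if "k \<le> Suc s" for k
      using that
    proof (induction k)
      case 0
      have "digits_below j 0 = \<one>\<^bsub>T\<^esub>" by (auto simp: digits_below_def one_tower)
      then show ?case by simp
    next
      case (Suc k)
      have "tower_gen ns k [^]\<^bsub>T\<^esub> d \<in> generate T (tower_flag ns i)" for d :: nat
        using gen[of k] Suc.prems by (induction d) auto
      then show ?case using Suc s by (simp add: digits_below_Suc)
    qed
    then have "digits_below j (Suc s) \<in> generate T (tower_flag ns i)" by simp
    moreover have "digits_below j (Suc s) = tower_elem ns j"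
    proof -
      have "j < N" using j(1) P_le_N[of "Suc s"] by linarith
      then have "digit j r = 0" if "Suc s \<le> r" "r < length ns" for r
        using digit_zero_iff[OF _ le, of j] j(1) that by blast
      then show ?thesis unfolding tower_elem_eq digits_below_def by (intro restrict_ext) auto
    qed
    ultimately show "x \<in> generate T (tower_flag ns i)" using j(2) by simp
  qed
qed

lemma tower_flag_has_tower_type: "group_flag_has_tower_type T (tower_flag ns) ns"
proof -
  let ?Gs = "map tower_subgroup [0..<length ns + 1]"
  have card: "card (tower_subgroup k) = P k" for k
  proof -
    have "inj_on (tower_elem ns) {..<P k}"
      by (rule inj_on_subset[OF inj_tower_elem]) (use P_le_N[of k] in auto)
    then show ?thesis by (simp add: tower_subgroup_def card_image)
  qed
  have less: "tower_subgroup k \<subset> tower_subgroup l" if "k < l" "l \<le> length ns" for k l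
  proof -
    have "tower_subgroup k \<subseteq> tower_subgroup l"
      using P_mono[of k l] that unfolding tower_subgroup_def by (intro image_mono) auto
    moreover have "tower_subgroup k \<noteq> tower_subgroup l" using card[of k] card[of l] P_strict[OF that] by fastforce
    ultimately show ?thesis by blast
  qed
  have zero: "generate T (tower_flag ns 0) = tower_subgroup 0"
  proof -
    have "tower_flag ns 0 = {\<one>\<^bsub>T\<^esub>}" using group_flag_tower by (simp add: group_flag_def)
    moreover have "tower_subgroup 0 = tower_flag ns 0" by (simp add: tower_subgroup_def tower_flag_def lessThan_Suc)
    ultimately show ?thesis using T.generate_one by simp
  qed
  have "set ?Gs = (\<lambda>i. generate T (tower_flag ns i)) ` {..<N}"
  proof (intro equalityI subsetI)
    fix H assume "H \<in> set ?Gs"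
    then have "H \<in> tower_subgroup ` {0..<length ns + 1}" by (simp only: set_map set_upt)
    then obtain k where "k \<in> {0..<length ns + 1}" and Hk: "H = tower_subgroup k" by (elim imageE)
    then have k: "k \<le> length ns" "H = tower_subgroup k" by simp_all
    show "H \<in> (\<lambda>i. generate T (tower_flag ns i)) ` {..<N}"
    proof (cases k)
      case 0
      then have "H = generate T (tower_flag ns 0)" using zero k(2) by simp
      moreover have "0 \<in> {..<N}" using P_pos[of "length ns"] by simp
      ultimately show ?thesis by (rule image_eqI)
    next
      case (Suc s)
      then have "s < length ns" using k by simp
      moreover then have "P s < P (Suc s)" by (intro P_strict) simp_all
      ultimately have "H = generate T (tower_flag ns (P s))" "P s \<in> {..<N}"
        using generate_tower_flag[of s "P s"] k(2) Suc P_le_N[of "Suc s"] by simp_all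
      then show ?thesis by (rule image_eqI)
    qed
  next
    fix H assume "H \<in> (\<lambda>i. generate T (tower_flag ns i)) ` {..<N}"
    then obtain i where "i \<in> {..<N}" and H: "H = generate T (tower_flag ns i)" by (elim imageE)
    then have i: "i < N" "H = generate T (tower_flag ns i)" by simp_all
    show "H \<in> set ?Gs"
    proof (cases "i = 0")
      case True
      then have "H = tower_subgroup 0" using zero i(2) by simp
      then show ?thesis unfolding set_map by (rule image_eqI) simp
    next
      case False
      have bound: "y \<le> length ns" if "P y \<le> i" for y
        using that i(1) by (cases "y \<le> length ns") auto
      \<comment> \<open>The position of the leading nonzero digit of \<open>i\<close>.\<close>
      define s where "s = (GREATEST s. P s \<le> i)"
      have "P 0 \<le> i" using False by simp
      then have s: "P s \<le> i" "\<And>y. P y \<le> i \<Longrightarrow> y \<le> s"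
        unfolding s_def using GreatestI_nat[of "\<lambda>s. P s \<le> i" 0 "length ns"] bound
          Greatest_le_nat[of "\<lambda>s. P s \<le> i" _ "length ns"] by simp_all
      have sl: "s < length ns" using s(1) i(1) by (cases "s < length ns") auto
      have "i < P (Suc s)" using s(2)[of "Suc s"] by (cases "i < P (Suc s)") auto
      then have "H = tower_subgroup (Suc s)" using generate_tower_flag[OF sl s(1)] i(2) by simp
      then show ?thesis unfolding set_map set_upt by (rule image_eqI) (use sl in simp)
    qed
  qed
  moreover have "sorted_wrt (\<subset>) ?Gs"
    unfolding sorted_wrt_map
  proof (rule sorted_wrt_mono_rel[OF _ sorted_wrt_upt])
    show "tower_subgroup k \<subset> tower_subgroup l"
      if "k \<in> set [0..<length ns + 1]" "l \<in> set [0..<length ns + 1]" "k < l" for k l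
      using less[OF that(3)] that(2) unfolding set_upt by simp
  qed
  moreover have "card (?Gs ! Suc s) = ns ! s * card (?Gs ! s)" if "s < length ns" for s
    using that by (simp add: card prod_list_take_Suc mult.commute del: upt_Suc)
  ultimately show ?thesis
    unfolding group_flag_has_tower_type_def order_tower by (intro exI[of _ ?Gs]) simp
qed

end

section \<open>Transport to a given type and the main theorem\<close>

lemma set_mult_image_group:
  assumes "inj_on f (carrier G)" "A \<subseteq> carrier G" "B \<subseteq> carrier G"
  shows "f ` A <#>\<^bsub>image_group f G\<^esub> f ` B = f ` (A <#>\<^bsub>G\<^esub> B)"
proof -
  have "f a \<otimes>\<^bsub>image_group f G\<^esub> f b = f (a \<otimes>\<^bsub>G\<^esub> b)" if "a \<in> A" "b \<in> B" for a b
  proof -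
    have "a \<in> carrier G" "b \<in> carrier G" using that assms by auto
    then show ?thesis using assms(1) by (simp add: image_group_def)
  qed
  then have "(\<lambda>(a, b). f a \<otimes>\<^bsub>image_group f G\<^esub> f b) ` (A \<times> B) = (\<lambda>(a, b). f (a \<otimes>\<^bsub>G\<^esub> b)) ` (A \<times> B)"
    by (intro image_cong) auto
  moreover have "f ` A <#>\<^bsub>image_group f G\<^esub> f ` B = (\<lambda>(a, b). f a \<otimes>\<^bsub>image_group f G\<^esub> f b) ` (A \<times> B)"
    unfolding set_mult_def by auto
  moreover have "f ` (A <#>\<^bsub>G\<^esub> B) = (\<lambda>(a, b). f (a \<otimes>\<^bsub>G\<^esub> b)) ` (A \<times> B)"
    unfolding set_mult_def by auto
  ultimately show ?thesis by simp
qed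

text \<open>The tower group lives on functions from \<open>nat\<close> to \<open>int\<close>,
  whereas \<open>flag_types\<close> collects groups on \<open>'g\<close>; the structure is carried
  along a bijection onto a finite subset of this infinite type.\<close>

lemma group_flag_transport:
  fixes G :: "('a, 'm) monoid_scheme"
  assumes inf: "infinite (UNIV :: 'g set)"
    and F: "group_flag G F" and ns: "group_flag_has_tower_type G F ns"
    and sub: "\<And>i. i < order G \<Longrightarrow> F i \<subseteq> carrier G"
  obtains G' :: "'g monoid" and F' where "group_flag G' F'" "group_flag_has_tower_type G' F' ns"
    "group_flag_type G' F' = group_flag_type G F"
proof -
  have G: "comm_group G" "finite (carrier G)" and F0: "F 0 = {\<one>\<^bsub>G\<^esub>}" and Fn: "F (order G - 1) = carrier G"
    and Fs: "\<And>i. Suc i < order G \<Longrightarrow> F i \<subset> F (Suc i)" and Fc: "\<And>i. i < order G \<Longrightarrow> card (F i) = i + 1"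
    using F by (auto simp: group_flag_def)
  interpret comm_group G by (rule G(1))
  obtain B :: "'g set" where B: "finite B" "card B = card (carrier G)"
    using infinite_arbitrarily_large[OF inf] by blast
  then obtain f where f: "bij_betw f (carrier G) B" using finite_same_card_bij[OF G(2) B(1)] by auto
  then have inj: "inj_on f (carrier G)" by (rule bij_betw_imp_inj_on)
  let ?G = "image_group f G" and ?F = "\<lambda>i. f ` F i"
  have iso: "f \<in> iso G ?G" by (rule inj_imp_image_group_iso[OF inj])
  have grp: "group ?G" by (rule inj_imp_image_group_is_group[OF inj])
  have comm: "comm_group ?G" by (rule iso_imp_comm_group[OF is_isoI[OF iso] group.is_monoid[OF grp]])
  have hom: "group_hom G ?G f"
  proof (intro group_hom.intro group_hom_axioms.intro is_group grp)
    show "f \<in> hom G ?G" using iso by (simp add: iso_def)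
  qed
  have order: "order ?G = order G" unfolding order_def image_group_carrier by (rule card_image[OF inj])
  have inj_card: "card (f ` A) = card A" if "A \<subseteq> carrier G" for A
    by (rule card_image[OF inj_on_subset[OF inj that]])
  have image_iff_subset: "f ` A \<subseteq> f ` B \<longleftrightarrow> A \<subseteq> B" if "A \<subseteq> carrier G" "B \<subseteq> carrier G" for A B
  proof
    assume *: "f ` A \<subseteq> f ` B"
    show "A \<subseteq> B"
    proof
      fix x assume x: "x \<in> A"
      then have "f x \<in> f ` B" using * by blast
      then show "x \<in> B" using inj_on_image_mem_iff[OF inj _ that(2)] x that(1) by blast
    qed
  qed (rule image_mono)
  have strict: "f ` A \<subset> f ` B" if "A \<subset> B" "B \<subseteq> carrier G" for A B
  proof -
    have "A \<subseteq> carrier G" using that by blast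
    then show ?thesis using that image_iff_subset[of A B] image_iff_subset[of B A] by blast
  qed
  have gen: "generate ?G (?F i) = f ` generate G (F i)" if "i < order G" for i
    by (rule group_hom.generate_img[OF hom sub[OF that]])
  have gsub: "generate G (F i) \<subseteq> carrier G" if "i < order G" for i using generate_incl[OF sub[OF that]] .
  have flag: "group_flag ?G ?F"
    unfolding group_flag_def order
  proof (intro conjI allI impI)
    show "?F 0 = {\<one>\<^bsub>?G\<^esub>}" by (simp add: F0 image_group_one)
    show "?F (order G - 1) = carrier ?G" by (simp only: Fn image_group_carrier)
    show "?F i \<subset> ?F (Suc i)" if "Suc i < order G" for i by (rule strict[OF Fs[OF that] sub[OF that]])
    show "card (?F i) = i + 1" if "i < order G" for i using inj_card[OF sub[OF that]] Fc[OF that] by simp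
  qed (use comm G in \<open>simp_all add: image_group_carrier\<close>)
  obtain Gs where Gs: "length Gs = length ns + 1" "sorted_wrt (\<subset>) Gs"
    "set Gs = (\<lambda>i. generate G (F i)) ` {..<order G}"
    "\<And>s. s < length ns \<Longrightarrow> card (Gs ! Suc s) = ns ! s * card (Gs ! s)"
    using ns unfolding group_flag_has_tower_type_def by blast
  have Gsub: "A \<subseteq> carrier G" if "A \<in> set Gs" for A
    using that gsub unfolding Gs(3) by blast
  have tower: "group_flag_has_tower_type ?G ?F ns"
    unfolding group_flag_has_tower_type_def order
  proof (intro exI[of _ "map ((`) f) Gs"] conjI allI impI)
    show "length (map ((`) f) Gs) = length ns + 1" using Gs(1) by simp
    show "sorted_wrt (\<subset>) (map ((`) f) Gs)"
      unfolding sorted_wrt_map by (rule sorted_wrt_mono_rel[OF _ Gs(2)]) (use strict Gsub in blast)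
    show "set (map ((`) f) Gs) = (\<lambda>i. generate ?G (?F i)) ` {..<order G}"
      unfolding set_map Gs(3) image_image by (rule image_cong[OF refl]) (simp add: gen)
    show "card (map ((`) f) Gs ! Suc s) = ns ! s * card (map ((`) f) Gs ! s)" if "s < length ns" for s
      using Gs(4)[OF that] inj_card[OF Gsub] that Gs(1) by simp
  qed
  have iff: "?F i <#>\<^bsub>?G\<^esub> ?F j \<subseteq> ?F k \<longleftrightarrow> F i <#>\<^bsub>G\<^esub> F j \<subseteq> F k"
    if "i < order G" "j < order G" "k < order G" for i j k
  proof -
    have "F i <#>\<^bsub>G\<^esub> F j \<subseteq> carrier G" using set_mult_closed[OF sub[OF that(1)] sub[OF that(2)]] .
    then show ?thesis
      unfolding set_mult_image_group[OF inj sub[OF that(1)] sub[OF that(2)]]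
      by (rule image_iff_subset[OF _ sub[OF that(3)]])
  qed
  have "group_flag_type ?G ?F = group_flag_type G F"
    unfolding group_flag_type_def flag_type_def order
  proof (rule restrict_ext)
    fix x assume x: "x \<in> {..<order G} \<times> {..<order G}"
    obtain i j where ij: "x = (i, j)" "i < order G" "j < order G" using x by auto
    have "(\<lambda>k. k < order G \<and> ?F i <#>\<^bsub>?G\<^esub> ?F j \<subseteq> ?F k) = (\<lambda>k. k < order G \<and> F i <#>\<^bsub>G\<^esub> F j \<subseteq> F k)"
    proof
      fix k
      show "(k < order G \<and> ?F i <#>\<^bsub>?G\<^esub> ?F j \<subseteq> ?F k) = (k < order G \<and> F i <#>\<^bsub>G\<^esub> F j \<subseteq> F k)"
        using iff[OF ij(2,3), of k] by blast
    qed
    then show "(case x of (i, j) \<Rightarrow> LEAST k. k < order G \<and> ?F i <#>\<^bsub>?G\<^esub> ?F j \<subseteq> ?F k)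
      = (case x of (i, j) \<Rightarrow> LEAST k. k < order G \<and> F i <#>\<^bsub>G\<^esub> F j \<subseteq> F k)"
      using ij(1) by simp
  qed
  then show thesis by (rule that[OF flag tower])
qed

section \<open>Least elements, and reduction to the treated towers\<close>

lemma flag_type_extensional: "flag_type n sp F \<in> extensional ({..<n} \<times> {..<n})"
  by (simp add: flag_type_def)

lemma minimal_elements_least:
  assumes "x \<in> S" "\<And>y. y \<in> S \<Longrightarrow> r x y" "\<And>y. y \<in> S \<Longrightarrow> r y x \<Longrightarrow> y = x"
  shows "minimal_elements r S = {x}"
  using assms unfolding minimal_elements_def by blast

lemma admissible_replicate: "Factorial_Ring.prime p \<Longrightarrow> ns = replicate t p \<Longrightarrow> admissible ns"
  unfolding admissible_def by blast

lemma admissible_pair: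
  assumes "q = 2 \<or> q = 3" "Factorial_Ring.prime p"
  shows "admissible [q, p]"
proof (cases "p = q")
  case True
  then show ?thesis using assms(2) by (intro admissible_replicate[of p _ 2]) (simp_all add: numeral_2_eq_2)
next
  case False
  then show ?thesis using assms unfolding admissible_def by blast
qed

lemma prod_list_ge_power: "\<forall>m\<in>set ns. 1 < m \<Longrightarrow> 2 ^ length ns \<le> prod_list (ns :: nat list)"
proof (induction ns)
  case (Cons a ns)
  then have "2 * 2 ^ length ns \<le> a * prod_list ns" by (intro mult_mono) auto
  then show ?case by simp
qed simp

text \<open>Entries are at least 2, so at most three of them fit below 8. Besides prime entries
  alone, only (4), (6), (2,4) and (4,2) remain.\<close>

lemma admissible_small:
  assumes ns: "\<forall>m\<in>set ns. 1 < m" and le: "prod_list ns \<le> 8" and ne: "ns \<noteq> [8]"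
  shows "admissible ns"
proof -
  have p: "Factorial_Ring.prime (2::nat)" "Factorial_Ring.prime (3::nat)" "Factorial_Ring.prime (5::nat)"
    "Factorial_Ring.prime (7::nat)" by simp_all
  have "(2::nat) ^ length ns \<le> 2 ^ 3" using prod_list_ge_power[OF ns] le by simp
  then have "length ns \<le> 3" by (rule power_le_imp_le_exp[rotated]) simp
  then consider "ns = []" | a where "ns = [a]" | a b where "ns = [a, b]" | a b c where "ns = [a, b, c]"
    by (cases ns rule: list.exhaust; cases "tl ns"; cases "tl (tl ns)"; cases "tl (tl (tl ns))") auto
  then show ?thesis
  proof cases
    case 1
    then show ?thesis by (intro admissible_replicate[OF p(1), of _ 0]) simp
  next
    case 2
    then have "a \<in> {2, 3, 4, 5, 6, 7}" using ns le ne by auto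
    then show ?thesis using 2 admissible_replicate[of a ns 1] p by (auto simp: admissible_def)
  next
    case 3
    have ab: "2 \<le> a" "2 \<le> b" "a * b \<le> 8" using 3 ns le by auto
    have "a * 2 \<le> a * b" "2 * b \<le> a * b" using ab by simp_all
    then have "a \<le> 4" "b \<le> 4" using ab(3) by linarith+
    then have "a = 2 \<or> a = 3 \<or> a = 4" "b = 2 \<or> b = 3 \<or> b = 4" using ab(1,2) by linarith+
    then have "(a, b) \<in> {(2, 2), (2, 3), (2, 4), (3, 2), (4, 2)}" using ab(3) by auto
    moreover have "admissible [2, 2]" "admissible [2, 3]" "admissible [3, 2]" using p admissible_pair by auto
    moreover have "admissible [2, 4]" "admissible [4, 2]" by (simp_all add: admissible_def)
    ultimately show ?thesis using 3 by auto
  next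
    case 4
    have abc: "2 \<le> a" "2 \<le> b" "2 \<le> c" "a * (b * c) \<le> 8" using 4 ns le by auto
    have four: "2 * 2 \<le> b * c" "2 * 2 \<le> a * c" "2 * 2 \<le> a * b" using abc by (intro mult_mono; simp)+
    have perm: "b * (a * c) \<le> 8" "c * (a * b) \<le> 8"
      using abc(4) by (simp only: mult.left_commute) (metis abc(4) mult.assoc mult.commute)
    have "a * (2 * 2) \<le> 8" by (rule le_trans[OF mult_le_mono2[OF four(1)] abc(4)])
    moreover have "b * (2 * 2) \<le> 8" by (rule le_trans[OF mult_le_mono2[OF four(2)] perm(1)])
    moreover have "c * (2 * 2) \<le> 8" by (rule le_trans[OF mult_le_mono2[OF four(3)] perm(2)])
    ultimately have "a \<le> 2" "b \<le> 2" "c \<le> 2" by linarith+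
    then have "a = 2" "b = 2" "c = 2" using abc by linarith+
    then show ?thesis using 4 by (intro admissible_replicate[OF p(1), of _ 3]) (simp add: numeral_3_eq_3)
  qed
qed

lemma admissible_prime_degree:
  assumes ns: "\<forall>m\<in>set ns. 1 < m" and "Factorial_Ring.prime (prod_list ns)"
  shows "admissible ns"
proof (cases ns)
  case Nil
  then show ?thesis using assms(2) by simp
next
  case (Cons a l)
  then have "a = 1 \<or> prod_list l = 1" using prime_product assms(2) by simp
  moreover have "1 < a" using Cons ns by simp
  ultimately have "prod_list l = 1" by simp
  moreover have "2 ^ length l \<le> prod_list l" using ns Cons by (intro prod_list_ge_power) simp
  ultimately have "2 ^ length l \<le> (2::nat) ^ 0" by simp
  then have "length l \<le> 0" by (rule power_le_imp_le_exp[rotated]) simp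
  then have "l = []" by simp
  then show ?thesis using Cons assms(2) by (intro admissible_replicate[of a _ 1]) simp_all
qed

theorem theorem1p14:
  fixes ns :: "nat list" and n :: nat
  assumes "infinite (UNIV :: 'g set)"
    and "tower_type_of_degree ns n"
    and "n < 8 \<or>
         (n = 8 \<and> ns \<noteq> [8]) \<or>
         Factorial_Ring.prime n \<or>
         (\<exists>p. Factorial_Ring.prime p \<and> ns = replicate (length ns) p) \<or>
         (\<exists>p. Factorial_Ring.prime p \<and> ns = [2, p]) \<or>
         (\<exists>p. Factorial_Ring.prime p \<and> ns = [3, p])"
  shows "minimal_elements (flag_type_le n) (flag_types TYPE('g) TYPE('f) ns) =
         {tower_flag_type ns}"
proof (rule minimal_elements_least)
  have ns: "\<forall>m\<in>set ns. 1 < m" and n: "n = prod_list ns"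
    using assms(2) by (auto simp: tower_type_of_degree_def)
  have adm: "admissible ns"
    using assms(3)
  proof (elim disjE exE conjE)
    assume "n < 8"
    then show ?thesis using n by (intro admissible_small[OF ns]) auto
  next
    assume "n = 8" "ns \<noteq> [8]"
    then show ?thesis using n by (intro admissible_small[OF ns]) auto
  next
    assume "Factorial_Ring.prime n"
    then show ?thesis using n by (intro admissible_prime_degree[OF ns]) simp
  next
    fix p :: nat assume "Factorial_Ring.prime p" "ns = replicate (length ns) p"
    then show ?thesis by (rule admissible_replicate)
  next
    fix p :: nat assume "Factorial_Ring.prime p" "ns = [2, p]"
    then show ?thesis using admissible_pair[of 2 p] by simp
  next
    fix p :: nat assume "Factorial_Ring.prime p" "ns = [3, p]"
    then show ?thesis using admissible_pair[of 3 p] by simp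
  qed
  note T = group_flag_tower[OF ns] tower_flag_has_tower_type[OF ns]
  obtain G :: "'g monoid" and F where GF: "group_flag G F" "group_flag_has_tower_type G F ns"
    "group_flag_type G F = group_flag_type (tower_group ns) (tower_flag ns)"
    by (rule group_flag_transport[OF assms(1) T group_flag_subset[OF T(1)]])
  have "tower_flag_type ns = group_flag_type G F" by (simp add: tower_flag_type_def GF(3))
  then show "tower_flag_type ns \<in> flag_types TYPE('g) TYPE('f) ns"
    unfolding flag_types_def using GF(1,2) by blast
  have T_ext: "tower_flag_type ns \<in> extensional ({..<n} \<times> {..<n})"
    using flag_type_extensional[of n] unfolding tower_flag_type_def group_flag_type_def order_tower[OF ns] n by blast
  have main: "flag_type_le n (tower_flag_type ns) y \<and> y \<in> extensional ({..<n} \<times> {..<n})"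
    if "y \<in> flag_types TYPE('g) TYPE('f) ns" for y
  proof -
    \<comment> \<open>Pointwise comparison controls only the index square; extensionality is kept
      alongside so that antisymmetry on the square gives equality of functions.\<close>
    have "y \<in> extensional ({..<n} \<times> {..<n}) \<and> (\<forall>i<n. \<forall>j<n. tower_bounded ns i j (y (i, j) + 1))"
      using that unfolding flag_types_def
    proof (elim UnE CollectE exE conjE)
      fix G :: "'g monoid" and F
      assume y: "y = group_flag_type G F" and F: "group_flag G F" "group_flag_has_tower_type G F ns"
      \<comment> \<open>\<open>flag_types\<close> does not prescribe the order of the group; the
        tower type determines it.\<close>
      have o: "order G = n" using group_flag_along(2)[OF F] n by simp
      show ?thesis using group_flag_type_bounded[OF F adm] flag_type_extensional[of n "set_mult G" F]
        unfolding o y by (simp add: group_flag_type_def o)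
    next
      fix L :: "'f ring" and K m F
      assume y: "y = field_flag_type L K m F" and F: "field_flag L K m F" "field_flag_has_tower_type L K m F ns"
      have o: "m = n" using field_flag_along(3)[OF F] n by simp
      show ?thesis using field_flag_type_bounded[OF F adm]
          flag_type_extensional[of n "\<lambda>A B. set_span L K (A <#>\<^bsub>L\<^esub> B)" F]
        unfolding o y by (simp add: field_flag_type_def)
    qed
    moreover have "tower_flag_type ns (i, j) \<le> y (i, j)"
      if "i < n" "j < n" "tower_bounded ns i j (y (i, j) + 1)" for i j
      using tower_flag_type_le[OF ns] that unfolding n by blast
    ultimately show ?thesis unfolding flag_type_le_def by blast
  qed
  show "flag_type_le n (tower_flag_type ns) y" if "y \<in> flag_types TYPE('g) TYPE('f) ns" for y
    using main[OF that] by (rule conjunct1)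
  show "y = tower_flag_type ns"
    if y: "y \<in> flag_types TYPE('g) TYPE('f) ns" "flag_type_le n y (tower_flag_type ns)" for y
  proof (rule extensionalityI[of _ "{..<n} \<times> {..<n}"])
    show "y \<in> extensional ({..<n} \<times> {..<n})" using main[OF y(1)] by (rule conjunct2)
    fix x assume "x \<in> {..<n} \<times> {..<n}"
    then obtain i j where x: "x = (i, j)" "i < n" "j < n" by blast
    have "tower_flag_type ns (i, j) \<le> y (i, j)" "y (i, j) \<le> tower_flag_type ns (i, j)"
      using main[OF y(1)] y(2) x(2,3) unfolding flag_type_le_def by blast+
    then show "y x = tower_flag_type ns x" using x(1) by simp
  qed (rule T_ext)
qed

end
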